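(* Let $b\ge2$ be an integer, let $W(x)=\sum_{n=1}^\infty \frac{\mathcal{W}_b(1,n)}{n!}x^n$, let $\theta$ be the unique positive real solution of $W(\theta)=1$, and set $\nu=1/\theta$. Then $$M(n)/n!\le \nu^n$$ for all $n\ge1$, and the constant is optimal: we have the more precise asymptotic formula $$M(n)/n! = \lambda\, n^{-1/2}\,\nu^n\bigl(1+O(n^{-1/2})\bigr) \quad (n\to\infty)$$ with $\lambda=(b-1)\left(\theta\, W'(\theta)\,\sigma\sqrt{2\pi}\right)^{-1}$, where $\sigma>0$ is defined by $$\sigma^2=\frac{W''(\theta)}{\theta\, W'(\theta)^3}+\frac{1}{\theta^2\, W'(\theta)^2}-\frac{1}{\theta\, W'(\theta)}.$$ Moreover, the maximum $M(n)=\max_{s\ge1}\mathcal{W}_b(s,n)$ is attained at $s=\mu n+O(1)$ with the constant $\mu=\left(\theta\, W'(\theta)\right)^{-1}$.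
   Context: $\mathbb{N}_0$ denotes the nonnegative integers. For an integer $b\ge2$ and positive integers $\ell,n$, let $$\mathcal{U}_b(\ell,n)=\#\{(a_1,\ldots,a_n)\in\mathbb{N}_0^n : b^{a_1}+\cdots+b^{a_n}=\ell\}.$$ For a positive integer $s$, $\mathcal{W}_b(s,n)$ is the maximum of $\mathcal{U}_b(\ell,n)$ over all positive integers $\ell$ whose $b$-ary sum of digits equals $s$ (it is $0$ if there are no representations). Further, $$M(n)=M_b(n)=\max_{\ell\ge1}\,\mathcal{U}_b(\ell,n)=\max_{s\ge1}\,\mathcal{W}_b(s,n).$$ The implied constants in the $O$-terms may depend on $b$. *)

theory Defs
  imports "HOL-Analysis.Analysis" "HOL-Library.Landau_Symbols"
begin

text \<open>The \<open>n\<close>-tuples are lists of length \<open>n\<close>; for \<open>b \<ge> 2\<close> the set of them is finite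
  (lemma \<open>finite_power_reps\<close>), so that \<^const>\<open>card\<close> counts it.\<close>

definition power_reps :: "nat \<Rightarrow> nat \<Rightarrow> nat \<Rightarrow> nat list set" where
  "power_reps b l n = {a. length a = n \<and> (\<Sum>x\<leftarrow>a. b ^ x) = l}"

definition U :: "nat \<Rightarrow> nat \<Rightarrow> nat \<Rightarrow> nat" where
  "U b l n = card (power_reps b l n)"

text \<open>For \<open>b < 2\<close>, where there is no \<open>b\<close>-ary expansion, the value is a dummy that makes the
  recursion terminate.\<close>

fun digit_sum :: "nat \<Rightarrow> nat \<Rightarrow> nat" where
  "digit_sum b l = (if b < 2 \<or> l = 0 then 0 else l mod b + digit_sum b (l div b))"

declare digit_sum.simps [simp del]

text \<open>Both maxima are over infinitely many \<open>l\<close>. The sets of values are finite and, for \<open>s \<ge> 1\<close>,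
  nonempty, so that \<^const>\<open>Max\<close> is meaningful (lemmas \<open>finite_U_values\<close>, \<open>ex_digit_sum\<close>).\<close>

definition W :: "nat \<Rightarrow> nat \<Rightarrow> nat \<Rightarrow> nat" where
  "W b s n = Max ((\<lambda>l. U b l n) ` {l. l \<ge> 1 \<and> digit_sum b l = s})"

definition M :: "nat \<Rightarrow> nat \<Rightarrow> nat" where
  "M b n = Max ((\<lambda>l. U b l n) ` {1..})"

text \<open>The sum \<^const>\<open>infsum\<close> is \<open>0\<close> when the family is not summable. All terms are nonnegative for
  \<open>x > 0\<close>, so an equation \<open>W_gf b x = 1\<close> includes convergence of the series at \<open>x\<close>.\<close>

definition W_gf :: "nat \<Rightarrow> real \<Rightarrow> real" where
  "W_gf b x = (\<Sum>\<^sub>\<infinity>n\<in>{1..}. real (W b 1 n) / fact n * x ^ n)"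


lemma exponent_less_of_mem:
  assumes "b \<ge> 2" "a \<in> power_reps b l n" "x \<in> set a"
  shows "x < l"
proof -
  have "b ^ x \<le> (\<Sum>x\<leftarrow>a. b ^ x)"
    using assms(3) by (intro member_le_sum_list) auto
  moreover have "x < b ^ x"
    using assms(1) by (intro power_gt_expt) auto
  ultimately show ?thesis
    using assms(2) by (auto simp: power_reps_def)
qed

lemma finite_power_reps:
  assumes "b \<ge> 2"
  shows "finite (power_reps b l n)"
proof (rule finite_subset)
  show "power_reps b l n \<subseteq> {a. set a \<subseteq> {..<l} \<and> length a = n}"
    using exponent_less_of_mem[OF assms] by (auto simp: power_reps_def)
  show "finite {a. set a \<subseteq> {..<l} \<and> length a = n}"
    by (rule finite_lists_length_eq) auto
qed

lemma U_bounded: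
  assumes "b \<ge> 2"
  shows "\<exists>C. \<forall>l. U b l n \<le> C"
proof (induction n)
  case 0
  have "U b l 0 \<le> 1" for l
    using card_mono[of "{[]}" "power_reps b l 0"] by (auto simp: U_def power_reps_def)
  then show ?case by blast
next
  case (Suc n)
  then obtain C where C: "\<And>l. U b l n \<le> C" by blast
  have "U b l (Suc n) \<le> Suc n * (Suc n * C)" for l
  proof -
    define E where "E = {e. b ^ e \<le> l \<and> l \<le> Suc n * b ^ e}"
    have E: "finite E \<and> card E \<le> Suc n"
    proof (cases "E = {}")
      case False
      define m where "m = (LEAST e. e \<in> E)"
      have m: "m \<in> E" using False unfolding m_def by (metis LeastI all_not_in_conv)
      have "E \<subseteq> {m..<m + Suc n}"
      proof
        fix e assume e: "e \<in> E"
        have me: "m \<le> e" unfolding m_def by (rule Least_le) (rule e)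
        have "b ^ m * b ^ (e - m) = b ^ e" using me by (simp flip: power_add)
        also have "\<dots> \<le> b ^ m * Suc n" using e m by (simp add: E_def mult.commute)
        finally have "b ^ (e - m) \<le> Suc n" using assms by (simp del: mult_Suc_right)
        moreover have "e - m < b ^ (e - m)" using assms by (intro power_gt_expt) auto
        ultimately show "e \<in> {m..<m + Suc n}" using me by auto
      qed
      then show ?thesis
        using card_mono[of "{m..<m + Suc n}" E] finite_subset by fastforce
    qed simp
    define B where "B = (SIGMA i:{..n}. SIGMA e:E. power_reps b (l - b ^ e) n)"
    define ins where "ins = (\<lambda>(i, e, a). take i a @ e # drop i (a :: nat list))"
    have finB: "finite B"
      unfolding B_def using E finite_power_reps[OF assms] by auto
    have "power_reps b l (Suc n) \<subseteq> ins ` B"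
    proof
      fix a assume a: "a \<in> power_reps b l (Suc n)"
      have len: "length a = Suc n" and suml: "(\<Sum>x\<leftarrow>a. b ^ x) = l"
        using a by (auto simp: power_reps_def)
      define e where "e = Max (set a)"
      have ein: "e \<in> set a" unfolding e_def using len by (intro Max_in) auto
      then obtain i where i: "i < length a" "a ! i = e" by (auto simp: in_set_conv_nth)
      define a' where "a' = take i a @ drop (Suc i) a"
      have split: "a = take i a @ e # drop (Suc i) a"
        using i id_take_nth_drop by blast
      have "l = b ^ e + (\<Sum>x\<leftarrow>a'. b ^ x)"
        unfolding suml[symmetric] a'_def by (subst split) simp
      moreover have "length a' = n" using i len by (simp add: a'_def)
      ultimately have "a' \<in> power_reps b (l - b ^ e) n" by (simp add: power_reps_def)
      moreover have "b ^ e \<le> l" using \<open>l = b ^ e + _\<close> by simp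
      moreover have "l \<le> Suc n * b ^ e"
      proof -
        have "(\<Sum>x\<leftarrow>a. b ^ x) \<le> (\<Sum>x\<leftarrow>a. b ^ e)"
          using assms by (intro sum_list_mono power_increasing) (auto simp: e_def)
        then show ?thesis using len suml by (simp add: sum_list_triv)
      qed
      moreover have "a = ins (i, e, a')"
        using split i by (simp add: ins_def a'_def)
      ultimately show "a \<in> ins ` B"
        using i len by (auto simp: B_def E_def intro!: image_eqI[where x = "(i, e, a')"])
    qed
    then have "U b l (Suc n) \<le> card B"
      unfolding U_def using finB by (meson card_image_le card_mono finite_imageI le_trans)
    also have "card B = Suc n * (\<Sum>e\<in>E. U b (l - b ^ e) n)"
      unfolding B_def U_def using E finite_power_reps[OF assms] by (subst card_SigmaI) auto
    also have "(\<Sum>e\<in>E. U b (l - b ^ e) n) \<le> card E * C"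
      using sum_bounded_above[of E "\<lambda>e. U b (l - b ^ e) n" C] C by simp
    also have "\<dots> \<le> Suc n * C" using E by (intro mult_right_mono) auto
    finally show ?thesis by (simp del: mult_Suc mult_Suc_right)
  qed
  then show ?case by blast
qed

lemma finite_U_values:
  assumes "b \<ge> 2"
  shows "finite ((\<lambda>l. U b l n) ` A)"
proof -
  obtain C where "\<And>l. U b l n \<le> C" using U_bounded[OF assms] by blast
  then have "(\<lambda>l. U b l n) ` A \<subseteq> {..C}" by auto
  then show ?thesis by (rule finite_subset) simp
qed

lemma ex_digit_sum:
  assumes "b \<ge> 2" "s \<ge> 1"
  shows "\<exists>l\<ge>1. digit_sum b l = s"
  using assms(2)
proof (induction s rule: nat_induct_at_least)
  case base
  have "digit_sum b 1 = 1"
    using assms(1) by (subst digit_sum.simps) (simp add: digit_sum.simps)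
  then show ?case by blast
next
  case (Suc s)
  then obtain l where "digit_sum b l = s" by blast
  moreover have "(b * l + 1) mod b = 1" "(b * l + 1) div b = l"
    using assms(1) mod_mult_self4[of b l 1] div_mult_self4[of b l 1] by auto
  ultimately have "digit_sum b (b * l + 1) = Suc s"
    using assms(1) by (subst digit_sum.simps) simp
  then show ?case by (metis le_add2)
qed

lemma digit_sum_pos:
  assumes "b \<ge> 2" "l \<ge> 1"
  shows "digit_sum b l \<ge> 1"
  using assms(2)
proof (induction l rule: less_induct)
  case (less l)
  show ?case
  proof (cases "l < b")
    case True
    then show ?thesis using less.prems assms(1) by (subst digit_sum.simps) auto
  next
    case False
    then have "l div b \<ge> 1" "l div b < l"
      using assms(1) by (auto simp: Suc_le_eq div_greater_zero_iff)
    from less.IH[OF this(2,1)] show ?thesis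
      using less.prems assms(1) by (subst digit_sum.simps) auto
  qed
qed

lemma M_eq_Max_W:
  assumes "b \<ge> 2"
  shows "M b n = Max ((\<lambda>s. W b s n) ` {1..})"
proof -
  let ?A = "\<lambda>s. {l. l \<ge> 1 \<and> digit_sum b l = s}"
  have W_in: "W b s n \<in> (\<lambda>l. U b l n) ` ?A s" if "s \<ge> 1" for s
    unfolding W_def using finite_U_values[OF assms] ex_digit_sum[OF assms that]
    by (intro Max_in) auto
  have "(\<lambda>s. W b s n) ` {1..} \<subseteq> (\<lambda>l. U b l n) ` {1..}" using W_in by fastforce
  then have fin: "finite ((\<lambda>s. W b s n) ` {1..})"
    using finite_U_values[OF assms] finite_subset by blast
  show ?thesis
  proof (rule antisym)
    have "M b n \<in> (\<lambda>l. U b l n) ` {1..}"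
      unfolding M_def using finite_U_values[OF assms] by (intro Max_in) auto
    then obtain l where l: "l \<ge> 1" "M b n = U b l n" by auto
    have "U b l n \<le> W b (digit_sum b l) n"
      unfolding W_def using finite_U_values[OF assms] l by (intro Max_ge) auto
    also have "\<dots> \<le> Max ((\<lambda>s. W b s n) ` {1..})"
      using fin digit_sum_pos[OF assms l(1)] by (intro Max_ge) auto
    finally show "M b n \<le> Max ((\<lambda>s. W b s n) ` {1..})" using l by simp
    show "Max ((\<lambda>s. W b s n) ` {1..}) \<le> M b n"
      unfolding M_def using finite_U_values[OF assms] \<open>_ \<subseteq> _\<close> by (intro Max_mono) auto
  qed
qed

end

theory Submission
  imports Defs
    "HOL-Probability.Characteristic_Functions"
    "HOL-Real_Asymp.Real_Asymp"
    "HOL-Computational_Algebra.Formal_Laurent_Series"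
begin

text \<open>Splitting off the top power of \<open>b\<close> from a representation, and using numbers whose digits are
  far apart for the converse, gives \<open>W b s n / n! = [x^n] W(x)^s\<close>, where \<open>W(x)\<close> is the exponential
  generating function of \<open>W b 1\<close>. With \<open>W(\<theta>) = 1\<close>, the number \<open>\<theta>^n W b s n / n!\<close> is
  therefore the probability that a random walk with step weights \<open>W b 1 k \<theta>^k / k!\<close> is at \<open>n\<close> after
  \<open>s\<close> steps. It is at most \<open>1\<close>, and the steps lie in \<open>1 + (b - 1) \<nat>\<close>. A local limit theorem with
  error \<open>O((1 + |t|) s^(-3/2))\<close> at distance \<open>t\<close> from the mean shows that it is maximal for
  \<open>s = \<mu> n + O(1)\<close> and yields the asymptotic value there; values of \<open>s\<close> far from \<open>\<mu> n\<close> are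
  excluded by a Chernoff bound.\<close>

unbundle no vec_syntax
unbundle fps_syntax

section \<open>Representations and powers of the generating function\<close>

text \<open>The root of W(\<theta>) = 1 has to lie strictly inside the disc of convergence: only
  then do the steps have the exponential moments behind the error terms and the Chernoff bound. The
  coefficients have no closed form, so this is obtained from two explicit estimates: a supersolution
  of a recursion over the exponents gives convergence at some \<open>x0\<close>, and a few
  coefficients already push the series above 1 at a smaller \<open>x1\<close>. The gap is narrow for
  \<open>b = 2\<close> and \<open>b = 3\<close>, whence the numerical constants there. Locating the
  maximum up to O(1) rests on the shape of the error term. At distance \<open>t\<close> from N = n /
  A, where \<open>A\<close> is the mean step, the normalised profile is at most exp(- a t^2 / N) + C
  (1 + |t|) / N, while some lattice point near N gives at least 1 - O(1 / N). So a maximiser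
  satisfies t^2 = O(1 + |t|), hence t = O(1). A uniform relative error of order N^(-1/2) would only
  give |t| = O(N^(1/4)). The same estimate yields the relative error O(1 / n) for
  \<open>M\<close>.\<close>

lemma sum_Pow_card:
  fixes h :: "nat \<Rightarrow> 'b::comm_semiring_1"
  assumes "finite S"
  shows "(\<Sum>I\<in>Pow S. h (card I)) = (\<Sum>k\<le>card S. of_nat (card S choose k) * h k)"
proof -
  have "(\<Sum>I\<in>Pow S. h (card I)) = (\<Sum>k\<le>card S. \<Sum>I\<in>{I \<in> Pow S. card I = k}. h (card I))"
    using assms by (intro sum.group[symmetric]) (auto intro: card_mono)
  also have "\<dots> = (\<Sum>k\<le>card S. of_nat (card S choose k) * h k)"
  proof (rule sum.cong[OF refl])
    fix k
    have "card {I \<in> Pow S. card I = k} = card S choose k"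
      using n_subsets[OF assms, of k] by (simp add: Pow_def conj_commute)
    then show "(\<Sum>I\<in>{I \<in> Pow S. card I = k}. h (card I)) = of_nat (card S choose k) * h k"
      by simp
  qed
  finally show ?thesis .
qed

text \<open>Representations are indexed by an arbitrary finite set instead of list positions, so
  that restricting one to a subset of positions gives an object of the same kind.\<close>

definition reps :: "nat \<Rightarrow> nat set \<Rightarrow> nat \<Rightarrow> (nat \<Rightarrow> nat) set" where
  "reps b S l = {f \<in> S \<rightarrow>\<^sub>E UNIV. (\<Sum>i\<in>S. b ^ f i) = l}"

lemma card_reps:
  assumes "finite S"
  shows "card (reps b S l) = U b l (card S)"
proof -
  obtain xs where xs: "distinct xs" "set xs = S" using finite_distinct_list[OF assms] by blast
  have len: "length xs = card S" using xs distinct_card by fastforce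
  have sum_xs: "(\<Sum>i\<in>S. g i) = (\<Sum>i\<leftarrow>xs. g i)" for g :: "nat \<Rightarrow> nat"
    using sum_list_distinct_conv_sum_set[OF xs(1)] xs(2) by metis
  have "bij_betw (\<lambda>f. map f xs) (reps b S l) (power_reps b l (card S))"
  proof (rule bij_betw_imageI)
    show "inj_on (\<lambda>f. map f xs) (reps b S l)"
    proof (rule inj_onI)
      fix f g assume f: "f \<in> reps b S l" and g: "g \<in> reps b S l" and e: "map f xs = map g xs"
      have "\<And>i. i \<in> S \<Longrightarrow> f i = g i" using e xs by auto
      then show "f = g" using f g by (auto simp: reps_def intro: PiE_ext)
    qed
    show "(\<lambda>f. map f xs) ` reps b S l = power_reps b l (card S)"
    proof safe
      fix f assume "f \<in> reps b S l"
      then show "map f xs \<in> power_reps b l (card S)"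
        by (simp add: reps_def power_reps_def sum_xs len comp_def)
    next
      fix a assume a: "a \<in> power_reps b l (card S)"
      have la: "length a = length xs" and sa: "(\<Sum>x\<leftarrow>a. b ^ x) = l"
        using a len by (auto simp: power_reps_def)
      define f where "f = restrict (\<lambda>i. the (map_of (zip xs a) i)) S"
      have map_f: "map f xs = a"
      proof (rule nth_equalityI)
        fix i assume "i < length (map f xs)"
        then show "map f xs ! i = a ! i"
          using la xs nth_mem[of i xs] by (simp add: f_def map_of_zip_nth)
      qed (use la in simp)
      moreover have "f \<in> reps b S l"
      proof -
        have "(\<Sum>i\<in>S. b ^ f i) = (\<Sum>x\<leftarrow>map f xs. b ^ x)" by (simp add: sum_xs comp_def)
        then show ?thesis unfolding map_f using sa by (simp add: reps_def) (simp add: f_def)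
      qed
      ultimately show "a \<in> (\<lambda>f. map f xs) ` reps b S l" using map_f by blast
    qed
  qed
  then show ?thesis by (simp add: bij_betw_same_card U_def)
qed

lemma finite_reps:
  assumes "b \<ge> 2" "finite S"
  shows "finite (reps b S l)"
proof -
  have "reps b S l \<subseteq> S \<rightarrow>\<^sub>E {..l}"
  proof
    fix f assume f: "f \<in> reps b S l"
    have "f i \<le> l" if "i \<in> S" for i
    proof -
      have "f i < b ^ f i" using assms(1) by (intro power_gt_expt) auto
      also have "b ^ f i \<le> (\<Sum>i\<in>S. b ^ f i)" using that assms by (intro member_le_sum) auto
      finally show ?thesis using f by (auto simp: reps_def)
    qed
    then show "f \<in> S \<rightarrow>\<^sub>E {..l}" using f by (auto simp: reps_def PiE_iff)
  qed
  then show ?thesis using assms(2) finite_subset finite_PiE by (metis finite_atMost)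
qed

text \<open>Positions are labelled, so distributing them between two independent representations
  costs a binomial coefficient; the exponential normalisation turns this into a product of
  series.\<close>

definition U_fps :: "nat \<Rightarrow> nat \<Rightarrow> real fps" where
  "U_fps b l = Abs_fps (\<lambda>n. real (U b l n) / fact n)"

lemma U_fps_nonneg: "U_fps b l $ n \<ge> 0" by (simp add: U_fps_def)

lemma fact_mult_fps_nth_egf_mult:
  "fact n * (Abs_fps (\<lambda>n. f n / fact n) * Abs_fps (\<lambda>n. g n / fact n)) $ n =
    (\<Sum>k\<le>n. real (n choose k) * (f k * g (n - k) :: real))"
  unfolding fps_mult_nth sum_distrib_left atLeast0AtMost
  by (rule sum.cong) (simp_all add: binomial_fact field_simps)

text \<open>Every representation of \<open>l1 + l2\<close> arises by gluing one of \<open>l1\<close>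
  on some \<open>I\<close> and one of \<open>l2\<close> on the complement. The set \<open>I\<close>
  need not be unique, so gluing covers all representations without being injective, and only an
  upper bound results.\<close>

lemma U_le_U_fps_mult:
  assumes "b \<ge> 2"
  assumes split: "\<And>f. f \<in> reps b {..<n} (l1 + l2) \<Longrightarrow> \<exists>I\<subseteq>{..<n}. (\<Sum>i\<in>I. b ^ f i) = l1"
  shows "real (U b (l1 + l2) n) / fact n \<le> (U_fps b l1 * U_fps b l2) $ n"
proof -
  let ?S = "{..<n}"
  let ?B = "SIGMA I:Pow ?S. reps b I l1 \<times> reps b (?S - I) l2"
  have finsub: "finite I" if "I \<subseteq> ?S" for I using that finite_subset by blast
  have "reps b ?S (l1 + l2) \<subseteq> (\<lambda>(I, g, h). \<lambda>i\<in>?S. if i \<in> I then g i else h i) ` ?B"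
  proof
    fix f assume f: "f \<in> reps b ?S (l1 + l2)"
    from split[OF this] obtain I where I: "I \<subseteq> ?S" "(\<Sum>i\<in>I. b ^ f i) = l1" by blast
    have "(\<Sum>i\<in>?S. b ^ f i) = (\<Sum>i\<in>I. b ^ f i) + (\<Sum>i\<in>?S - I. b ^ f i)"
      using I(1) by (simp add: sum.subset_diff add.commute)
    then have "(\<Sum>i\<in>?S - I. b ^ f i) = l2" using f I(2) by (auto simp: reps_def)
    then have "(I, restrict f I, restrict f (?S - I)) \<in> ?B" using I by (auto simp: reps_def)
    moreover have "f = (\<lambda>i\<in>?S. if i \<in> I then restrict f I i else restrict f (?S - I) i)"
      using f by (auto simp: reps_def fun_eq_iff PiE_def extensional_def)
    ultimately show "f \<in> (\<lambda>(I, g, h). \<lambda>i\<in>?S. if i \<in> I then g i else h i) ` ?B"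
      by (intro image_eqI[where x = "(I, restrict f I, restrict f (?S - I))"]) auto
  qed
  moreover have finB: "finite ?B" using finite_reps[OF assms(1)] finsub by (intro finite_SigmaI) auto
  ultimately have "card (reps b ?S (l1 + l2)) \<le> card ?B"
    by (meson card_image_le card_mono finite_imageI le_trans)
  also have "card ?B = (\<Sum>I\<in>Pow ?S. card (reps b I l1) * card (reps b (?S - I) l2))"
    using finite_reps[OF assms(1)] finsub by (subst card_SigmaI) (auto simp: card_cartesian_product)
  also have "\<dots> = (\<Sum>I\<in>Pow ?S. U b l1 (card I) * U b l2 (n - card I))"
    using finsub by (intro sum.cong) (auto simp: card_reps card_Diff_subset)
  also have "\<dots> = (\<Sum>k\<le>n. (n choose k) * (U b l1 k * U b l2 (n - k)))"
    using sum_Pow_card[of ?S "\<lambda>k. U b l1 k * U b l2 (n - k)"] by simp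
  finally have "real (U b (l1 + l2) n) \<le> real (\<Sum>k\<le>n. (n choose k) * (U b l1 k * U b l2 (n - k)))"
    unfolding card_reps[OF finite_lessThan] by (simp only: card_lessThan of_nat_le_iff)
  also have "\<dots> = fact n * (U_fps b l1 * U_fps b l2) $ n"
    unfolding U_fps_def fact_mult_fps_nth_egf_mult by simp
  finally show ?thesis by (simp add: field_simps)
qed

text \<open>A minimal subfamily with sum at least \<open>b ^ e\<close> overshoots by less than its smallest term, which
  divides everything in sight.\<close>

lemma ex_subset_sum_eq_power:
  fixes b e :: nat
  assumes "b \<ge> 2" "finite S" "\<And>i. i \<in> S \<Longrightarrow> f i \<le> e" "b ^ e \<le> (\<Sum>i\<in>S. b ^ f i)"
  shows "\<exists>I\<subseteq>S. (\<Sum>i\<in>I. b ^ f i) = b ^ e"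
proof -
  define P where "P = (\<lambda>I. I \<subseteq> S \<and> b ^ e \<le> (\<Sum>i\<in>I. b ^ f i))"
  have "P S" using assms by (simp add: P_def)
  then obtain I where I: "P I" and min: "\<And>J. P J \<Longrightarrow> card I \<le> card J"
    using ex_has_least_nat[of P S card] by blast
  have finI: "finite I" using I assms(2) by (auto simp: P_def intro: finite_subset)
  have "I \<noteq> {}" using I assms(1) by (auto simp: P_def)
  then have "Min (f ` I) \<in> f ` I" using finI by (intro Min_in) auto
  then obtain i where i: "i \<in> I" "f i = Min (f ` I)" by auto
  have fi: "f i \<le> f j" if "j \<in> I" for j using that finI i by auto
  have "\<not> P (I - {i})" using min[of "I - {i}"] i finI by (meson card_Diff1_less leD)
  then have lt: "(\<Sum>j\<in>I - {i}. b ^ f j) < b ^ e" using I by (auto simp: P_def)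
  have dvd: "b ^ f i dvd (\<Sum>j\<in>I - {i}. b ^ f j)"
    using fi by (intro dvd_sum le_imp_power_dvd) auto
  have "f i \<le> e" using i(1) I assms(3)[of i] by (auto simp: P_def)
  then have dvd2: "b ^ f i dvd b ^ e" by (rule le_imp_power_dvd)
  have "(\<Sum>j\<in>I - {i}. b ^ f j) + b ^ f i \<le> b ^ e"
  proof -
    have "b ^ f i dvd b ^ e - (\<Sum>j\<in>I - {i}. b ^ f j)" using dvd dvd2 by (rule dvd_diff_nat[rotated])
    then have "b ^ f i \<le> b ^ e - (\<Sum>j\<in>I - {i}. b ^ f j)" using lt by (intro dvd_imp_le) auto
    then show ?thesis using lt by linarith
  qed
  moreover have "(\<Sum>j\<in>I. b ^ f j) = (\<Sum>j\<in>I - {i}. b ^ f j) + b ^ f i"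
    using i finI by (simp add: sum.remove add.commute)
  ultimately show ?thesis using I by (intro exI[of _ I]) (auto simp: P_def)
qed

section \<open>Digit sums under concatenation and removal of the top power\<close>

lemma digit_sum_add_mult_power:
  assumes "b \<ge> 2" "r < b ^ e"
  shows "digit_sum b (c * b ^ e + r) = digit_sum b c + digit_sum b r"
  using assms(2)
proof (induction e arbitrary: r)
  case 0
  then show ?case by (simp add: digit_sum.simps)
next
  case (Suc e)
  have "r div b < b ^ e" using Suc.prems assms(1) by (simp add: less_mult_imp_div_less mult.commute)
  note IH = Suc.IH[OF this]
  have step: "digit_sum b x = x mod b + digit_sum b (x div b)" for x
    using assms(1) by (cases "x = 0") (simp_all add: digit_sum.simps)
  have "(c * b ^ Suc e + r) mod b = r mod b"
    by (metis mod_mult_self3 mult.assoc mult.commute power_Suc)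
  moreover have "(c * b ^ Suc e + r) div b = c * b ^ e + r div b"
  proof -
    have "c * b ^ Suc e + r = r + b * (c * b ^ e)" by simp
    then show ?thesis using assms(1) by (metis add.commute div_mult_self2 not_numeral_le_zero)
  qed
  ultimately show ?case using IH step[of "c * b ^ Suc e + r"] step[of r] by simp
qed

lemma digit_sum_less:
  assumes "b \<ge> 2" "c < b"
  shows "digit_sum b c = c"
  using assms by (simp add: digit_sum.simps[of b c] digit_sum.simps[of b 0])

lemma digit_sum_power: "b \<ge> 2 \<Longrightarrow> digit_sum b (b ^ e) = 1"
  using digit_sum_add_mult_power[of b 0 e 1] digit_sum_less[of b 1] digit_sum_less[of b 0] by simp

lemma ex_power_le_less:
  assumes "b \<ge> 2" "(l::nat) \<ge> 1"
  shows "\<exists>e. b ^ e \<le> l \<and> l < b ^ Suc e"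
  using ex_power_ivl1[of b l] assms by auto

text \<open>Subtracting \<open>b ^ e\<close> lowers the leading digit by one without a borrow, since
  that digit is at least 1.\<close>

lemma digit_sum_minus_top:
  assumes "b \<ge> 2" "b ^ e \<le> l" "l < b ^ Suc e"
  shows "digit_sum b l = Suc (digit_sum b (l - b ^ e))"
proof -
  define c r where "c = l div b ^ e" and "r = l mod b ^ e"
  have r: "r < b ^ e" using assms(1) by (simp add: r_def)
  have l: "l = c * b ^ e + r" unfolding c_def r_def by (rule div_mult_mod_eq[symmetric])
  have c: "c \<ge> 1" "c < b"
    using assms by (auto simp: c_def Suc_le_eq div_greater_zero_iff less_mult_imp_div_less)
  have "l - b ^ e = (c - 1) * b ^ e + r"
    using c by (simp add: l diff_mult_distrib)
  then show ?thesis
    using c unfolding l by (simp add: digit_sum_add_mult_power[OF assms(1) r] digit_sum_less assms(1))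
qed

lemma digit_sum_eq_0_iff: "b \<ge> 2 \<Longrightarrow> digit_sum b l = 0 \<longleftrightarrow> l = 0"
  using digit_sum_pos[of b l] by (cases "l = 0") (auto simp: digit_sum.simps[of b 0])

lemma digit_sum_eq_1_iff:
  assumes "b \<ge> 2"
  shows "digit_sum b l = 1 \<longleftrightarrow> (\<exists>e. l = b ^ e)"
proof
  assume d: "digit_sum b l = 1"
  then have "l \<ge> 1" using digit_sum_eq_0_iff[OF assms, of l] by (cases l) auto
  then obtain e where e: "b ^ e \<le> l" "l < b ^ Suc e" using ex_power_le_less assms by blast
  then have "l - b ^ e = 0"
    using digit_sum_minus_top[OF assms e] d digit_sum_eq_0_iff[OF assms] by simp
  then show "\<exists>e. l = b ^ e" using e by (metis diff_is_0_eq le_antisym)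
qed (use digit_sum_power[OF assms] in auto)

lemma U_le_W:
  assumes "b \<ge> 2" "l \<ge> 1"
  shows "U b l n \<le> W b (digit_sum b l) n"
  unfolding W_def using finite_U_values[OF assms(1)] assms(2) by (intro Max_ge) auto

lemma U_0: "b \<ge> 2 \<Longrightarrow> U b 0 n = (if n = 0 then 1 else 0)"
proof (cases n)
  case 0
  have "power_reps b 0 0 = {[]}" by (auto simp: power_reps_def)
  then show ?thesis using 0 by (simp add: U_def)
next
  case (Suc m)
  assume b: "b \<ge> 2"
  have "power_reps b 0 n = {}"
    using b Suc by (auto simp: power_reps_def length_Suc_conv)
  then show ?thesis using Suc by (simp add: U_def)
qed

section \<open>The maximum for digit sum \<open>s\<close> as a coefficient of a power\<close>

definition W_fps :: "nat \<Rightarrow> real fps" where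
  "W_fps b = Abs_fps (\<lambda>n. real (W b 1 n) / fact n)"

lemma fps_nth_power_nonneg:
  fixes f :: "'a::linordered_semidom fps"
  assumes "\<And>n. f $ n \<ge> 0"
  shows "(f ^ s) $ n \<ge> 0"
  using assms by (induction s arbitrary: n) (auto simp: fps_mult_nth intro!: sum_nonneg)

lemma W_fps_nonneg: "W_fps b $ n \<ge> 0" by (simp add: W_fps_def)

text \<open>As \<open>l < b ^ Suc e\<close>, no part exceeds \<open>b ^ e\<close>, so
  \<open>ex_subset_sum_eq_power\<close> finds parts with sum exactly \<open>b ^ e\<close>. The
  others represent \<open>l - b ^ e\<close>, whose digit sum is smaller by one, and each such split
  contributes one factor \<open>W_fps b\<close>.\<close>

lemma U_le_W_fps_power:
  assumes "b \<ge> 2"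
  shows "real (U b l n) / fact n \<le> (W_fps b ^ digit_sum b l) $ n"
proof (induction l arbitrary: n rule: less_induct)
  case (less l)
  show ?case
  proof (cases "l = 0")
    case True
    then show ?thesis using U_0[OF assms] digit_sum_eq_0_iff[OF assms, of 0] by simp
  next
    case False
    then obtain e where e: "b ^ e \<le> l" "l < b ^ Suc e" using ex_power_le_less[OF assms, of l] by auto
    define r where "r = l - b ^ e"
    have l: "l = b ^ e + r" using e by (simp add: r_def)
    have "r < l" using assms False by (simp add: r_def)
    have "real (U b l n) / fact n \<le> (U_fps b (b ^ e) * U_fps b r) $ n"
      unfolding l
    proof (rule U_le_U_fps_mult[OF assms])
      fix f assume f: "f \<in> reps b {..<n} (b ^ e + r)"
      have "f i \<le> e" if "i \<in> {..<n}" for i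
      proof -
        have "b ^ f i \<le> (\<Sum>i\<in>{..<n}. b ^ f i)" using that by (intro member_le_sum) auto
        also have "\<dots> < b ^ Suc e" using f e l by (simp add: reps_def)
        finally show ?thesis using assms by (simp del: power_Suc)
      qed
      then show "\<exists>I\<subseteq>{..<n}. (\<Sum>i\<in>I. b ^ f i) = b ^ e"
        using f by (intro ex_subset_sum_eq_power[OF assms]) (auto simp: reps_def)
    qed
    also have "\<dots> \<le> (W_fps b * W_fps b ^ digit_sum b r) $ n"
      unfolding fps_mult_nth
    proof (rule sum_mono)
      fix i
      have "U_fps b (b ^ e) $ i \<le> W_fps b $ i"
        using U_le_W[OF assms, of "b ^ e" i] assms
        by (simp add: U_fps_def W_fps_def digit_sum_power divide_right_mono)
      moreover have "U_fps b r $ (n - i) \<le> (W_fps b ^ digit_sum b r) $ (n - i)"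
        using less.IH[OF \<open>r < l\<close>] by (simp add: U_fps_def)
      ultimately show "U_fps b (b ^ e) $ i * U_fps b r $ (n - i)
          \<le> W_fps b $ i * (W_fps b ^ digit_sum b r) $ (n - i)"
        by (intro mult_mono) (auto simp: W_fps_nonneg U_fps_def)
    qed
    also have "W_fps b * W_fps b ^ digit_sum b r = W_fps b ^ digit_sum b l"
      using digit_sum_minus_top[OF assms e] by (simp add: r_def)
    finally show ?thesis .
  qed
qed

text \<open>Raising every exponent by one multiplies the sum by \<open>b\<close> and is
  injective.\<close>

lemma U_power_mono:
  assumes "b \<ge> 2" "e \<le> e'"
  shows "U b (b ^ e) n \<le> U b (b ^ e') n"
  using assms(2)
proof (induction rule: dec_induct)
  case (step k)
  have "map Suc ` power_reps b (b ^ k) n \<subseteq> power_reps b (b ^ Suc k) n"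
    by (auto simp: power_reps_def comp_def sum_list_const_mult)
  then have "U b (b ^ k) n \<le> U b (b ^ Suc k) n"
    unfolding U_def by (intro card_inj_on_le[of "map Suc"] finite_power_reps assms) (auto simp: inj_on_def)
  then show ?case using step by simp
qed simp

text \<open>The numbers of digit sum 1 are the powers of \<open>b\<close>, and their counts increase
  with the exponent, so the maximum is the eventual value. A common threshold for all
  \<open>k \<le> n\<close> is wanted because a coefficient of a product involves all lower
  ones.\<close>

lemma W_1_eq_U_power:
  assumes "b \<ge> 2"
  shows "\<exists>E. \<forall>e\<ge>E. \<forall>k\<le>n. U b (b ^ e) k = W b 1 k"
proof -
  have "\<exists>E. \<forall>e\<ge>E. U b (b ^ e) k = W b 1 k" for k
  proof -
    have "W b 1 k \<in> (\<lambda>l. U b l k) ` {l. l \<ge> 1 \<and> digit_sum b l = 1}"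
      unfolding W_def using finite_U_values[OF assms] ex_digit_sum[OF assms, of 1]
      by (intro Max_in) auto
    then obtain E where E: "W b 1 k = U b (b ^ E) k"
      using digit_sum_eq_1_iff[OF assms] by auto
    have "U b (b ^ e) k = W b 1 k" if "e \<ge> E" for e
      using U_power_mono[OF assms that, of k] U_le_W[OF assms, of "b ^ e" k] E assms
      by (simp add: digit_sum_power)
    then show ?thesis by blast
  qed
  then obtain E where E: "\<And>k e. e \<ge> E k \<Longrightarrow> U b (b ^ e) k = W b 1 k" by metis
  have "U b (b ^ e) k = W b 1 k" if "e \<ge> Max (E ` {..n})" "k \<le> n" for e k
    using that E by (meson Max_ge atMost_iff dual_order.trans finite_atMost finite_imageI imageI)
  then show ?thesis by blast
qed

text \<open>If the top power \<open>b ^ (E + d)\<close> is represented by exponents \<open>\<ge> d\<close> only, then its parts can be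
  told apart from those of \<open>l < b ^ d\<close>.\<close>

lemma U_fps_mult_le_U:
  assumes "b \<ge> 2" "l < b ^ d"
  shows "(U_fps b (b ^ E) * U_fps b l) $ n \<le> real (U b (b ^ (E + d) + l) n) / fact n"
proof -
  let ?S = "{..<n}"
  let ?B = "SIGMA I:Pow ?S. reps b I (b ^ E) \<times> reps b (?S - I) l"
  define F where "F = (\<lambda>(I, g, h). \<lambda>i\<in>?S. if i \<in> I then g i + d else h i :: nat)"
  have finsub: "finite I" if "I \<subseteq> ?S" for I using that finite_subset by blast
  have small: "h i < d" if "h \<in> reps b J l" "i \<in> J" "finite J" for h i J
  proof -
    have "b ^ h i \<le> (\<Sum>i\<in>J. b ^ h i)" using that by (intro member_le_sum) auto
    also have "\<dots> < b ^ d" using that assms by (simp add: reps_def)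
    finally show ?thesis using assms(1) by simp
  qed
  have I_eq: "{i \<in> ?S. F (I, g, h) i \<ge> d} = I" if "(I, g, h) \<in> ?B" for I g h
    using that small[of h "?S - I"] by (force simp: F_def)
  have inj: "inj_on F ?B"
  proof (rule inj_onI)
    fix x y assume xy: "x \<in> ?B" "y \<in> ?B" "F x = F y"
    obtain I g h I' g' h' where x: "x = (I, g, h)" and y: "y = (I', g', h')"
      by (metis prod_cases3)
    have 1: "I \<in> Pow ?S" "g \<in> reps b I (b ^ E)" "h \<in> reps b (?S - I) l"
      and 2: "I' \<in> Pow ?S" "g' \<in> reps b I' (b ^ E)" "h' \<in> reps b (?S - I') l"
      and eq: "F (I, g, h) = F (I', g', h')"
      using xy unfolding x y by auto
    have I: "I' = I" using I_eq[of I g h] I_eq[of I' g' h'] 1 2 eq by auto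
    have pt: "F (I, g, h) i = F (I', g', h') i" for i using eq by simp
    have "g i = g' i" if "i \<in> I" for i using pt[of i] that 1(1) I by (auto simp: F_def)
    moreover have "h i = h' i" if "i \<in> ?S - I" for i using pt[of i] that I by (auto simp: F_def)
    ultimately show "x = y"
      using 1 2 I unfolding x y by (auto simp: reps_def intro!: PiE_ext[of g I "\<lambda>_. UNIV" g'] PiE_ext[of h "?S - I" "\<lambda>_. UNIV" h'])
  qed
  have sub: "F ` ?B \<subseteq> reps b ?S (b ^ (E + d) + l)"
  proof (rule image_subsetI)
    fix x assume "x \<in> ?B"
    then obtain I g h where x: "x = (I, g, h)"
      and 1: "I \<in> Pow ?S" "g \<in> reps b I (b ^ E)" "h \<in> reps b (?S - I) l" by blast
    have "(\<Sum>i\<in>?S. b ^ F (I, g, h) i) = (\<Sum>i\<in>I. b ^ F (I, g, h) i) + (\<Sum>i\<in>?S - I. b ^ F (I, g, h) i)"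
      using 1 by (simp add: sum.subset_diff add.commute)
    also have "(\<Sum>i\<in>I. b ^ F (I, g, h) i) = (\<Sum>i\<in>I. b ^ g i * b ^ d)"
      using 1(1) by (intro sum.cong) (auto simp: F_def power_add)
    also have "\<dots> = b ^ (E + d)"
      using 1(2) by (simp add: reps_def power_add flip: sum_distrib_right)
    also have "(\<Sum>i\<in>?S - I. b ^ F (I, g, h) i) = (\<Sum>i\<in>?S - I. b ^ h i)"
      by (intro sum.cong) (auto simp: F_def)
    also have "\<dots> = l" using 1(3) by (simp add: reps_def)
    finally show "F x \<in> reps b ?S (b ^ (E + d) + l)" unfolding x by (simp add: reps_def F_def)
  qed
  have "(\<Sum>k\<le>n. (n choose k) * (U b (b ^ E) k * U b l (n - k)))
      = (\<Sum>I\<in>Pow ?S. U b (b ^ E) (card I) * U b l (n - card I))"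
    using sum_Pow_card[of ?S "\<lambda>k. U b (b ^ E) k * U b l (n - k)"] by simp
  also have "\<dots> = (\<Sum>I\<in>Pow ?S. card (reps b I (b ^ E)) * card (reps b (?S - I) l))"
    using finsub by (intro sum.cong) (auto simp: card_reps card_Diff_subset)
  also have "\<dots> = card ?B"
    using finite_reps[OF assms(1)] finsub by (subst card_SigmaI) (auto simp: card_cartesian_product)
  also have "\<dots> \<le> card (reps b ?S (b ^ (E + d) + l))"
    using inj sub by (rule card_inj_on_le) (simp add: finite_reps assms)
  finally have "(\<Sum>k\<le>n. (n choose k) * (U b (b ^ E) k * U b l (n - k))) \<le> U b (b ^ (E + d) + l) n"
    by (simp only: card_reps[OF finite_lessThan] card_lessThan)
  then have "real (\<Sum>k\<le>n. (n choose k) * (U b (b ^ E) k * U b l (n - k))) \<le> real (U b (b ^ (E + d) + l) n)"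
    by (simp only: of_nat_le_iff)
  moreover have "real (\<Sum>k\<le>n. (n choose k) * (U b (b ^ E) k * U b l (n - k)))
      = fact n * (U_fps b (b ^ E) * U_fps b l) $ n"
    unfolding U_fps_def fact_mult_fps_nth_egf_mult by simp
  ultimately show ?thesis by (simp add: field_simps)
qed

text \<open>A new top digit is placed so far above \<open>l\<close> that
  \<open>U_fps_mult_le_U\<close> applies. The claim is limited to \<open>k \<le> n\<close> because
  the exponent \<open>E\<close>, at which the counts have stabilised, depends on
  \<open>n\<close>.\<close>

lemma ex_W_fps_power_le_U:
  assumes "b \<ge> 2"
  shows "\<exists>l. digit_sum b l = s \<and> (\<forall>k\<le>n. (W_fps b ^ s) $ k \<le> real (U b l k) / fact k)"
proof (induction s)
  case 0
  show ?case using U_0[OF assms] digit_sum_eq_0_iff[OF assms, of 0] by (intro exI[of _ 0]) auto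
next
  case (Suc s)
  then obtain l where l: "digit_sum b l = s" "\<And>k. k \<le> n \<Longrightarrow> (W_fps b ^ s) $ k \<le> real (U b l k) / fact k"
    by blast
  obtain E where E: "\<And>k. k \<le> n \<Longrightarrow> U b (b ^ E) k = W b 1 k" using W_1_eq_U_power[OF assms] by blast
  \<comment> \<open>Shifting by \<open>l\<close> itself is enough, as \<open>l < b ^ l\<close>; this
    also keeps the digits of \<open>l\<close> below the new top power.\<close>
  have ld: "l < b ^ l" using assms by (intro power_gt_expt) auto
  then have ld': "l < b ^ (E + l)" using assms by (meson le_add2 less_le_trans one_le_numeral order_trans power_increasing)
  have "digit_sum b (b ^ (E + l) + l) = Suc s"
    using digit_sum_add_mult_power[OF assms ld', of 1] digit_sum_less[of b 1] assms l(1) by simp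
  moreover have "(W_fps b ^ Suc s) $ k \<le> real (U b (b ^ (E + l) + l) k) / fact k" if "k \<le> n" for k
  proof -
    have "(W_fps b ^ Suc s) $ k \<le> (U_fps b (b ^ E) * U_fps b l) $ k"
      unfolding power_Suc fps_mult_nth
    proof (rule sum_mono)
      fix i assume i: "i \<in> {0..k}"
      have "W_fps b $ i = U_fps b (b ^ E) $ i" using E[of i] i that by (simp add: W_fps_def U_fps_def)
      moreover have "(W_fps b ^ s) $ (k - i) \<le> U_fps b l $ (k - i)"
        using l(2)[of "k - i"] that by (simp add: U_fps_def)
      ultimately show "W_fps b $ i * (W_fps b ^ s) $ (k - i) \<le> U_fps b (b ^ E) $ i * U_fps b l $ (k - i)"
        by (metis U_fps_nonneg mult_left_mono)
    qed
    also have "\<dots> \<le> real (U b (b ^ (E + l) + l) k) / fact k" by (rule U_fps_mult_le_U[OF assms ld])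
    finally show ?thesis .
  qed
  ultimately show ?case by blast
qed

lemma W_eq_W_fps_power:
  assumes "b \<ge> 2" "s \<ge> 1"
  shows "real (W b s n) / fact n = (W_fps b ^ s) $ n"
proof (rule antisym)
  have "W b s n \<in> (\<lambda>l. U b l n) ` {l. l \<ge> 1 \<and> digit_sum b l = s}"
    unfolding W_def using finite_U_values[OF assms(1)] ex_digit_sum[OF assms]
    by (intro Max_in) auto
  then obtain l where "digit_sum b l = s" "W b s n = U b l n" by auto
  then show "real (W b s n) / fact n \<le> (W_fps b ^ s) $ n"
    using U_le_W_fps_power[OF assms(1), of l n] by simp
  obtain l where l: "digit_sum b l = s" "(W_fps b ^ s) $ n \<le> real (U b l n) / fact n"
    using ex_W_fps_power_le_U[OF assms(1), of s n] by blast
  then have "l \<ge> 1" using assms digit_sum_eq_0_iff[OF assms(1), of l] by (cases l) auto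
  then have "U b l n \<le> W b s n" using U_le_W[OF assms(1)] l by blast
  then have "real (U b l n) / fact n \<le> real (W b s n) / fact n" by (simp add: divide_right_mono)
  then show "(W_fps b ^ s) $ n \<le> real (W b s n) / fact n" using l(2) by linarith
qed

section \<open>The radius of convergence\<close>

definition bounded_reps :: "nat \<Rightarrow> nat \<Rightarrow> nat set \<Rightarrow> nat \<Rightarrow> (nat \<Rightarrow> nat) set" where
  "bounded_reps b k S l = {f \<in> S \<rightarrow>\<^sub>E {..k}. (\<Sum>i\<in>S. b ^ f i) = l}"

lemma finite_bounded_reps: "finite S \<Longrightarrow> finite (bounded_reps b k S l)"
  unfolding bounded_reps_def by (rule finite_subset[of _ "S \<rightarrow>\<^sub>E {..k}"]) (auto intro: finite_PiE)

lemma card_bounded_reps_le: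
  assumes "finite S" "finite S'" "card S = card S'"
  shows "card (bounded_reps b k S l) \<le> card (bounded_reps b k S' l)"
proof -
  obtain h where h: "bij_betw h S' S" using assms finite_same_card_bij by metis
  have sum_h: "(\<Sum>i\<in>S'. g (h i)) = (\<Sum>i\<in>S. g i)" for g :: "nat \<Rightarrow> nat"
    using sum.reindex_bij_betw[OF h] .
  show ?thesis
  proof (rule card_inj_on_le)
    show "inj_on (\<lambda>f. restrict (f \<circ> h) S') (bounded_reps b k S l)"
    proof (rule inj_onI)
      fix f g assume fg: "f \<in> bounded_reps b k S l" "g \<in> bounded_reps b k S l"
        and e: "restrict (f \<circ> h) S' = restrict (g \<circ> h) S'"
      have "f i = g i" if "i \<in> S" for i
      proof -
        have "i \<in> h ` S'" using h that by (simp add: bij_betw_def)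
        then obtain j where j: "j \<in> S'" "i = h j" by blast
        then show ?thesis using fun_cong[OF e, of j] by simp
      qed
      then show "f = g" using fg by (auto simp: bounded_reps_def intro: PiE_ext)
    qed
    show "(\<lambda>f. restrict (f \<circ> h) S') ` bounded_reps b k S l \<subseteq> bounded_reps b k S' l"
    proof (rule image_subsetI)
      fix f assume f: "f \<in> bounded_reps b k S l"
      have "f (h i) \<le> k" if "i \<in> S'" for i
        using f bij_betwE[OF h] that by (auto simp: bounded_reps_def)
      then show "restrict (f \<circ> h) S' \<in> bounded_reps b k S' l"
        using f sum_h[of "\<lambda>i. b ^ f i"] by (simp add: bounded_reps_def PiE_iff)
    qed
  qed (rule finite_bounded_reps[OF assms(2)])
qed

text \<open>Subdividing top down: the parts \<open>b ^ k\<close> are removed from \<open>r * b ^ k\<close>, and the rest is a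
  multiple of \<open>b ^ (k - 1)\<close> to be represented by powers up to \<open>b ^ (k - 1)\<close>.\<close>

definition level_count :: "nat \<Rightarrow> nat \<Rightarrow> nat \<Rightarrow> nat \<Rightarrow> nat" where
  "level_count b k r n = card (bounded_reps b k {..<n} (r * b ^ k))"

lemma level_count_0: "level_count b 0 r n = (if n = r then 1 else 0)"
proof -
  have "bounded_reps b 0 {..<n} r = (if n = r then {\<lambda>i\<in>{..<n}. 0} else {})"
  proof -
    have "f \<in> bounded_reps b 0 {..<n} r \<longleftrightarrow> n = r \<and> f = (\<lambda>i\<in>{..<n}. 0)" for f
    proof -
      have "f \<in> {..<n} \<rightarrow>\<^sub>E {..0} \<longleftrightarrow> f = (\<lambda>i\<in>{..<n}. 0)"
        by (auto simp: PiE_iff extensional_def fun_eq_iff)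
      moreover have "(\<Sum>i<n. b ^ (\<lambda>i\<in>{..<n}. 0) i) = n" by simp
      ultimately show ?thesis unfolding bounded_reps_def by auto
    qed
    then show ?thesis by auto
  qed
  then show ?thesis by (simp add: level_count_def)
qed

lemma level_count_power:
  assumes "b \<ge> 2"
  shows "level_count b k 1 n = U b (b ^ k) n"
proof -
  have "bounded_reps b k {..<n} (b ^ k) = reps b {..<n} (b ^ k)"
  proof -
    have "f i \<le> k" if "f \<in> reps b {..<n} (b ^ k)" "i < n" for f i
    proof -
      have "b ^ f i \<le> (\<Sum>i<n. b ^ f i)" using that by (intro member_le_sum) auto
      then show ?thesis using that assms by (simp add: reps_def)
    qed
    then show ?thesis by (auto simp: bounded_reps_def reps_def PiE_iff)
  qed
  then show ?thesis using card_reps[of "{..<n}" b "b ^ k"] by (simp add: level_count_def)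
qed

text \<open>A representation is determined by the set of positions carrying \<open>Suc k\<close> and
  its restriction to the others. With \<open>j\<close> such positions the rest sums to
  \<open>(r - j) * b ^ Suc k\<close>, which one level lower has the multiplier
  \<open>b * (r - j)\<close>.\<close>

lemma level_count_Suc_le:
  assumes "b \<ge> 2"
  shows "level_count b (Suc k) r n
    \<le> (\<Sum>j\<le>n. (n choose j) * (if j \<le> r then level_count b k (b * (r - j)) (n - j) else 0))"
proof -
  let ?S = "{..<n}" and ?R = "\<lambda>J j. if j \<le> r then bounded_reps b k J (b * (r - j) * b ^ k) else {}"
  let ?B = "SIGMA I:Pow ?S. ?R (?S - I) (card I)"
  define F where "F = (\<lambda>f. ({i \<in> ?S. f i = Suc k}, restrict f {i \<in> ?S. f i \<noteq> Suc k}))"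
  have finsub: "finite I" if "I \<subseteq> ?S" for I using that finite_subset by blast
  have "card (bounded_reps b (Suc k) ?S (r * b ^ Suc k)) \<le> card ?B"
  proof (rule card_inj_on_le)
    show "inj_on F (bounded_reps b (Suc k) ?S (r * b ^ Suc k))"
    proof (rule inj_onI)
      fix f g assume fg: "f \<in> bounded_reps b (Suc k) ?S (r * b ^ Suc k)"
        "g \<in> bounded_reps b (Suc k) ?S (r * b ^ Suc k)" and e: "F f = F g"
      have e1: "{i \<in> ?S. f i = Suc k} = {i \<in> ?S. g i = Suc k}" using e by (simp add: F_def)
      have e2: "restrict f {i \<in> ?S. f i \<noteq> Suc k} i = restrict g {i \<in> ?S. g i \<noteq> Suc k} i" for i
        using e by (simp add: F_def)
      have "f i = g i" if "i \<in> ?S" for i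
        proof (cases "f i = Suc k")
        case True
        then have "i \<in> {i \<in> ?S. g i = Suc k}" using that e1 by blast
        then show ?thesis using True by simp
      next
        case False
        then have "g i \<noteq> Suc k" using that e1 by blast
        then show ?thesis using e2[of i] False that by simp
      qed
      then show "f = g" using fg by (auto simp: bounded_reps_def intro: PiE_ext)
    qed
    show "F ` bounded_reps b (Suc k) ?S (r * b ^ Suc k) \<subseteq> ?B"
    proof (rule image_subsetI)
      fix f assume f: "f \<in> bounded_reps b (Suc k) ?S (r * b ^ Suc k)"
      define I where "I = {i \<in> ?S. f i = Suc k}"
      have IS: "I \<subseteq> ?S" by (auto simp: I_def)
      have D: "{i \<in> ?S. f i \<noteq> Suc k} = ?S - I" by (auto simp: I_def)
      have "(\<Sum>i\<in>?S. b ^ f i) = (\<Sum>i\<in>I. b ^ f i) + (\<Sum>i\<in>?S - I. b ^ f i)"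
        using sum.subset_diff[of I ?S "\<lambda>i. b ^ f i"] IS by simp
      moreover have "(\<Sum>i\<in>I. b ^ f i) = card I * b ^ Suc k" by (simp add: I_def)
      ultimately have s: "card I * b ^ Suc k + (\<Sum>i\<in>?S - I. b ^ f i) = r * b ^ Suc k"
        using f by (simp add: bounded_reps_def)
      then have "card I * b ^ Suc k \<le> r * b ^ Suc k" by linarith
      then have le: "card I \<le> r" using assms by (simp del: power_Suc)
      have "(\<Sum>i\<in>?S - I. b ^ f i) = (r - card I) * b ^ Suc k"
        using s by (simp add: diff_mult_distrib)
      moreover have "f i \<le> k" if "i \<in> ?S - I" for i
        using f that by (force simp: bounded_reps_def I_def PiE_iff le_Suc_eq)
      ultimately have "restrict f (?S - I) \<in> bounded_reps b k (?S - I) (b * (r - card I) * b ^ k)"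
        by (simp add: bounded_reps_def mult_ac)
      then have "(I, restrict f (?S - I)) \<in> ?B" using le IS by simp
      moreover have "F f = (I, restrict f (?S - I))" unfolding F_def D[symmetric] by (simp add: I_def)
      ultimately show "F f \<in> ?B" by simp
    qed
    show "finite ?B" using finsub by (intro finite_SigmaI) (auto intro: finite_bounded_reps)
  qed
  also have "card ?B = (\<Sum>I\<in>Pow ?S. card (?R (?S - I) (card I)))"
    using finsub by (subst card_SigmaI) (auto intro: finite_bounded_reps)
  also have "\<dots> \<le> (\<Sum>I\<in>Pow ?S. if card I \<le> r then level_count b k (b * (r - card I)) (n - card I) else 0)"
    using finsub by (intro sum_mono) (auto simp: level_count_def card_Diff_subset intro!: card_bounded_reps_le)
  also have "\<dots> = (\<Sum>j\<le>n. (n choose j) * (if j \<le> r then level_count b k (b * (r - j)) (n - j) else 0))"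
    using sum_Pow_card[of ?S "\<lambda>j. if j \<le> r then level_count b k (b * (r - j)) (n - j) else 0"] by simp
  finally show ?thesis by (simp add: level_count_def)
qed

text \<open>\<open>G r\<close> dominates the exponential generating function of the representations of \<open>r * b ^ k\<close> by
  powers up to \<open>b ^ k\<close>; the hypothesis mirrors the recursion over the number \<open>j\<close> of parts \<open>b ^ k\<close>.\<close>

lemma sum_level_count_le:
  fixes x :: real
  assumes b: "b \<ge> 2" and x: "x \<ge> 0" and G0: "G 0 = 1"
    and G: "\<And>r. (\<Sum>j\<le>r. x ^ j / fact j * G (b * (r - j))) \<le> G r" and Gnn: "\<And>r. G r \<ge> 0"
  shows "(\<Sum>n\<le>N. real (level_count b k r n) / fact n * x ^ n) \<le> G r"
proof (induction k arbitrary: r)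
  case 0
  have "(\<Sum>n\<le>N. real (level_count b 0 r n) / fact n * x ^ n)
      = (\<Sum>n\<le>N. if n = r then x ^ r / fact r else 0)"
    by (intro sum.cong) (auto simp: level_count_0)
  also have "\<dots> \<le> x ^ r / fact r * G (b * (r - r))" using x by (simp add: G0)
  also have "\<dots> \<le> (\<Sum>j\<le>r. x ^ j / fact j * G (b * (r - j)))"
    using x Gnn by (intro member_le_sum[of r _ "\<lambda>j. x ^ j / fact j * G (b * (r - j))"]) auto
  finally show ?case using G by (meson order_trans)
next
  case (Suc k)
  define v where "v = (\<lambda>j m. real (level_count b k (b * (r - j)) m) / fact m * x ^ m)"
  define a where "a = (\<lambda>j. if j \<le> r then x ^ j / fact j else 0)"
  have av: "a j \<ge> 0" "v j m \<ge> 0" for j m using x by (auto simp: a_def v_def)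
  have tm: "real (level_count b (Suc k) r n) / fact n * x ^ n \<le> (\<Sum>j\<le>n. a j * v j (n - j))" for n
  proof -
    have "real (level_count b (Suc k) r n) \<le>
        real (\<Sum>j\<le>n. (n choose j) * (if j \<le> r then level_count b k (b * (r - j)) (n - j) else 0))"
      using level_count_Suc_le[OF b] of_nat_le_iff by blast
    then have "real (level_count b (Suc k) r n) / fact n * x ^ n \<le>
        (\<Sum>j\<le>n. real (n choose j) * real (if j \<le> r then level_count b k (b * (r - j)) (n - j) else 0)) / fact n * x ^ n"
      using x by (intro mult_right_mono divide_right_mono) auto
    also have "\<dots> = (\<Sum>j\<le>n. a j * v j (n - j))"
      unfolding sum_divide_distrib sum_distrib_right
    proof (rule sum.cong[OF refl])
      fix j assume "j \<in> {..n}"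
      then have "x ^ n = x ^ j * x ^ (n - j)" by (simp flip: power_add)
      then show "real (n choose j) * real (if j \<le> r then level_count b k (b * (r - j)) (n - j) else 0) / fact n * x ^ n
          = a j * v j (n - j)"
        using \<open>j \<in> {..n}\<close> by (simp add: a_def v_def binomial_fact)
    qed
    finally show ?thesis .
  qed
  have "(\<Sum>n\<le>N. real (level_count b (Suc k) r n) / fact n * x ^ n) \<le> (\<Sum>n\<le>N. \<Sum>j\<le>n. a j * v j (n - j))"
    by (rule sum_mono) (rule tm)
  also have "\<dots> = (\<Sum>(j, m)\<in>{(j, m). j + m \<le> N}. a j * v j m)"
    by (rule sum.triangle_reindex_eq[symmetric])
  \<comment> \<open>Enlarging the triangle to a square adds only nonnegative terms and decouples
    \<open>j\<close> from \<open>m\<close>.\<close>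
  also have "\<dots> \<le> (\<Sum>(j, m)\<in>{..N} \<times> {..N}. a j * v j m)"
    using av by (intro sum_mono2) auto
  also have "\<dots> = (\<Sum>j\<le>N. a j * (\<Sum>m\<le>N. v j m))"
    by (simp add: sum.cartesian_product sum_distrib_left)
  also have "\<dots> \<le> (\<Sum>j\<le>N. a j * G (b * (r - j)))"
    using Suc.IH av by (intro sum_mono mult_left_mono) (auto simp: v_def)
  \<comment> \<open>The weights \<open>a j\<close> vanish beyond \<open>r\<close>; passing through
    the union avoids comparing \<open>N\<close> with \<open>r\<close>.\<close>
  also have "\<dots> \<le> (\<Sum>j\<in>{..N} \<union> {..r}. a j * G (b * (r - j)))"
    using av Gnn by (intro sum_mono2) auto
  also have "\<dots> = (\<Sum>j\<le>r. x ^ j / fact j * G (b * (r - j)))"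
    by (rule sum.mono_neutral_cong_right) (auto simp: a_def)
  also have "\<dots> \<le> G r" by (rule G)
  finally show ?case .
qed

text \<open>Up to order \<open>N\<close> the coefficients are those of the level counts for
  \<open>r = 1\<close> at a sufficiently high level \<open>E\<close>, and the bound
  \<open>G 1\<close> depends neither on \<open>N\<close> nor on \<open>E\<close>.\<close>

lemma summable_W_fps_of_supersolution:
  fixes x :: real
  assumes b: "b \<ge> 2" and x: "x \<ge> 0" and G0: "G 0 = 1"
    and G: "\<And>r. (\<Sum>j\<le>r. x ^ j / fact j * G (b * (r - j))) \<le> G r" and Gnn: "\<And>r. G r \<ge> 0"
  shows "summable (\<lambda>n. W_fps b $ n * x ^ n)"
proof (rule summableI_nonneg_bounded)
  fix N
  obtain E where E: "\<And>n. n \<le> N \<Longrightarrow> U b (b ^ E) n = W b 1 n" using W_1_eq_U_power[OF b] by blast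
  have "(\<Sum>n<N. W_fps b $ n * x ^ n) \<le> (\<Sum>n\<le>N. W_fps b $ n * x ^ n)"
    using x by (intro sum_mono2) (auto simp: W_fps_def)
  also have "\<dots> = (\<Sum>n\<le>N. real (level_count b E 1 n) / fact n * x ^ n)"
    using E unfolding level_count_power[OF b] by (intro sum.cong) (auto simp: W_fps_def)
  also have "\<dots> \<le> G 1" by (rule sum_level_count_le[OF assms])
  finally show "(\<Sum>n<N. W_fps b $ n * x ^ n) \<le> G 1" .
qed (use x in \<open>simp add: W_fps_def\<close>)

text \<open>The trial supersolution is \<open>A * y ^ r / fact r\<close> for
  \<open>r \<ge> 1\<close>. Replacing \<open>G (b * i)\<close> by a multiple of
  \<open>z ^ i / fact i\<close> turns the recursion into the binomial expansion of
  \<open>(x + z) ^ r\<close>. The term \<open>j = r\<close> involves \<open>G 0 = 1\<close> instead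
  of \<open>A\<close>, which is why \<open>x ^ r\<close> is treated separately in
  \<open>key\<close>.\<close>

lemma summable_W_fps_of_power_bound:
  fixes x y A D z :: real
  assumes b: "b \<ge> 2" and nn: "x \<ge> 0" "y \<ge> 0" "A \<ge> 0" "D \<ge> 0" "z \<ge> 0"
    and z: "\<And>i. i \<ge> 1 \<Longrightarrow> y ^ (b * i) / fact (b * i) \<le> D * z ^ i / fact i"
    and key: "\<And>r. r \<ge> 1 \<Longrightarrow> x ^ r + A * D * ((x + z) ^ r - x ^ r) \<le> A * y ^ r"
  shows "summable (\<lambda>n. W_fps b $ n * x ^ n)"
proof (rule summable_W_fps_of_supersolution[where G = "\<lambda>r. if r = 0 then 1 else A * y ^ r / fact r"])
  fix r :: nat
  show "(\<Sum>j\<le>r. x ^ j / fact j * (if b * (r - j) = 0 then 1 else A * y ^ (b * (r - j)) / fact (b * (r - j))))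
      \<le> (if r = 0 then 1 else A * y ^ r / fact r)" (is "(\<Sum>j\<le>r. ?t j) \<le> _")
  proof (cases "r = 0")
    case False
    have "(\<Sum>j\<le>r. ?t j) = x ^ r / fact r + (\<Sum>j<r. ?t j)"
      by (simp add: lessThan_Suc_atMost[symmetric])
    also have "(\<Sum>j<r. ?t j) \<le> (\<Sum>j<r. A * D / fact r * (of_nat (r choose j) * x ^ j * z ^ (r - j)))"
    proof (rule sum_mono)
      fix j assume "j \<in> {..<r}"
      then have j: "j < r" by simp
      have "?t j = A * (x ^ j / fact j) * (y ^ (b * (r - j)) / fact (b * (r - j)))"
        using j b by simp
      also have "\<dots> \<le> A * (x ^ j / fact j) * (D * z ^ (r - j) / fact (r - j))"
        using j nn by (intro mult_left_mono z) auto
      also have "\<dots> = A * D / fact r * (of_nat (r choose j) * x ^ j * z ^ (r - j))"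
        using j by (simp add: binomial_fact field_simps)
      finally show "?t j \<le> A * D / fact r * (of_nat (r choose j) * x ^ j * z ^ (r - j))" .
    qed
    also have "\<dots> = A * D / fact r * (\<Sum>j<r. of_nat (r choose j) * x ^ j * z ^ (r - j))"
      by (simp add: sum_distrib_left)
    also have "(\<Sum>j<r. of_nat (r choose j) * x ^ j * z ^ (r - j)) = (x + z) ^ r - x ^ r"
      unfolding binomial_ring by (simp add: lessThan_Suc_atMost[symmetric])
    also have "x ^ r / fact r + A * D / fact r * ((x + z) ^ r - x ^ r)
        = (x ^ r + A * D * ((x + z) ^ r - x ^ r)) / fact r" by (simp add: add_divide_distrib)
    also have "\<dots> \<le> A * y ^ r / fact r" using key[of r] False by (intro divide_right_mono) auto
    finally show ?thesis using False by simp
  qed simp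
qed (use b nn in auto)

text \<open>The quotient of the two sides is the number of partitions of a set of size
  \<open>b * i\<close> into \<open>i\<close> blocks of size \<open>b\<close>. The induction splits
  off one block and uses that a binomial coefficient is at least the power of the ratio.\<close>

lemma fact_power_mult_fact_le:
  assumes "b \<ge> 1"
  shows "(fact b ^ i * fact i :: real) \<le> fact (b * i)"
proof (induction i)
  case (Suc i)
  have "real (Suc i) ^ 1 \<le> real (Suc i) ^ b" using assms by (intro power_increasing) auto
  also have "real (Suc i) ^ b = (real (b * Suc i) / real b) ^ b" using assms by (simp only: of_nat_mult) simp
  also have "\<dots> \<le> real ((b * Suc i) choose b)"
    using assms by (intro binomial_ge_n_over_k_pow_k) auto
  finally have ch: "real (Suc i) \<le> real ((b * Suc i) choose b)" by simp
  have "(fact b ^ Suc i * fact (Suc i) :: real) = fact b * real (Suc i) * (fact b ^ i * fact i)"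
    by (simp add: algebra_simps)
  also have "\<dots> \<le> fact b * real ((b * Suc i) choose b) * fact (b * i)"
    using ch Suc by (intro mult_mono) auto
  also have "\<dots> = fact (b * Suc i)"
  proof -
    have "fact b * fact (b * i) * ((b * Suc i) choose b) = fact (b * Suc i)"
      using binomial_fact_lemma[of b "b * Suc i"] by simp
    from arg_cong[OF this, of real] show ?thesis
      by (simp only: of_nat_mult of_nat_fact mult_ac)
  qed
  finally show ?case .
qed simp

text \<open>With \<open>A = D = 1\<close> the condition \<open>key\<close> collapses to a comparison
  of powers. The equation x + y^b / b! = y is that of the exponential generating function of
  leaf-labelled trees whose inner nodes have \<open>b\<close> children, and \<open>y\<close> is a
  supersolution of it.\<close>

lemma summable_W_fps_of_linear_bound:
  fixes x y :: real
  assumes b: "b \<ge> 2" and nn: "x \<ge> 0" "y \<ge> 0" and xy: "x + y ^ b / fact b \<le> y"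
  shows "summable (\<lambda>n. W_fps b $ n * x ^ n)"
proof (rule summable_W_fps_of_power_bound[where y = y and A = 1 and D = 1 and z = "y ^ b / fact b"])
  fix i :: nat
  have "y ^ (b * i) / fact (b * i) \<le> y ^ (b * i) / (fact b ^ i * fact i)"
    using nn fact_power_mult_fact_le[of b i] b by (intro divide_left_mono) auto
  then show "y ^ (b * i) / fact (b * i) \<le> 1 * (y ^ b / fact b) ^ i / fact i"
    by (simp add: power_mult power_divide)
next
  fix r :: nat
  have "(x + y ^ b / fact b) ^ r \<le> y ^ r" using xy nn by (intro power_mono) auto
  then show "x ^ r + 1 * 1 * ((x + y ^ b / fact b) ^ r - x ^ r) \<le> 1 * y ^ r" by simp
qed (use assms in auto)

section \<open>Lower bounds for coefficients and a point where the series exceeds 1\<close>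

lemma W_1_ge_U_power: "b \<ge> 2 \<Longrightarrow> U b (b ^ e) n \<le> W b 1 n"
  using U_le_W[of b "b ^ e" n] by (simp add: digit_sum_power)

lemma W_1_1_pos: "b \<ge> 2 \<Longrightarrow> W b 1 1 \<ge> 1"
proof -
  assume b: "b \<ge> 2"
  have "{[0]} \<subseteq> power_reps b (b ^ 0) 1" by (auto simp: power_reps_def)
  then have "1 \<le> U b (b ^ 0) 1"
    unfolding U_def using card_mono[OF finite_power_reps[OF b]] by (metis is_singletonI is_singleton_altdef)
  then show ?thesis using W_1_ge_U_power[OF b, of 0 1] by linarith
qed

lemma W_1_b_pos: "b \<ge> 2 \<Longrightarrow> W b 1 b \<ge> 1"
proof -
  assume b: "b \<ge> 2"
  have "{replicate b 0} \<subseteq> power_reps b (b ^ 1) b" by (auto simp: power_reps_def sum_list_replicate)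
  then have "1 \<le> U b (b ^ 1) b"
    unfolding U_def using card_mono[OF finite_power_reps[OF b]] by (metis is_singletonI is_singleton_altdef)
  then show ?thesis using W_1_ge_U_power[OF b, of 1 b] by linarith
qed

lemma W_fps_1_ge: "b \<ge> 2 \<Longrightarrow> W_fps b $ 1 \<ge> 1" using W_1_1_pos[of b] by (simp add: W_fps_def)

lemma W_fps_b_ge: "b \<ge> 2 \<Longrightarrow> W_fps b $ b \<ge> 1 / fact b"
  using W_1_b_pos[of b] by (simp add: W_fps_def divide_right_mono)

text \<open>A representation of \<open>2 ^ E\<close> with at least two parts does not contain
  \<open>E\<close>, so inserting \<open>E\<close> at any of the \<open>n + 1\<close> places gives
  distinct representations of \<open>2 ^ Suc E\<close>. For a single part the place of insertion
  could not be recovered.\<close>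

lemma W_fps_2_Suc_ge:
  assumes n: "n \<ge> 2"
  shows "W_fps 2 $ n \<le> W_fps 2 $ Suc n"
proof -
  obtain E where E: "U 2 (2 ^ E) n = W 2 1 n" using W_1_eq_U_power[of 2 n] by auto
  define F where "F = (\<lambda>(i, a). take i a @ E # drop i (a :: nat list))"
  have notin: "E \<notin> set a" if a: "a \<in> power_reps 2 (2 ^ E) n" for a
  proof
    assume "E \<in> set a"
    then obtain ys zs where s: "a = ys @ E # zs" by (meson split_list)
    have "(\<Sum>x\<leftarrow>ys @ zs. (2::nat) ^ x) = 0" "length (ys @ zs) \<ge> 1"
      using a n s by (auto simp: power_reps_def)
    then show False by (cases "ys @ zs") (auto simp flip: map_append sum_list_append)
  qed
  have "card ({..n} \<times> power_reps 2 (2 ^ E) n) \<le> card (power_reps 2 (2 ^ Suc E) (Suc n))"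
  proof (rule card_inj_on_le)
    show "inj_on F ({..n} \<times> power_reps 2 (2 ^ E) n)"
    proof (rule inj_onI)
      fix p q assume p: "p \<in> {..n} \<times> power_reps 2 (2 ^ E) n" and q: "q \<in> {..n} \<times> power_reps 2 (2 ^ E) n"
        and eq: "F p = F q"
      obtain i a j c where pq: "p = (i, a)" "q = (j, c)" by (metis prod.exhaust)
      have len: "length a = n" "length c = n" "i \<le> n" "j \<le> n" using p q pq by (auto simp: power_reps_def)
      have "E \<notin> set (take i a)" "E \<notin> set (drop i a)"
        using notin[of a] p pq by (auto dest: in_set_takeD in_set_dropD)
      then have td: "take i a = take j c" "drop i a = drop j c"
        using eq append_Cons_eq_iff[of E "take i a" "drop i a" "take j c" "drop j c"] pq by (auto simp: F_def)
      then have "a = c" by (metis append_take_drop_id)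
      moreover have "i = j" using arg_cong[OF td(1), of length] len by simp
      ultimately show "p = q" using pq by simp
    qed
    show "F ` ({..n} \<times> power_reps 2 (2 ^ E) n) \<subseteq> power_reps 2 (2 ^ Suc E) (Suc n)"
    proof (rule image_subsetI)
      fix p assume p: "p \<in> {..n} \<times> power_reps 2 (2 ^ E) n"
      obtain i a where pq: "p = (i, a)" by (metis prod.exhaust)
      have "(\<Sum>x\<leftarrow>take i a. (2::nat) ^ x) + (\<Sum>x\<leftarrow>drop i a. 2 ^ x) = (\<Sum>x\<leftarrow>a. 2 ^ x)"
        by (simp flip: map_append sum_list_append)
      then show "F p \<in> power_reps 2 (2 ^ Suc E) (Suc n)"
        using p pq by (auto simp: F_def power_reps_def)
    qed
  qed (simp add: finite_power_reps)
  then have "Suc n * W 2 1 n \<le> U 2 (2 ^ Suc E) (Suc n)"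
    by (simp only: card_cartesian_product E[symmetric] U_def card_atMost)
  also have "\<dots> \<le> W 2 1 (Suc n)" by (rule W_1_ge_U_power) simp
  finally have "real (Suc n) * real (W 2 1 n) \<le> real (W 2 1 (Suc n))"
    by (metis of_nat_le_iff of_nat_mult)
  then have "real (Suc n) * real (W 2 1 n) / fact (Suc n) \<le> real (W 2 1 (Suc n)) / fact (Suc n)"
    by (rule divide_right_mono) simp
  moreover have "real (Suc n) * real (W 2 1 n) / fact (Suc n) = real (W 2 1 n) / fact n"
    by (simp only: fact_Suc of_nat_mult) simp
  ultimately show ?thesis by (simp add: W_fps_def)
qed

lemma W_fps_2_ge: "n \<ge> 2 \<Longrightarrow> W_fps 2 $ n \<ge> 1 / 2"
proof (induction n rule: nat_induct_at_least)
  case base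
  then show ?case using W_fps_b_ge[of 2] by simp
next
  case (Suc n)
  then show ?case using W_fps_2_Suc_ge[of n] by linarith
qed

text \<open>For \<open>b = 2\<close> the bound \<open>i! / (2 i)! \<le> 2^(- i)\<close>, which amounts to \<open>summable_W_fps_of_linear_bound\<close>,
  only reaches the radius \<open>1 / 2\<close>, where the series is still below \<open>1\<close>.\<close>

lemma summable_W_fps_2: "summable (\<lambda>n. W_fps 2 $ n * (3 / 5) ^ n)"
\<comment> \<open>From \<open>i\<close> to \<open>i + 1\<close> the quotient (2 i)! / i! grows by 2
  (2 i + 1) \<ge> 6, which gives \<open>z = 1/6\<close>; \<open>D = 3\<close> is then exact at
  \<open>i = 1\<close>. With these, \<open>A = 6/5\<close> gives equality in the final inequality at
  \<open>r = 1\<close>.\<close>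
proof (rule summable_W_fps_of_power_bound[where y = 1 and A = "6/5" and D = 3 and z = "1/6"])
  fix i :: nat assume "i \<ge> 1"
  then have "(6 ^ i * fact i :: real) \<le> 3 * fact (2 * i)"
  proof (induction i rule: nat_induct_at_least)
    case base
    show ?case by (simp add: fact_numeral)
  next
    case (Suc i)
    have "(6 ^ Suc i * fact (Suc i) :: real) = 6 * (real i + 1) * (6 ^ i * fact i)" by simp
    also have "\<dots> \<le> 6 * (real i + 1) * (3 * fact (2 * i))" using Suc by (intro mult_left_mono) auto
    also have "\<dots> \<le> (2 * real i + 2) * (2 * real i + 1) * (3 * fact (2 * i))"
      using Suc(1) mult_left_mono[of 3 "2 * real i + 1" "2 * real i + 2"] by (intro mult_right_mono) auto
    also have "\<dots> = 3 * fact (2 * Suc i)" by (simp add: algebra_simps)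
    finally show ?case .
  qed
  then show "1 ^ (2 * i) / fact (2 * i) \<le> 3 * (1 / 6) ^ i / (fact i :: real)"
    by (simp add: field_simps)
next
  fix r :: nat assume "r \<ge> 1"
  then have "18 * (23 / 30) ^ r - 13 * (3 / 5) ^ r \<le> (6 :: real)"
  proof (induction r rule: nat_induct_at_least)
    case (Suc r)
    have "(3 / 5 :: real) ^ r \<le> (3 / 5) ^ 1" using Suc(1) by (intro power_decreasing) auto
    then show ?case using Suc by simp
  qed simp
  moreover have "q + 6 / 5 * 3 * (p - q) \<le> 6 / 5 * 1" if "18 * p - 13 * q \<le> 6" for p q :: real
    using that by argo
  moreover have "(3 / 5 + 1 / 6 :: real) = 23 / 30" by simp
  ultimately show "(3 / 5) ^ r + 6 / 5 * 3 * ((3 / 5 + 1 / 6) ^ r - (3 / 5) ^ r) \<le> 6 / 5 * (1::real) ^ r"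
    by (simp only: power_one)
qed auto

text \<open>Convergence at \<open>x0\<close> comes from a supersolution, the value above 1 at
  \<open>x1\<close> from explicit coefficients. For \<open>b \<ge> 4\<close> the coefficients at 1
  and \<open>b\<close> suffice with \<open>x1 = 1\<close>; smaller bases need sharper
  choices.\<close>

lemma W_fps_radius:
  assumes b: "b \<ge> 2"
  shows "\<exists>x1 x0. 0 < x1 \<and> x1 < x0 \<and> summable (\<lambda>n. W_fps b $ n * x0 ^ n) \<and> (\<Sum>n. W_fps b $ n * x1 ^ n) > 1"
proof -
  have sub: "(\<Sum>n. W_fps b $ n * x1 ^ n) \<ge> (\<Sum>n\<in>F. W_fps b $ n * x1 ^ n)"
    if "summable (\<lambda>n. W_fps b $ n * x0 ^ n)" "0 < x1" "x1 < x0" "finite F" for x0 x1 F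
  proof (rule sum_le_suminf)
    show "summable (\<lambda>n. W_fps b $ n * x1 ^ n)"
      using powser_inside[OF that(1), of x1] that by simp
  qed (use that W_fps_nonneg in auto)
  have lin: "x1 + x1 ^ b / fact b \<le> (\<Sum>n. W_fps b $ n * x1 ^ n)"
    if "summable (\<lambda>n. W_fps b $ n * x0 ^ n)" "0 < x1" "x1 < x0" for x0 x1
  proof -
    have "x1 + x1 ^ b / fact b \<le> W_fps b $ 1 * x1 ^ 1 + W_fps b $ b * x1 ^ b"
      using W_fps_1_ge[OF b] mult_right_mono[OF W_fps_b_ge[OF b], of "x1 ^ b"] that
      by (intro add_mono) auto
    also have "\<dots> = (\<Sum>n\<in>{1, b}. W_fps b $ n * x1 ^ n)" using b by simp
    also have "\<dots> \<le> (\<Sum>n. W_fps b $ n * x1 ^ n)" by (rule sub[OF that]) simp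
    finally show ?thesis .
  qed
  consider "b = 2" | "b = 3" | "b \<ge> 4" using b by linarith
  then show ?thesis
  proof cases
    case 1
    have s: "summable (\<lambda>n. W_fps b $ n * (3 / 5) ^ n)" using summable_W_fps_2 1 by simp
    \<comment> \<open>Here all coefficients from order 2 on are at least 1/2, and the terms up to
      order 10 are enough.\<close>
    have "1 < (59 / 100 :: real) + (\<Sum>n=2..10. 1 / 2 * (59 / 100) ^ n)"
      by (simp add: eval_nat_numeral)
    also have "\<dots> \<le> W_fps b $ 1 * (59 / 100) ^ 1 + (\<Sum>n=2..10. W_fps b $ n * (59 / 100) ^ n)"
      using W_fps_1_ge[OF b] W_fps_2_ge 1 by (intro add_mono sum_mono mult_right_mono) auto
    also have "\<dots> = (\<Sum>n\<in>insert 1 {2..10}. W_fps b $ n * (59 / 100) ^ n)" by simp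
    also have "\<dots> \<le> (\<Sum>n. W_fps b $ n * (59 / 100) ^ n)" by (rule sub[OF s]) auto
    finally show ?thesis using s by (intro exI[of _ "59/100"] exI[of _ "3/5"]) auto
  next
    case 2
    \<comment> \<open>The value 7/5 is close to sqrt 2, where y - y^3 / 6 is largest.\<close>
    have s: "summable (\<lambda>n. W_fps b $ n * (94 / 100) ^ n)"
      using 2 by (intro summable_W_fps_of_linear_bound[where y = "7/5"]) (auto simp: fact_numeral eval_nat_numeral)
    have "1 < (92/100 :: real) + (92/100) ^ b / fact b" using 2 by (simp add: fact_numeral eval_nat_numeral)
    also have "\<dots> \<le> (\<Sum>n. W_fps b $ n * (92 / 100) ^ n)" by (rule lin[OF s]) auto
    finally show ?thesis using s by (intro exI[of _ "92/100"] exI[of _ "94/100"]) auto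
  next
    case 3
    then have "(2 ^ b / fact b :: real) \<le> 2 / 3"
    proof (induction b rule: nat_induct_at_least)
      case (Suc b)
      have "(2 ^ Suc b / fact (Suc b) :: real) = 2 / real (Suc b) * (2 ^ b / fact b)" by simp
      also have "\<dots> \<le> 1 * (2 / 3)" using Suc by (intro mult_mono) auto
      finally show ?case by simp
    qed (simp add: fact_numeral)
    then have "4 / 3 + 2 ^ b / fact b \<le> (2 :: real)" by linarith
    then have s: "summable (\<lambda>n. W_fps b $ n * (4 / 3) ^ n)"
      using b by (intro summable_W_fps_of_linear_bound[where y = 2]) auto
    have "1 < (1 :: real) + 1 ^ b / fact b" by simp
    also have "\<dots> \<le> (\<Sum>n. W_fps b $ n * 1 ^ n)" by (rule lin[OF s]) auto
    finally show ?thesis using s by (intro exI[of _ "1"] exI[of _ "4/3"]) auto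
  qed
qed

text \<open>Every power of \<open>b\<close> is 1 modulo \<open>b - 1\<close>, so the number of parts
  of a representation of a power of \<open>b\<close> is 1 modulo \<open>b - 1\<close>.\<close>

lemma W_1_support:
  assumes b: "b \<ge> 2" and n: "W b 1 n \<noteq> 0"
  shows "\<exists>j. n = 1 + (b - 1) * j"
proof -
  obtain E where "U b (b ^ E) n = W b 1 n" using W_1_eq_U_power[OF b, of n] by auto
  then have "power_reps b (b ^ E) n \<noteq> {}" using n by (auto simp: U_def)
  then obtain a where a: "length a = n" "(\<Sum>x\<leftarrow>a. b ^ x) = b ^ E" by (auto simp: power_reps_def)
  have pw: "(int b - 1) dvd int b ^ e - 1" for e
    using power_diff_1_eq[of "int b" e] by simp
  have "(int b - 1) dvd int (\<Sum>x\<leftarrow>a. b ^ x) - int (length a)"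
  proof (induction a)
    case (Cons x a)
    have "int (\<Sum>x\<leftarrow>x # a. b ^ x) - int (length (x # a))
        = (int b ^ x - 1) + (int (\<Sum>x\<leftarrow>a. b ^ x) - int (length a))" by simp
    then show ?case using Cons pw by (metis dvd_add)
  qed simp
  then have "(int b - 1) dvd int b ^ E - int n" using a by simp
  then have "(int b - 1) dvd int n - 1" using dvd_diff[OF pw[of E], of "int b ^ E - int n"] by simp
  moreover have "n \<ge> 1" using a b by (cases n) auto
  ultimately have "int (b - 1) dvd int (n - 1)" using b by (simp add: of_nat_diff)
  then have "b - 1 dvd n - 1" by simp
  then obtain j where "n - 1 = (b - 1) * j" by (auto elim: dvdE)
  then show ?thesis using \<open>n \<ge> 1\<close> by (intro exI[of _ j]) simp
qed

section \<open>A local limit theorem on a lattice\<close>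

text \<open>Rescaling by sqrt \<alpha> reduces the integrals to the characteristic function of the
  standard normal distribution.\<close>

lemma gaussian_cos_integral:
  fixes \<alpha> t :: real
  assumes "\<alpha> > 0"
  shows "integrable lborel (\<lambda>u. exp (- (\<alpha> * u\<^sup>2) / 2))"
    and "integrable lborel (\<lambda>u. exp (- (\<alpha> * u\<^sup>2) / 2) * cos (t * u))"
    and "(LINT u|lborel. exp (- (\<alpha> * u\<^sup>2) / 2)) = sqrt (2 * pi / \<alpha>)"
    and "(LINT u|lborel. exp (- (\<alpha> * u\<^sup>2) / 2) * cos (t * u)) = sqrt (2 * pi / \<alpha>) * exp (- t\<^sup>2 / (2 * \<alpha>))"
proof -
  define s where "s = sqrt \<alpha>"
  have s: "s > 0" "s\<^sup>2 = \<alpha>" using assms by (auto simp: s_def)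
  have nd: "normal_density 0 (1 / s) u = exp (- (\<alpha> * u\<^sup>2) / 2) * (s / sqrt (2 * pi))" for u
    using s(1) unfolding s(2)[symmetric]
    by (simp add: normal_density_def real_sqrt_divide power_divide real_sqrt_mult field_simps)
  have "integrable lborel (\<lambda>u. sqrt (2 * pi) / s * normal_density 0 (1 / s) u)"
    using s by (intro integrable_mult_right integrable_normal_density) simp
  moreover have "sqrt (2 * pi) / s * normal_density 0 (1 / s) u = exp (- (\<alpha> * u\<^sup>2) / 2)" for u
    unfolding nd using s by simp
  ultimately show int1: "integrable lborel (\<lambda>u. exp (- (\<alpha> * u\<^sup>2) / 2))" by simp
  show "integrable lborel (\<lambda>u. exp (- (\<alpha> * u\<^sup>2) / 2) * cos (t * u))"
    by (rule Bochner_Integration.integrable_bound[OF int1]) (auto simp: abs_mult mult_left_le)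
  have key: "(LINT u|lborel. exp (- (\<alpha> * u\<^sup>2) / 2) * cos (r * u)) = sqrt (2 * pi / \<alpha>) * exp (- r\<^sup>2 / (2 * \<alpha>))" for r
  proof -
    have "complex_of_real (exp (- ((r / s)\<^sup>2) / 2)) = char std_normal_distribution (r / s)"
      by (simp add: char_std_normal_distribution)
    also have "\<dots> = (CLINT x|lborel. std_normal_density x *\<^sub>R iexp (r / s * x))"
      unfolding char_def by (subst integral_density) auto
    finally have e: "exp (- ((r / s)\<^sup>2) / 2) = Re (CLINT x|lborel. std_normal_density x *\<^sub>R iexp (r / s * x))"
      by (metis Re_complex_of_real)
    have "integrable lborel (\<lambda>x. std_normal_density x *\<^sub>R iexp (r / s * x))"
      by (rule Bochner_Integration.integrable_bound[OF integrable_normal_density[of 1 0]]) auto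
    from integral_Re[OF this] have "exp (- ((r / s)\<^sup>2) / 2) = (LINT x|lborel. std_normal_density x * cos (r / s * x))"
      unfolding e by (simp add: Re_exp)
    also have "\<dots> = (LINT x|lborel. 1 / sqrt (2 * pi) * (exp (- (\<alpha> * (0 + 1 / s * x)\<^sup>2) / 2) * cos (r * (0 + 1 / s * x))))"
      using s by (intro Bochner_Integration.integral_cong) (auto simp: std_normal_density_def power_divide field_simps)
    also have "\<dots> = 1 / sqrt (2 * pi) * (LINT x|lborel. exp (- (\<alpha> * (0 + 1 / s * x)\<^sup>2) / 2) * cos (r * (0 + 1 / s * x)))"
      by simp
    finally have "(LINT x|lborel. exp (- (\<alpha> * (0 + 1 / s * x)\<^sup>2) / 2) * cos (r * (0 + 1 / s * x)))
        = sqrt (2 * pi) * exp (- ((r / s)\<^sup>2) / 2)" by (simp add: field_simps)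
    moreover have "(LINT u|lborel. exp (- (\<alpha> * u\<^sup>2) / 2) * cos (r * u))
        = \<bar>1 / s\<bar> *\<^sub>R (LINT x|lborel. exp (- (\<alpha> * (0 + 1 / s * x)\<^sup>2) / 2) * cos (r * (0 + 1 / s * x)))"
      by (rule lborel_integral_real_affine) (use s in simp)
    moreover have "(r / s)\<^sup>2 / 2 = r\<^sup>2 / (2 * \<alpha>)" using s by (simp add: power_divide)
    ultimately show ?thesis using s by (simp add: s_def real_sqrt_divide)
  qed
  show "(LINT u|lborel. exp (- (\<alpha> * u\<^sup>2) / 2) * cos (t * u)) = sqrt (2 * pi / \<alpha>) * exp (- t\<^sup>2 / (2 * \<alpha>))"
    by (rule key)
  show "(LINT u|lborel. exp (- (\<alpha> * u\<^sup>2) / 2)) = sqrt (2 * pi / \<alpha>)"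
    using key[of 0] by simp
qed

text \<open>This is a first order expansion of a power that keeps the linear term explicit. The
  remainder satisfies R(n + 1) = a R(n) + (n + 2) b^(n + 1) (a - b)^2; the exponent is written
  \<open>n + 2\<close> to avoid subtraction in the powers.\<close>

lemma norm_power_diff_linear_le:
  fixes a b :: "'a::{real_normed_algebra_1, comm_ring_1}"
  assumes "norm a \<le> r" "norm b \<le> r"
  shows "norm (a ^ (n + 2) - b ^ (n + 2) - of_nat (n + 2) * b ^ (n + 1) * (a - b))
    \<le> real (n + 2) ^ 2 * r ^ n * norm (a - b) ^ 2"
proof (induction n)
  case 0
  have e: "a ^ (0 + 2) - b ^ (0 + 2) - of_nat (0 + 2) * b ^ (0 + 1) * (a - b) = (a - b) ^ 2"
    by (simp add: power2_eq_square algebra_simps)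
  have "norm ((a - b) ^ 2) \<le> norm (a - b) ^ 2" by (rule norm_power_ineq)
  also have "\<dots> \<le> 4 * norm (a - b) ^ 2" by simp
  finally show ?case unfolding e by simp
next
  case (Suc n)
  have r: "r \<ge> 0" using assms norm_ge_zero order_trans by blast
  have "a ^ (Suc n + 2) - b ^ (Suc n + 2) - of_nat (Suc n + 2) * b ^ (Suc n + 1) * (a - b)
      = a * (a ^ (n + 2) - b ^ (n + 2) - of_nat (n + 2) * b ^ (n + 1) * (a - b))
        + of_nat (n + 2) * (b ^ (n + 1) * (a - b) ^ 2)"
    by (simp add: algebra_simps power2_eq_square)
  also have "norm \<dots> \<le> norm a * norm (a ^ (n + 2) - b ^ (n + 2) - of_nat (n + 2) * b ^ (n + 1) * (a - b))
        + norm (of_nat (n + 2) :: 'a) * norm (b ^ (n + 1) * (a - b) ^ 2)"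
    by (intro norm_triangle_le add_mono norm_mult_ineq)
  also have "\<dots> \<le> r * (real (n + 2) ^ 2 * r ^ n * norm (a - b) ^ 2) + real (n + 2) * (r ^ (n + 1) * norm (a - b) ^ 2)"
  proof (intro add_mono mult_mono)
    have "norm (b ^ (n + 1) * (a - b) ^ 2) \<le> norm (b ^ (n + 1)) * norm ((a - b) ^ 2)" by (rule norm_mult_ineq)
    also have "\<dots> \<le> norm b ^ (n + 1) * norm (a - b) ^ 2" by (intro mult_mono norm_power_ineq) auto
    also have "\<dots> \<le> r ^ (n + 1) * norm (a - b) ^ 2"
      using assms r by (intro mult_right_mono power_mono) auto
    finally show "norm (b ^ (n + 1) * (a - b) ^ 2) \<le> r ^ (n + 1) * norm (a - b) ^ 2" .
    show "norm (of_nat (n + 2) :: 'a) \<le> real (n + 2)" by (metis norm_of_nat order_refl)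
  qed (use assms Suc r in auto)
  also have "\<dots> = (real (n + 2) ^ 2 + real (n + 2)) * (r ^ Suc n * norm (a - b) ^ 2)"
    by (simp add: algebra_simps)
  also have "\<dots> \<le> real (Suc n + 2) ^ 2 * (r ^ Suc n * norm (a - b) ^ 2)"
    using r by (intro mult_right_mono) (auto simp: power2_eq_square algebra_simps)
  finally show ?case by (simp add: mult.assoc)
qed

section \<open>Elementary estimates for exponentials and the cosine\<close>

lemma power_le_fact_exp:
  assumes "(y::real) \<ge> 0"
  shows "y ^ k \<le> fact k * exp y"
proof -
  have "y ^ k /\<^sub>R fact k \<le> exp y"
    unfolding exp_def using sum_le_suminf[OF summable_exp_generic[of y], of "{k}"] assms by simp
  then show ?thesis by (simp add: field_simps)
qed

text \<open>Half of the exponent absorbs the power. In the local limit theorem each factor u^2 is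
  thereby worth 1 / S.\<close>

lemma power_times_exp_neg_le:
  fixes c S u :: real
  assumes "c > 0" "S > 0"
  shows "(S * u\<^sup>2) ^ k * exp (- (c * S * u\<^sup>2)) \<le> (2 / c) ^ k * fact k * exp (- (c * S * u\<^sup>2) / 2)"
proof -
  define y where "y = c * S * u\<^sup>2 / 2"
  have y: "y \<ge> 0" "S * u\<^sup>2 = 2 / c * y" "c * S * u\<^sup>2 = y + y"
    using assms by (auto simp: y_def)
  have "(2 / c * y) ^ k * exp (- (y + y)) = (2 / c) ^ k * y ^ k * exp (- (y + y))"
    by (simp add: power_mult_distrib power_divide)
  also have "\<dots> \<le> (2 / c) ^ k * (fact k * exp y) * exp (- (y + y))"
    using assms y(1) by (intro mult_right_mono mult_left_mono power_le_fact_exp) auto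
  also have "\<dots> = (2 / c) ^ k * fact k * exp (- (y + y) / 2)"
    by (simp flip: exp_add)
  finally show ?thesis using y by simp
qed

text \<open>By concavity the sine lies above its chord on [0, pi / 2], and 1 - cos u = 2 sin^2(u /
  2).\<close>

lemma one_minus_cos_ge:
  assumes "\<bar>u\<bar> \<le> pi"
  shows "1 - cos u \<ge> 2 * u\<^sup>2 / pi\<^sup>2"
proof -
  have *: "sin x \<ge> 2 * x / pi" if "0 \<le> x" "x \<le> pi / 2" for x
  proof -
    have "concave_on {0..pi/2} sin"
      unfolding concave_on_def
    proof (rule f''_ge0_imp_convex)
      show "((\<lambda>x. - sin x) has_real_derivative - cos x) (at x)" for x :: real
        by (auto intro!: derivative_eq_intros)
      show "((\<lambda>x. - cos x) has_real_derivative sin x) (at x)" for x :: real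
        by (auto intro!: derivative_eq_intros)
    qed (auto intro: sin_ge_zero)
    from concave_onD[OF this, of "2 * x / pi" 0 "pi / 2"] that show ?thesis
      by (simp add: field_simps)
  qed
  have "cos u = 1 - 2 * (sin (\<bar>u\<bar> / 2))\<^sup>2"
    using cos_double_sin[of "\<bar>u\<bar> / 2"] by simp
  moreover have "(2 * (\<bar>u\<bar> / 2) / pi)\<^sup>2 \<le> (sin (\<bar>u\<bar> / 2))\<^sup>2"
    using *[of "\<bar>u\<bar> / 2"] assms by (intro power_mono) auto
  ultimately show ?thesis by (simp add: power_divide)
qed

lemma exp_neg_quadratic:
  assumes "(y::real) \<ge> 0"
  shows "\<bar>exp (- y) - (1 - y)\<bar> \<le> y\<^sup>2 / 2"
proof -
  have 1: "1 - y \<le> exp (- y)" using exp_ge_add_one_self[of "- y"] by simp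
  have "exp (- y) \<le> 1 - y + y\<^sup>2 / 2"
  proof -
    define f where "f = (\<lambda>y::real. 1 - y + y\<^sup>2 / 2 - exp (- y))"
    have "f 0 \<le> f y"
    proof (rule DERIV_nonneg_imp_nondecreasing[OF assms])
      fix x :: real
      have "(f has_real_derivative (- 1 + x + exp (- x))) (at x)"
        unfolding f_def by (auto intro!: derivative_eq_intros)
      moreover have "- 1 + x + exp (- x) \<ge> 0" using exp_ge_add_one_self[of "- x"] by simp
      ultimately show "\<exists>y. (f has_real_derivative y) (at x) \<and> 0 \<le> y" by blast
    qed
    then show ?thesis by (simp add: f_def)
  qed
  then show ?thesis using 1 by simp
qed

text \<open>Mass at both 0 and 1 makes the lattice span one, so the characteristic function has
  modulus below 1 on [-pi, pi] except at 0. The radius condition supplies all moments and room for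
  exponential tilting.\<close>

locale lattice_walk =
  fixes q :: "nat \<Rightarrow> real"
  assumes q_nonneg: "\<And>k. q k \<ge> 0"
    and q_sums: "q sums 1"
    and q0: "q 0 > 0" and q1: "q 1 > 0"
    and q_radius: "\<exists>R>1. summable (\<lambda>k. q k * R ^ k)"
begin

section \<open>Moments and characteristic function of one step\<close>

definition Q where "Q = Abs_fps q"
definition m where "m = (\<Sum>k. q k * real k)"
definition mom where "mom j = (\<Sum>k. q k * (real k - m) ^ j)"
abbreviation v where "v \<equiv> mom 2"

lemma summable_q: "summable q" using q_sums by (rule sums_summable)
lemma suminf_q: "suminf q = 1" using q_sums by (rule sums_unique[symmetric])

lemma summable_q_growth:
  fixes g :: "nat \<Rightarrow> real"
  assumes "\<And>R. R > 1 \<Longrightarrow> eventually (\<lambda>k. \<bar>g k\<bar> \<le> R ^ k) sequentially"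
  shows "summable (\<lambda>k. q k * g k)"
proof -
  obtain R where R: "R > 1" "summable (\<lambda>k. q k * R ^ k)" using q_radius by blast
  show ?thesis
  proof (rule summable_comparison_test_ev[OF _ R(2)])
    show "eventually (\<lambda>k. norm (q k * g k) \<le> q k * R ^ k) sequentially"
      using assms[OF R(1)] by eventually_elim (auto simp: abs_mult q_nonneg intro!: mult_left_mono)
  qed
qed

lemma summable_mean: "summable (\<lambda>k. q k * real k)"
proof (rule summable_q_growth)
  fix R :: real assume "R > 1"
  then show "eventually (\<lambda>k. \<bar>real k\<bar> \<le> R ^ k) sequentially" by real_asymp
qed

lemma power_growth:
  assumes "R > 1"
  shows "eventually (\<lambda>k. \<bar>(real k - m) ^ j\<bar> \<le> R ^ k) sequentially"
proof -
  \<comment> \<open>The root of order \<open>Suc j\<close> also makes sense for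
    \<open>j = 0\<close>.\<close>
  define r where "r = root (Suc j) R"
  have r: "r > 1" "r ^ Suc j = R" using assms by (auto simp: r_def simp del: power_Suc)
  have "eventually (\<lambda>k. a + real k \<le> r ^ k) sequentially" for a using r(1) by real_asymp
  then have "eventually (\<lambda>k. (\<bar>m\<bar> + 1) + real k \<le> r ^ k) sequentially" .
  then show ?thesis
  proof eventually_elim
    case (elim k)
    have "\<bar>(real k - m) ^ j\<bar> \<le> (\<bar>m\<bar> + 1 + real k) ^ j"
      unfolding power_abs by (intro power_mono) auto
    also have "\<dots> \<le> (\<bar>m\<bar> + 1 + real k) ^ Suc j" by (intro power_increasing) auto
    also have "\<dots> \<le> (r ^ k) ^ Suc j" using elim by (intro power_mono) auto
    also have "\<dots> = R ^ k" unfolding r(2)[symmetric] by (simp only: mult.commute flip: power_mult)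
    finally show ?case .
  qed
qed

lemma summable_mom: "summable (\<lambda>k. q k * (real k - m) ^ j)"
  by (rule summable_q_growth) (rule power_growth)

lemma mom_0: "mom 0 = 1" by (simp add: mom_def suminf_q)

lemma mom_1: "mom 1 = 0"
proof -
  have "(\<Sum>k. q k * (real k - m)) = (\<Sum>k. q k * real k - m * q k)"
    by (rule suminf_cong) (simp add: algebra_simps)
  also have "\<dots> = (\<Sum>k. q k * real k) - (\<Sum>k. m * q k)"
    by (rule suminf_diff[symmetric]) (auto intro: summable_mean summable_mult summable_q)
  also have "(\<Sum>k. m * q k) = m" using suminf_mult[OF summable_q, of m] by (simp add: suminf_q)
  finally show ?thesis by (simp add: mom_def m_def)
qed

lemma v_pos: "v > 0"
proof -
  have "m \<noteq> 0 \<or> m \<noteq> 1" by auto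
  then obtain i where i: "i < 2" "real i \<noteq> m" by (metis of_nat_0 of_nat_1 one_less_numeral_iff pos2 semiring_norm(76))
  have "0 < q i * (real i - m) ^ 2" using i q0 q1 by (cases i) auto
  also have "\<dots> \<le> v"
    unfolding mom_def using sum_le_suminf[OF summable_mom[of 2], of "{i}"] q_nonneg by simp
  finally show ?thesis .
qed

text \<open>This is the characteristic function of the centred step; centring removes the linear
  term of its expansion.\<close>

definition psi where "psi u = (\<Sum>k. q k *\<^sub>R iexp (u * (real k - m)))"

lemma summable_psi: "summable (\<lambda>k. norm (q k *\<^sub>R iexp (u * (real k - m))))"
  using summable_q q_nonneg by simp

lemma psi_taylor: "norm (psi u - (complex_of_real (1 - v * u ^ 2 / 2) - \<i> * complex_of_real (mom 3 * u ^ 3 / 6))) \<le> mom 4 / 24 * u ^ 4"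
proof -
  let ?P = "\<lambda>k. (\<Sum>j\<le>3. (\<i> * complex_of_real (u * (real k - m))) ^ j / fact j)"
  have sm: "(\<lambda>k. complex_of_real (q k * (real k - m) ^ j)) sums complex_of_real (mom j)" for j
    unfolding mom_def by (intro sums_of_real summable_sums summable_mom)
  have "(\<lambda>k. (\<Sum>j\<le>3. (\<i> * u) ^ j / fact j * complex_of_real (q k * (real k - m) ^ j)))
      sums (\<Sum>j\<le>3. (\<i> * u) ^ j / fact j * complex_of_real (mom j))"
    by (intro sums_sum sums_mult sm)
  moreover have "(\<Sum>j\<le>3. (\<i> * u) ^ j / fact j * complex_of_real (q k * (real k - m) ^ j)) = q k *\<^sub>R ?P k" for k
    by (simp add: scaleR_conv_of_real sum_distrib_left power_mult_distrib mult_ac)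
  moreover have "(\<Sum>j\<le>3. (\<i> * u) ^ j / fact j * complex_of_real (mom j))
      = complex_of_real (1 - v * u ^ 2 / 2) - \<i> * complex_of_real (mom 3 * u ^ 3 / 6)"
    using mom_1 by (simp add: eval_nat_numeral mom_0 algebra_simps)
  ultimately have P: "(\<lambda>k. q k *\<^sub>R ?P k) sums (complex_of_real (1 - v * u ^ 2 / 2) - \<i> * complex_of_real (mom 3 * u ^ 3 / 6))" by simp
  have psi: "(\<lambda>k. q k *\<^sub>R iexp (u * (real k - m))) sums psi u"
    unfolding psi_def by (intro summable_sums summable_norm_cancel[OF summable_psi])
  have d: "(\<lambda>k. q k *\<^sub>R (iexp (u * (real k - m)) - ?P k)) sums (psi u - (complex_of_real (1 - v * u ^ 2 / 2) - \<i> * complex_of_real (mom 3 * u ^ 3 / 6)))"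
    using sums_diff[OF psi P] by (simp add: scaleR_diff_right)
  have le: "norm (q k *\<^sub>R (iexp (u * (real k - m)) - ?P k)) \<le> u ^ 4 / 24 * (q k * (real k - m) ^ 4)" for k
  proof -
    have "norm (iexp (u * (real k - m)) - ?P k) \<le> \<bar>u * (real k - m)\<bar> ^ Suc 3 / fact (Suc 3)"
      by (rule iexp_approx1)
    also have "\<dots> = u ^ 4 * (real k - m) ^ 4 / 24"
      by (simp add: fact_numeral abs_mult power_mult_distrib flip: power_abs)
    finally show ?thesis
      using mult_left_mono[OF _ q_nonneg[of k], of "norm (iexp (u * (real k - m)) - ?P k)"
          "u ^ 4 * (real k - m) ^ 4 / 24"] q_nonneg[of k] unfolding norm_scaleR by (simp only: abs_of_nonneg) argo
  qed
  have s4: "summable (\<lambda>k. u ^ 4 / 24 * (q k * (real k - m) ^ 4))" by (intro summable_mult summable_mom)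
  have "norm (psi u - (complex_of_real (1 - v * u ^ 2 / 2) - \<i> * complex_of_real (mom 3 * u ^ 3 / 6))) \<le> (\<Sum>k. u ^ 4 / 24 * (q k * (real k - m) ^ 4))"
    unfolding sums_unique[OF d] by (rule norm_suminf_le[OF le s4])
  also have "\<dots> = mom 4 / 24 * u ^ 4"
    unfolding mom_def by (subst suminf_mult[OF summable_mom]) simp
  finally show ?thesis .
qed

text \<open>The terms of index 0 and 1 alone produce enough cancellation: all others are bounded by
  their total mass \<open>1 - q 0 - q 1\<close>.\<close>

lemma norm_psi_le:
  shows "\<exists>c>0. \<forall>u. \<bar>u\<bar> \<le> pi \<longrightarrow> norm (psi u) \<le> exp (- (c * u\<^sup>2))"
proof -
  define c where "c = 2 * q 0 * q 1 / ((q 0 + q 1) * pi\<^sup>2)"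
  have "c > 0" using q0 q1 by (simp add: c_def)
  moreover have "norm (psi u) \<le> exp (- (c * u\<^sup>2))" if u: "\<bar>u\<bar> \<le> pi" for u
  proof -
    define f where "f = (\<lambda>k. q k *\<^sub>R iexp (u * (real k - m)))"
    have sf: "summable f" unfolding f_def using summable_norm_cancel[OF summable_psi] .
    have snf: "summable (\<lambda>k. norm (f k))" unfolding f_def using summable_psi .
    have "psi u = (\<Sum>k. f (k + 2)) + (f 0 + f 1)"
      unfolding psi_def f_def[symmetric] using suminf_split_initial_segment[OF sf, of 2] by (simp add: eval_nat_numeral)
    then have "norm (psi u) \<le> norm (\<Sum>k. f (k + 2)) + norm (f 0 + f 1)"
      by (simp add: norm_triangle_ineq)
    also have "norm (\<Sum>k. f (k + 2)) \<le> (\<Sum>k. norm (f (k + 2)))"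
      by (intro summable_norm summable_ignore_initial_segment[OF snf])
    also have "(\<Sum>k. norm (f (k + 2))) = 1 - q 0 - q 1"
      using suminf_split_initial_segment[OF summable_q, of 2] q_nonneg
      by (simp add: f_def suminf_q eval_nat_numeral)
    also have "norm (f 0 + f 1) \<le> q 0 + q 1 - q 0 * q 1 * (1 - cos u) / (q 0 + q 1)"
    proof -
      have "f 0 + f 1 = iexp (- u * m) * (q 0 + q 1 * iexp u)"
        by (simp add: f_def scaleR_conv_of_real algebra_simps flip: exp_add)
      then have "norm (f 0 + f 1) = norm (complex_of_real (q 0) + q 1 * iexp u)"
        by (simp add: norm_mult)
      also have "\<dots> = norm (Complex (q 0 + q 1 * cos u) (q 1 * sin u))"
        by (intro arg_cong[of _ _ norm] complex_eqI) (simp_all flip: cis_conv_exp)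
      finally have "norm (f 0 + f 1) ^ 2 = (q 0 + q 1 * cos u)\<^sup>2 + (q 1 * sin u)\<^sup>2"
        by (simp add: cmod_power2)
      also have "\<dots> = (q 0 + q 1)\<^sup>2 - 2 * (q 0 * q 1 * (1 - cos u))"
        using sin_cos_squared_add[of u] by algebra
      \<comment> \<open>Completing the square, s^2 - 2 w \<le> (s - w / s)^2 with s = q 0 + q 1,
        bounds the modulus without a square root.\<close>
      also have "\<dots> \<le> (q 0 + q 1 - q 0 * q 1 * (1 - cos u) / (q 0 + q 1))\<^sup>2"
      proof -
        have "(s - w / s)\<^sup>2 = s\<^sup>2 - 2 * w + (w / s)\<^sup>2" if "s > 0" for s w :: real
          using that by (simp add: power2_eq_square field_simps)
        from this[of "q 0 + q 1" "q 0 * q 1 * (1 - cos u)"] show ?thesis using q0 q1 by simp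
      qed
      finally show ?thesis
      proof (rule power2_le_imp_le)
        have "q 0 * q 1 * (1 - cos u) \<le> q 0 * q 1 * 2"
          using q0 q1 cos_ge_minus_one[of u] by (intro mult_left_mono) auto
        also have "\<dots> \<le> (q 0 + q 1)\<^sup>2"
          using zero_le_power2[of "q 0"] zero_le_power2[of "q 1"] by (simp add: power2_eq_square algebra_simps)
        finally show "0 \<le> q 0 + q 1 - q 0 * q 1 * (1 - cos u) / (q 0 + q 1)"
          using q0 q1 by (simp add: field_simps power2_eq_square)
      qed
    qed
    also have "1 - q 0 - q 1 + (q 0 + q 1 - q 0 * q 1 * (1 - cos u) / (q 0 + q 1))
        = 1 - q 0 * q 1 / (q 0 + q 1) * (1 - cos u)" by simp
    also have "\<dots> \<le> 1 - q 0 * q 1 / (q 0 + q 1) * (2 * u\<^sup>2 / pi\<^sup>2)"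
      using q0 q1 by (intro diff_left_mono mult_left_mono one_minus_cos_ge[OF u]) auto
    also have "\<dots> = 1 - c * u\<^sup>2" by (simp add: c_def)
    also have "\<dots> \<le> exp (- (c * u\<^sup>2))" using exp_ge_add_one_self[of "- (c * u\<^sup>2)"] by simp
    finally show ?thesis by simp
  qed
  ultimately show ?thesis by blast
qed

end

lemma integral_cos_period:
  fixes M N :: nat
  shows
  "(LINT u|lborel. indicator {-pi..pi} u * cos (u * (real M - real N))) = (if M = N then 2 * pi else 0)"
proof (cases "M = N")
  case True
  then show ?thesis by simp
next
  case False
  define j where "j = real M - real N"
  have j: "j \<noteq> 0" using False by (simp add: j_def)
  have "sin (pi * j) = 0"
    by (simp add: j_def right_diff_distrib sin_diff sin_npi2)
  moreover have "(LINT u|lborel. cos (u * j) * indicator {-pi..pi} u) = sin (pi * j) / j - sin (- pi * j) / j"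
    using j by (intro integral_FTC_Icc_real) (auto intro!: derivative_eq_intros continuous_intros)
  ultimately show ?thesis using False by (simp add: j_def mult.commute)
qed

text \<open>For positive \<open>x\<close> the bound exp x - 1 \<le> x exp x is used twice; for
  negative \<open>x\<close> the Taylor bound is better than required. Averaged over the steps, it
  controls the moment generating function.\<close>

lemma exp_le_quadratic: "exp x \<le> 1 + x + x\<^sup>2 * exp \<bar>x\<bar>" for x :: real
proof (cases "x \<ge> 0")
  case True
  have "1 - x \<le> exp (- x)" using exp_ge_add_one_self[of "- x"] by simp
  then have "(1 - x) * exp x \<le> exp (- x) * exp x" by (rule mult_right_mono) simp
  then have 1: "exp x - 1 \<le> x * exp x" by (simp add: algebra_simps flip: exp_add)
  then have "x * (exp x - 1) \<le> x * (x * exp x)" using True by (rule mult_left_mono)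
  then show ?thesis using 1 True by (simp add: power2_eq_square algebra_simps)
next
  case False
  have "exp x \<le> 1 + x + x\<^sup>2 / 2" using exp_neg_quadratic[of "- x"] False by simp
  also have "\<dots> \<le> 1 + x + x\<^sup>2 * exp \<bar>x\<bar>"
  proof -
    have "1 / 2 \<le> exp \<bar>x\<bar>" using one_le_exp_iff[of "\<bar>x\<bar>"] by linarith
    from mult_left_mono[OF this, of "x\<^sup>2"] show ?thesis by simp
  qed
  finally show ?thesis .
qed

section \<open>Fourier inversion, local limit theorem and Chernoff bound\<close>

context lattice_walk
begin

text \<open>A complex copy of \<open>Q\<close> allows evaluation on the unit circle.\<close>

definition Qc where "Qc = Abs_fps (\<lambda>k. complex_of_real (q k))"

lemma Qc_power: "(Qc ^ S) $ N = complex_of_real ((Q ^ S) $ N)"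
  by (induction S arbitrary: N) (auto simp: fps_mult_nth Qc_def Q_def)

lemma Q_power_nonneg: "(Q ^ S) $ N \<ge> 0"
  by (rule fps_nth_power_nonneg) (simp add: Q_def q_nonneg)

lemma Q_radius: "ereal 1 < fps_conv_radius Q" "ereal 1 < fps_conv_radius Qc"
proof -
  obtain R where R: "R > 1" "summable (\<lambda>k. q k * R ^ k)" using q_radius by blast
  have "fps_conv_radius Q \<ge> norm R"
    unfolding fps_conv_radius_def Q_def fps_nth_Abs_fps by (rule conv_radius_geI[OF R(2)])
  then show "ereal 1 < fps_conv_radius Q" using R(1) by (auto intro: less_le_trans[of "ereal 1" "ereal R"])
  have "summable (\<lambda>k. complex_of_real (q k) * complex_of_real R ^ k)"
    using summable_of_real[OF R(2)] by simp
  then have "fps_conv_radius Qc \<ge> norm (complex_of_real R)"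
    unfolding fps_conv_radius_def Qc_def fps_nth_Abs_fps by (rule conv_radius_geI)
  then show "ereal 1 < fps_conv_radius Qc" using R(1) by (auto intro: less_le_trans[of "ereal 1" "ereal R"])
qed

lemma summable_Q_power: "summable (\<lambda>N. (Q ^ S) $ N)"
proof -
  have "ereal (norm (1::real)) < fps_conv_radius (Q ^ S)"
    using Q_radius(1) fps_conv_radius_power[of Q S] by (auto intro: less_le_trans)
  from summable_fps[OF this] show ?thesis by simp
qed

lemma psi_eq_eval: "psi u = iexp (- u * m) * eval_fps Qc (iexp u)"
proof -
  have r: "ereal (norm (iexp u)) < fps_conv_radius Qc" using Q_radius(2) by simp
  have "(\<lambda>k. iexp (- u * m) * (complex_of_real (q k) * iexp u ^ k)) sums (iexp (- u * m) * eval_fps Qc (iexp u))"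
    using sums_eval_fps[OF r] by (intro sums_mult) (simp add: Qc_def)
  moreover have "iexp (- u * m) * (complex_of_real (q k) * iexp u ^ k) = q k *\<^sub>R iexp (u * (real k - m))" for k
    by (simp add: scaleR_conv_of_real algebra_simps flip: exp_of_nat_mult exp_add)
  ultimately show ?thesis unfolding psi_def using sums_unique by force
qed

lemma psi_power_sums:
  "(\<lambda>M. (Q ^ S) $ M * cos (u * (real M - real N))) sums Re (psi u ^ S * iexp (- (real N - real S * m) * u))"
proof -
  have r: "ereal (norm (iexp u)) < fps_conv_radius Qc" using Q_radius(2) by simp
  have "(\<lambda>M. complex_of_real ((Q ^ S) $ M) * iexp u ^ M) sums eval_fps (Qc ^ S) (iexp u)"
    using sums_eval_fps[of "iexp u" "Qc ^ S"] r fps_conv_radius_power[of Qc S]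
    by (auto simp: Qc_power intro: less_le_trans)
  then have "(\<lambda>M. iexp (- u * N) * (complex_of_real ((Q ^ S) $ M) * iexp u ^ M)) sums (iexp (- u * N) * eval_fps Qc (iexp u) ^ S)"
    unfolding eval_fps_power[OF r] by (rule sums_mult)
  also have "iexp (- u * N) * eval_fps Qc (iexp u) ^ S = psi u ^ S * iexp (- (real N - real S * m) * u)"
  proof -
    have "iexp (- u * m) ^ S * iexp (- (real N - real S * m) * u) = iexp (- u * N)"
      by (simp add: algebra_simps flip: exp_of_nat_mult exp_add)
    then show ?thesis unfolding psi_eq_eval power_mult_distrib by (metis mult.assoc mult.commute)
  qed
  also have "(\<lambda>M. iexp (- u * N) * (complex_of_real ((Q ^ S) $ M) * iexp u ^ M))
      = (\<lambda>M. complex_of_real ((Q ^ S) $ M) * iexp (u * (real M - real N)))"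
    by (rule ext) (simp add: algebra_simps flip: exp_of_nat_mult exp_add)
  finally have "(\<lambda>M. Re (complex_of_real ((Q ^ S) $ M) * iexp (u * (real M - real N)))) sums
      Re (psi u ^ S * iexp (- (real N - real S * m) * u))" by (rule sums_Re)
  then show ?thesis by (simp add: Re_exp)
qed

text \<open>The coefficients are real, so real parts suffice. Termwise integration is justified by
  the summable coefficients of \<open>Q ^ S\<close>, and orthogonality of cosines over a period
  picks out the one at \<open>N\<close>.\<close>

lemma fourier_inversion:
  "integrable lborel (\<lambda>u. indicator {-pi..pi} u * Re (psi u ^ S * iexp (- (real N - real S * m) * u)))"
  "(LINT u|lborel. indicator {-pi..pi} u * Re (psi u ^ S * iexp (- (real N - real S * m) * u))) = 2 * pi * (Q ^ S) $ N"
proof -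
  define f where "f = (\<lambda>M u. (Q ^ S) $ M * (indicator {-pi..pi} u * cos (u * (real M - real N))))"
  have bnd: "norm (f M u) \<le> (Q ^ S) $ M * indicator {-pi..pi} u" for M u
    using Q_power_nonneg[of S M] by (auto simp: f_def abs_mult mult_left_le split: split_indicator)
  have ind: "integrable lborel (\<lambda>u. indicator {-pi..pi} u :: real)" by simp
  have int: "integrable lborel (f M)" for M
    by (rule Bochner_Integration.integrable_bound[OF integrable_mult_right[OF ind, of "(Q ^ S) $ M"]])
       (use bnd Q_power_nonneg in \<open>auto simp: f_def\<close>)
  have sm: "summable (\<lambda>M. norm (f M u))" for u
    by (rule summable_comparison_test'[OF summable_mult2[OF summable_Q_power[of S], of "indicator {-pi..pi} u"]])
       (use bnd in auto)
  have si: "summable (\<lambda>M. LINT u|lborel. norm (f M u))"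
  proof (rule summable_comparison_test'[OF summable_mult2[OF summable_Q_power[of S], of "2 * pi"]])
    fix M
    have "(LINT u|lborel. norm (f M u)) \<le> (LINT u|lborel. (Q ^ S) $ M * indicator {-pi..pi} u)"
      using bnd int by (intro integral_mono) auto
    then show "norm (LINT u|lborel. norm (f M u)) \<le> (Q ^ S) $ M * (2 * pi)" by simp
  qed
  have F: "(\<Sum>M. f M u) = indicator {-pi..pi} u * Re (psi u ^ S * iexp (- (real N - real S * m) * u))" for u
    using sums_mult[OF psi_power_sums[of S u N], of "indicator {-pi..pi} u"]
    by (auto simp: f_def mult.left_commute dest: sums_unique)
  have AE: "AE u in lborel. summable (\<lambda>M. norm (f M u))" using sm by simp
  show "integrable lborel (\<lambda>u. indicator {-pi..pi} u * Re (psi u ^ S * iexp (- (real N - real S * m) * u)))"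
    using integrable_suminf[OF int AE si] unfolding F .
  have "(\<lambda>M. LINT u|lborel. f M u) sums (LINT u|lborel. indicator {-pi..pi} u * Re (psi u ^ S * iexp (- (real N - real S * m) * u)))"
    using sums_integral[OF int AE si] unfolding F .
  moreover have "(LINT u|lborel. f M u) = (if M = N then 2 * pi * (Q ^ S) $ M else 0)" for M
    using integral_cos_period[of M N] by (simp add: f_def)
  ultimately have "(\<lambda>M. if M = N then 2 * pi * (Q ^ S) $ M else 0) sums
      (LINT u|lborel. indicator {-pi..pi} u * Re (psi u ^ S * iexp (- (real N - real S * m) * u)))" by simp
  from sums_unique2[OF this sums_single[of N "\<lambda>M. 2 * pi * (Q ^ S) $ M"]]
  show "(LINT u|lborel. indicator {-pi..pi} u * Re (psi u ^ S * iexp (- (real N - real S * m) * u))) = 2 * pi * (Q ^ S) $ N" .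
qed

text \<open>The cubic Taylor term of \<open>psi\<close> is purely imaginary, so its contribution to the real part
  carries the factor \<open>sin (t * u)\<close>. This gains one order: the error is \<open>O((1 + |t|) / S)\<close> instead
  of \<open>O(1 / sqrt S)\<close>, which is what locating the maximum up to \<open>O(1)\<close> needs.\<close>

lemma psi_power_approx:
  "\<exists>c>0. \<exists>C\<ge>0. \<forall>S\<ge>2. \<forall>u t.
    \<bar>indicator {-pi..pi} u * Re (psi u ^ S * iexp (- t * u)) - exp (- (v * real S * u\<^sup>2) / 2) * cos (t * u)\<bar>
      \<le> C * (1 + \<bar>t\<bar>) / real S * exp (- (c * real S * u\<^sup>2) / 2)"
proof -
  obtain c0 where c0: "c0 > 0" "\<And>u. \<bar>u\<bar> \<le> pi \<Longrightarrow> norm (psi u) \<le> exp (- (c0 * u\<^sup>2))"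
    using norm_psi_le by blast
  \<comment> \<open>A common decay rate for \<open>psi\<close> and for the Gaussian
    \<open>g\<close>, whose own rate is v / 2.\<close>
  define c where "c = min c0 (v / 2)"
  have c: "c > 0" "c \<le> c0" "c \<le> v / 2" using c0 v_pos by (auto simp: c_def)
  define g where "g = (\<lambda>u. exp (- (v * u\<^sup>2) / 2))"
  define r where "r = (\<lambda>u. exp (- (c * u\<^sup>2)))"
  define K1 where "K1 = mom 4 / 24 + v\<^sup>2 / 8"
  define K2 where "K2 = \<bar>mom 3\<bar> / 6 + K1 * pi"
  \<comment> \<open>The expansion leaves the power \<open>S - 2\<close> of \<open>r u\<close>
    instead of \<open>S\<close>; for |u| \<le> pi the two missing factors cost at most
    \<open>B\<close>.\<close>
  define B where "B = exp (2 * c * pi\<^sup>2)"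
  have mom4: "mom 4 \<ge> 0"
    unfolding mom_def by (intro suminf_nonneg summable_mom mult_nonneg_nonneg q_nonneg) auto
  have K: "K1 \<ge> 0" "K2 \<ge> 0" using mom4 by (auto simp: K1_def K2_def)
  have g_power: "g u ^ S = exp (- (v * real S * u\<^sup>2) / 2)" for u S
    by (simp add: g_def mult_ac flip: exp_of_nat_mult)
  have gr: "g u \<le> r u" for u
    using mult_right_mono[OF c(3), of "u\<^sup>2"] by (simp add: g_def r_def)
  have psir: "norm (psi u) \<le> r u" if "\<bar>u\<bar> \<le> pi" for u
    using c0(2)[OF that] mult_right_mono[OF c(2), of "u\<^sup>2"]
    unfolding r_def by (meson exp_le_cancel_iff neg_le_iff_le order_trans zero_le_power2)
  define d where "d = (\<lambda>u. psi u - complex_of_real (g u))"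
  \<comment> \<open>\<open>psi\<close> and the Gaussian agree to second order, so their difference
    is the cubic Taylor term plus O(u^4).\<close>
  have d4: "norm (d u + \<i> * complex_of_real (mom 3 * u ^ 3 / 6)) \<le> K1 * u ^ 4" for u
  proof -
    have "\<bar>exp (- (v * u\<^sup>2 / 2)) - (1 - v * u\<^sup>2 / 2)\<bar> \<le> (v * u\<^sup>2 / 2)\<^sup>2 / 2"
      using v_pos by (intro exp_neg_quadratic) auto
    also have "\<dots> = v\<^sup>2 / 8 * u ^ 4" by (simp add: power_mult_distrib power_divide flip: power_mult)
    finally have "norm (complex_of_real (1 - v * u ^ 2 / 2) - complex_of_real (g u)) \<le> v\<^sup>2 / 8 * u ^ 4"
      unfolding of_real_diff[symmetric] norm_of_real g_def by (simp add: abs_minus_commute)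
    then have "norm ((psi u - (complex_of_real (1 - v * u ^ 2 / 2) - \<i> * complex_of_real (mom 3 * u ^ 3 / 6)))
        + (complex_of_real (1 - v * u ^ 2 / 2) - complex_of_real (g u))) \<le> mom 4 / 24 * u ^ 4 + v\<^sup>2 / 8 * u ^ 4"
      by (intro norm_triangle_le add_mono psi_taylor)
    then show ?thesis by (simp add: d_def K1_def algebra_simps)
  qed
  have d3: "norm (d u) \<le> K2 * \<bar>u\<bar> ^ 3" if "\<bar>u\<bar> \<le> pi" for u
  proof -
    have "norm (d u) \<le> norm (d u + \<i> * complex_of_real (mom 3 * u ^ 3 / 6)) + norm (\<i> * complex_of_real (mom 3 * u ^ 3 / 6))"
      by (metis add_diff_cancel norm_triangle_ineq4)
    also have "norm (\<i> * complex_of_real (mom 3 * u ^ 3 / 6)) = \<bar>mom 3\<bar> / 6 * \<bar>u\<bar> ^ 3"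
      unfolding norm_mult norm_of_real by (simp add: abs_mult power_abs)
    also have "norm (d u + \<i> * complex_of_real (mom 3 * u ^ 3 / 6)) \<le> K1 * (\<bar>u\<bar> * \<bar>u\<bar> ^ 3)"
      using d4[of u] by (simp add: power_even_abs flip: power_Suc)
    also have "\<dots> \<le> K1 * (pi * \<bar>u\<bar> ^ 3)" using that K by (intro mult_left_mono mult_right_mono) auto
    finally show ?thesis by (simp add: K2_def algebra_simps)
  qed
  define C where "C = B * (K2\<^sup>2 * ((2 / c) ^ 3 * 6) + (K1 + \<bar>mom 3\<bar> / 6) * ((2 / c) ^ 2 * 2)) + 2 / c"
  have C: "C \<ge> 0" using K c by (auto simp: C_def B_def)
  have main: "\<bar>indicator {-pi..pi} u * Re (psi u ^ S * iexp (- t * u)) - exp (- (v * real S * u\<^sup>2) / 2) * cos (t * u)\<bar>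
      \<le> C * (1 + \<bar>t\<bar>) / real S * exp (- (c * real S * u\<^sup>2) / 2)" if S: "S \<ge> 2" for S u t
  proof (cases "\<bar>u\<bar> \<le> pi")
    case False
    then have ind: "indicator {-pi..pi} u = (0::real)" by (auto split: split_indicator)
    have "1 \<le> u\<^sup>2"
    proof -
      have "1 \<le> \<bar>u\<bar>" using False pi_ge_two by linarith
      then show ?thesis by (metis one_le_power power2_abs)
    qed
    \<comment> \<open>Outside the period only the Gaussian tail is left. Since u^2 \<ge> 1, a factor
      u^2 = (S u^2) / S can be inserted, which gains 1 / S.\<close>
    have "\<bar>exp (- (v * real S * u\<^sup>2) / 2) * cos (t * u)\<bar> \<le> exp (- (v * real S * u\<^sup>2) / 2)"
      by (simp add: abs_mult mult_left_le)
    also have "\<dots> \<le> exp (- (c * real S * u\<^sup>2))"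
      using mult_right_mono[OF c(3), of "real S * u\<^sup>2"] by (simp add: mult_ac)
    also have "\<dots> \<le> u\<^sup>2 * exp (- (c * real S * u\<^sup>2))" using \<open>1 \<le> u\<^sup>2\<close> by simp
    also have "\<dots> = (real S * u\<^sup>2) ^ 1 * exp (- (c * real S * u\<^sup>2)) / real S" using S by simp
    also have "\<dots> \<le> (2 / c) ^ 1 * fact 1 * exp (- (c * real S * u\<^sup>2) / 2) / real S"
      using S c by (intro divide_right_mono power_times_exp_neg_le) auto
    also have "\<dots> = 2 / c * 1 / real S * exp (- (c * real S * u\<^sup>2) / 2)" by simp
    also have "\<dots> \<le> C * (1 + \<bar>t\<bar>) / real S * exp (- (c * real S * u\<^sup>2) / 2)"
    proof (intro mult_right_mono divide_right_mono mult_mono)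
      show "2 / c \<le> C" using K c by (simp add: C_def B_def)
    qed (use C in auto)
    finally show ?thesis using ind by simp
  next
    case True
    then have ind: "indicator {-pi..pi} u = (1::real)" by (auto split: split_indicator)
    obtain n where n: "S = n + 2" using S by (metis add.commute le_Suc_ex)
    define E where "E = exp (- (c * real S * u\<^sup>2))"
    have rn: "r u ^ n \<le> B * E"
    proof -
      have "u\<^sup>2 \<le> pi\<^sup>2" using True by (metis abs_ge_zero power2_abs power_mono)
      then have "c * u\<^sup>2 * 2 \<le> c * pi\<^sup>2 * 2" using c by simp
      then have "exp (- (c * real n * u\<^sup>2)) \<le> exp (2 * c * pi\<^sup>2 - c * real S * u\<^sup>2)"
        by (simp add: n algebra_simps)
      then show ?thesis
        by (simp add: r_def B_def E_def mult_ac flip: exp_of_nat_mult exp_add)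
    qed
    have r01: "0 \<le> r u" "r u \<le> 1" using c by (auto simp: r_def)
    have g0: "0 \<le> g u" by (simp add: g_def)
    have gn1: "g u ^ (n + 1) \<le> B * E"
    proof -
      have "g u ^ (n + 1) \<le> r u ^ (n + 1)" using gr g0 by (intro power_mono) auto
      also have "\<dots> \<le> r u ^ n" using r01 by (intro power_decreasing) auto
      finally show ?thesis using rn by linarith
    qed
    \<comment> \<open>\<open>D\<close> is the part of the \<open>S\<close>-th power beyond first
      order in \<open>d u\<close>; it is quadratic in \<open>d u\<close>, hence of order S^2 u^6
      before the decay.\<close>
    define D where "D = psi u ^ (n + 2) - complex_of_real (g u) ^ (n + 2)
        - of_nat (n + 2) * complex_of_real (g u) ^ (n + 1) * d u"
    have D: "norm D \<le> real S ^ 2 * (B * E) * (K2 * \<bar>u\<bar> ^ 3) ^ 2"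
    proof -
      have "norm D \<le> real (n + 2) ^ 2 * r u ^ n * norm (d u) ^ 2"
        unfolding D_def d_def by (rule norm_power_diff_linear_le) (use psir[OF True] gr g0 in auto)
      also have "\<dots> \<le> real S ^ 2 * (B * E) * (K2 * \<bar>u\<bar> ^ 3) ^ 2"
        using rn d3[OF True] unfolding n by (intro mult_mono power_mono mult_left_mono) (auto simp: B_def E_def)
      finally show ?thesis .
    qed
    define e where "e = d u + \<i> * complex_of_real (mom 3 * u ^ 3 / 6)"
    define k where "k = real S * g u ^ (n + 1)"
    have k: "0 \<le> k" "k \<le> real S * (B * E)" using gn1 g0 by (auto simp: k_def intro!: mult_left_mono)
    have "psi u ^ S = complex_of_real (g u ^ S) + D + complex_of_real k * e
        - complex_of_real k * (\<i> * complex_of_real (mom 3 * u ^ 3 / 6))"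
      by (simp add: D_def e_def k_def n algebra_simps)
    then have "psi u ^ S * iexp (- t * u) = complex_of_real (g u ^ S) * iexp (- t * u)
        + (D + complex_of_real k * e) * iexp (- t * u)
        - complex_of_real (k * (mom 3 * u ^ 3 / 6)) * (\<i> * iexp (- t * u))"
      by (simp only: of_real_mult) (simp only: algebra_simps)
    then have "Re (psi u ^ S * iexp (- t * u)) = g u ^ S * cos (t * u)
        + Re ((D + complex_of_real k * e) * iexp (- t * u)) - k * (mom 3 * u ^ 3 / 6) * sin (t * u)"
      by (simp add: Re_exp Im_exp del: of_real_power)
    then have "\<bar>Re (psi u ^ S * iexp (- t * u)) - g u ^ S * cos (t * u)\<bar>
        \<le> \<bar>Re ((D + complex_of_real k * e) * iexp (- t * u))\<bar> + \<bar>k * (mom 3 * u ^ 3 / 6) * sin (t * u)\<bar>" by linarith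
    also have "\<bar>Re ((D + complex_of_real k * e) * iexp (- t * u))\<bar> \<le> norm (D + complex_of_real k * e)"
      using abs_Re_le_cmod[of "(D + complex_of_real k * e) * iexp (- t * u)"] norm_exp_i_times[of "- t * u"]
      by (simp add: norm_mult del: norm_exp_i_times)
    also have "\<dots> \<le> norm D + k * norm e" using k norm_triangle_ineq[of D "k * e"] by (simp add: norm_mult)
    also have "\<dots> \<le> real S ^ 2 * (B * E) * (K2 * \<bar>u\<bar> ^ 3) ^ 2 + real S * (B * E) * (K1 * u ^ 4)"
      using d4[of u] k D by (intro add_mono mult_mono) (auto simp: e_def)
    also have "\<bar>k * (mom 3 * u ^ 3 / 6) * sin (t * u)\<bar> \<le> real S * (B * E) * (\<bar>mom 3\<bar> * \<bar>u\<bar> ^ 3 / 6) * (\<bar>t\<bar> * \<bar>u\<bar>)"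
      unfolding abs_mult using k abs_sin_x_le_abs_x[of "t * u"]
      by (intro mult_mono) (auto simp: abs_mult power_abs)
    \<comment> \<open>Powers of u are matched with powers of S: S^2 u^6 = (S u^2)^3 / S and S u^4 =
      (S u^2)^2 / S.\<close>
    also have "real S ^ 2 * (B * E) * (K2 * \<bar>u\<bar> ^ 3) ^ 2 + real S * (B * E) * (K1 * u ^ 4)
         + real S * (B * E) * (\<bar>mom 3\<bar> * \<bar>u\<bar> ^ 3 / 6) * (\<bar>t\<bar> * \<bar>u\<bar>)
        = (B * K2\<^sup>2 * ((real S * u\<^sup>2) ^ 3 * E) + B * (K1 + \<bar>mom 3\<bar> / 6 * \<bar>t\<bar>) * ((real S * u\<^sup>2) ^ 2 * E)) / real S"
    proof -
      have "u ^ 4 = \<bar>u\<bar> ^ 4" "u\<^sup>2 = \<bar>u\<bar>\<^sup>2" by (simp_all add: power_even_abs)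
      then show ?thesis using S by (simp add: eval_nat_numeral field_simps)
    qed
    also have "\<dots> \<le> (B * K2\<^sup>2 * ((2 / c) ^ 3 * fact 3 * exp (- (c * real S * u\<^sup>2) / 2))
        + B * (K1 + \<bar>mom 3\<bar> / 6 * \<bar>t\<bar>) * ((2 / c) ^ 2 * fact 2 * exp (- (c * real S * u\<^sup>2) / 2))) / real S"
      unfolding E_def using S c K
      by (intro divide_right_mono add_mono mult_left_mono power_times_exp_neg_le) (auto simp: B_def)
    also have "\<dots> = (B * K2\<^sup>2 * ((2 / c) ^ 3 * 6) * 1
        + B * ((2 / c) ^ 2 * 2) * (K1 + \<bar>mom 3\<bar> / 6 * \<bar>t\<bar>)) / real S * exp (- (c * real S * u\<^sup>2) / 2)"
      by (simp add: fact_numeral add_divide_distrib algebra_simps)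
    also have "\<dots> \<le> (C * (1 + \<bar>t\<bar>)) / real S * exp (- (c * real S * u\<^sup>2) / 2)"
    proof (intro mult_right_mono divide_right_mono)
      have "B * K2\<^sup>2 * ((2 / c) ^ 3 * 6) * 1 \<le> B * K2\<^sup>2 * ((2 / c) ^ 3 * 6) * (1 + \<bar>t\<bar>)"
        using c by (intro mult_left_mono) (auto simp: B_def)
      moreover have "B * ((2 / c) ^ 2 * 2) * (K1 + \<bar>mom 3\<bar> / 6 * \<bar>t\<bar>) \<le> B * ((2 / c) ^ 2 * 2) * ((K1 + \<bar>mom 3\<bar> / 6) * (1 + \<bar>t\<bar>))"
      proof (rule mult_left_mono)
        have "0 \<le> K1 * \<bar>t\<bar> + \<bar>mom 3\<bar> / 6" using K by simp
        then show "K1 + \<bar>mom 3\<bar> / 6 * \<bar>t\<bar> \<le> (K1 + \<bar>mom 3\<bar> / 6) * (1 + \<bar>t\<bar>)"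
          by (simp only: distrib_left distrib_right mult_1_right)
      qed (use c in \<open>auto simp: B_def\<close>)
      moreover have "0 \<le> 2 / c * (1 + \<bar>t\<bar>)" using c by simp
      ultimately show "B * K2\<^sup>2 * ((2 / c) ^ 3 * 6) * 1 + B * ((2 / c) ^ 2 * 2) * (K1 + \<bar>mom 3\<bar> / 6 * \<bar>t\<bar>) \<le> C * (1 + \<bar>t\<bar>)"
        unfolding C_def by (simp only: distrib_right distrib_left mult_ac)
    qed auto
    finally show ?thesis using ind g_power[of u S] by simp
  qed
  show ?thesis using c(1) C main by blast
qed

text \<open>The pointwise error carries 1 / S; integrating it against a Gaussian of width S^(-1/2)
  supplies the remaining factor.\<close>

theorem local_limit:
  "\<exists>C\<ge>0. \<forall>S\<ge>2. \<forall>N.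
    \<bar>(Q ^ S) $ N - exp (- (real N - real S * m)\<^sup>2 / (2 * v * real S)) / sqrt (2 * pi * v * real S)\<bar>
      \<le> C * (1 + \<bar>real N - real S * m\<bar>) / (real S * sqrt (real S))"
proof -
  obtain c C where c: "c > 0" "C \<ge> 0" and approx: "\<And>S u t. S \<ge> 2 \<Longrightarrow>
    \<bar>indicator {-pi..pi} u * Re (psi u ^ S * iexp (- t * u)) - exp (- (v * real S * u\<^sup>2) / 2) * cos (t * u)\<bar>
      \<le> C * (1 + \<bar>t\<bar>) / real S * exp (- (c * real S * u\<^sup>2) / 2)"
    using psi_power_approx by blast
  define C' where "C' = C * sqrt (2 * pi / c) / (2 * pi)"
  have "\<bar>(Q ^ S) $ N - exp (- (real N - real S * m)\<^sup>2 / (2 * v * real S)) / sqrt (2 * pi * v * real S)\<bar>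
      \<le> C' * (1 + \<bar>real N - real S * m\<bar>) / (real S * sqrt (real S))" if S: "S \<ge> 2" for S N
  proof -
    define t where "t = real N - real S * m"
    define f where "f = (\<lambda>u. indicator {-pi..pi} u * Re (psi u ^ S * iexp (- t * u)))"
    define h where "h = (\<lambda>u. exp (- (v * real S * u\<^sup>2) / 2) * cos (t * u))"
    have pos: "v * real S > 0" "c * real S > 0" using S v_pos c by auto
    have f: "integrable lborel f" "integral\<^sup>L lborel f = 2 * pi * (Q ^ S) $ N"
      unfolding f_def t_def by (rule fourier_inversion)+
    have h: "integrable lborel h" "integral\<^sup>L lborel h = sqrt (2 * pi / (v * real S)) * exp (- t\<^sup>2 / (2 * (v * real S)))"
      unfolding h_def by (rule gaussian_cos_integral[OF pos(1)])+
    have int: "integrable lborel (\<lambda>u. C * (1 + \<bar>t\<bar>) / real S * exp (- (c * real S * u\<^sup>2) / 2))"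
      using gaussian_cos_integral(1)[OF pos(2)] by simp
    have "norm (LINT u|lborel. f u - h u) \<le> (LINT u|lborel. norm (f u - h u))"
      by (rule integral_norm_bound)
    also have "\<dots> \<le> (LINT u|lborel. C * (1 + \<bar>t\<bar>) / real S * exp (- (c * real S * u\<^sup>2) / 2))"
      using approx[OF S] f(1) h(1) by (intro integral_mono int) (auto simp: f_def h_def)
    also have "\<dots> = C * (1 + \<bar>t\<bar>) / real S * sqrt (2 * pi / (c * real S))"
      using gaussian_cos_integral(3)[OF pos(2)] by simp
    finally have "\<bar>2 * pi * (Q ^ S) $ N - sqrt (2 * pi / (v * real S)) * exp (- t\<^sup>2 / (2 * (v * real S)))\<bar>
        \<le> C * (1 + \<bar>t\<bar>) / real S * sqrt (2 * pi / (c * real S))"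
      using f h by simp
    then have "\<bar>2 * pi * (Q ^ S) $ N - sqrt (2 * pi / (v * real S)) * exp (- t\<^sup>2 / (2 * (v * real S)))\<bar> / (2 * pi)
        \<le> C * (1 + \<bar>t\<bar>) / real S * sqrt (2 * pi / (c * real S)) / (2 * pi)"
      by (intro divide_right_mono) auto
    also have "\<bar>2 * pi * (Q ^ S) $ N - sqrt (2 * pi / (v * real S)) * exp (- t\<^sup>2 / (2 * (v * real S)))\<bar> / (2 * pi)
        = \<bar>(2 * pi * (Q ^ S) $ N - sqrt (2 * pi / (v * real S)) * exp (- t\<^sup>2 / (2 * (v * real S)))) / (2 * pi)\<bar>"
      by simp
    also have "(2 * pi * (Q ^ S) $ N - sqrt (2 * pi / (v * real S)) * exp (- t\<^sup>2 / (2 * (v * real S)))) / (2 * pi)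
        = (Q ^ S) $ N - exp (- t\<^sup>2 / (2 * v * real S)) / sqrt (2 * pi * v * real S)"
    proof -
      have "sqrt (2 * pi / (v * real S)) = 2 * pi / sqrt (2 * pi * v * real S)"
      proof -
        have "sqrt (2 * pi / (v * real S)) = sqrt ((2 * pi)\<^sup>2 / (2 * pi * v * real S))"
          using pos by (simp add: power2_eq_square)
        then show ?thesis by (simp only: real_sqrt_divide real_sqrt_abs) simp
      qed
      then show ?thesis by (simp add: diff_divide_distrib mult.assoc)
    qed
    also have "C * (1 + \<bar>t\<bar>) / real S * sqrt (2 * pi / (c * real S)) / (2 * pi)
        = C' * (1 + \<bar>t\<bar>) / (real S * sqrt (real S))"
      by (simp only: C'_def real_sqrt_divide real_sqrt_mult) (simp add: field_simps)
    finally show ?thesis by (simp add: t_def)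
  qed
  moreover have "C' \<ge> 0" using c by (simp add: C'_def)
  ultimately show ?thesis by blast
qed

text \<open>A single coefficient is at most Q(exp h)^S exp(- h N). The centred moment generating
  function has no linear term in \<open>h\<close>, so it is at most exp(K h^2) near 0. Both signs of
  \<open>h\<close> are covered, for the two tails.\<close>

theorem chernoff:
  "\<exists>K>0. \<exists>h0>0. \<forall>S N h. \<bar>h\<bar> \<le> h0 \<longrightarrow> (Q ^ S) $ N \<le> exp (real S * K * h\<^sup>2 - h * (real N - real S * m))"
proof -
  obtain R where R: "R > 1" "summable (\<lambda>k. q k * R ^ k)" using q_radius by blast
  \<comment> \<open>\<open>R\<close> is split in two: in \<open>g\<close> one factor
    \<open>r ^ k\<close> pays for the square and the other for the exponential.\<close>
  define r where "r = sqrt R"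
  have r: "r > 1" "r * r = R" "r < R"
  proof -
    show "r > 1" "r * r = R" using R(1) by (auto simp: r_def)
    then show "r < R" using mult_strict_left_mono[of 1 r r] by simp
  qed
  define h0 where "h0 = ln r"
  have h0: "h0 > 0" "exp h0 = r" using r by (auto simp: h0_def)
  define g where "g = (\<lambda>k. (real k - m)\<^sup>2 * exp (h0 * \<bar>real k - m\<bar>))"
  have sg: "summable (\<lambda>k. q k * g k)"
  proof (rule summable_comparison_test_ev[OF _ summable_mult[OF R(2), of "exp (h0 * \<bar>m\<bar>)"]])
    show "eventually (\<lambda>k. norm (q k * g k) \<le> exp (h0 * \<bar>m\<bar>) * (q k * R ^ k)) sequentially"
      using power_growth[OF r(1), of 2]
    proof eventually_elim
      case (elim k)
      have "exp (h0 * \<bar>real k - m\<bar>) \<le> exp (h0 * (real k + \<bar>m\<bar>))" using h0 by simp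
      also have "\<dots> = r ^ k * exp (h0 * \<bar>m\<bar>)"
        by (simp add: distrib_left exp_add flip: h0(2) exp_of_nat_mult)
      finally have "g k \<le> r ^ k * (r ^ k * exp (h0 * \<bar>m\<bar>))"
        unfolding g_def using elim r by (intro mult_mono) auto
      also have "\<dots> = R ^ k * exp (h0 * \<bar>m\<bar>)" by (simp add: r(2)[symmetric] power_mult_distrib)
      finally have "q k * g k \<le> q k * (R ^ k * exp (h0 * \<bar>m\<bar>))" using q_nonneg by (rule mult_left_mono)
      moreover have "q k * g k \<ge> 0" using q_nonneg by (simp add: g_def)
      ultimately show ?case by (simp add: mult_ac)
    qed
  qed
  \<comment> \<open>The summand 1 makes \<open>K\<close> positive, so that
    \<open>far_from_peak\<close> can divide by it.\<close>
  define K where "K = 1 + (\<Sum>k. q k * g k)"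
  have "(\<Sum>k. q k * g k) \<ge> 0" using q_nonneg by (intro suminf_nonneg sg) (auto simp: g_def)
  then have K: "K > 0" by (simp add: K_def)
  have "(Q ^ S) $ N \<le> exp (real S * K * h\<^sup>2 - h * (real N - real S * m))" if h: "\<bar>h\<bar> \<le> h0" for S N h
  proof -
    have "exp h \<le> r" using h h0 by (metis abs_le_D1 exp_le_cancel_iff)
    moreover have "ereal R \<le> fps_conv_radius Q"
      unfolding fps_conv_radius_def Q_def fps_nth_Abs_fps using conv_radius_geI[OF R(2)] R(1) by simp
    ultimately have rad: "ereal (norm (exp h)) < fps_conv_radius Q"
      using r(3) by (metis abs_exp_cancel ereal_less_ereal_Ex less_ereal.simps(1) less_le_trans order_le_less_trans real_norm_def)
    have radS: "ereal (norm (exp h)) < fps_conv_radius (Q ^ S)"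
      using rad fps_conv_radius_power[of Q S] by (rule less_le_trans)
    have "(Q ^ S) $ N * exp h ^ N \<le> (\<Sum>M. (Q ^ S) $ M * exp h ^ M)"
      using sum_le_suminf[OF summable_fps[OF radS], of "{N}"] Q_power_nonneg by simp
    also have "\<dots> = eval_fps Q (exp h) ^ S"
      using eval_fps_power[OF rad, of S] by (simp add: eval_fps_def)
    finally have 1: "(Q ^ S) $ N * exp h ^ N \<le> eval_fps Q (exp h) ^ S" .
    have "(\<lambda>k. q k * exp h ^ k) sums eval_fps Q (exp h)" using sums_eval_fps[OF rad] by (simp add: Q_def)
    then have "(\<lambda>k. exp (- h * m) * (q k * exp h ^ k)) sums (exp (- h * m) * eval_fps Q (exp h))" by (rule sums_mult)
    moreover have "exp (- h * m) * (q k * exp h ^ k) = q k * exp (h * (real k - m))" for k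
      by (simp add: algebra_simps flip: exp_of_nat_mult exp_add)
    ultimately have 2: "(\<lambda>k. q k * exp (h * (real k - m))) sums (exp (- h * m) * eval_fps Q (exp h))"
      by (simp only:)
    have "(\<lambda>k. q k + h * (q k * (real k - m) ^ 1) + h\<^sup>2 * (q k * g k)) sums (1 + h * mom 1 + h\<^sup>2 * (\<Sum>k. q k * g k))"
      unfolding mom_def by (intro sums_add sums_mult q_sums summable_sums summable_mom sg)
    then have 3: "(\<lambda>k. q k + h * (q k * (real k - m)) + h\<^sup>2 * (q k * g k)) sums (1 + h\<^sup>2 * (\<Sum>k. q k * g k))"
      using mom_1 by simp
    have "exp (- h * m) * eval_fps Q (exp h) \<le> 1 + h\<^sup>2 * (\<Sum>k. q k * g k)"
    proof (rule sums_le[OF _ 2 3])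
      fix k
      have "exp (h * (real k - m)) \<le> 1 + h * (real k - m) + (h * (real k - m))\<^sup>2 * exp \<bar>h * (real k - m)\<bar>"
        by (rule exp_le_quadratic)
      also have "exp \<bar>h * (real k - m)\<bar> \<le> exp (h0 * \<bar>real k - m\<bar>)"
        using h by (simp add: abs_mult mult_right_mono)
      finally have "exp (h * (real k - m)) \<le> 1 + h * (real k - m) + h\<^sup>2 * g k"
        by (simp add: g_def power_mult_distrib mult_left_mono mult.assoc)
      from mult_left_mono[OF this q_nonneg[of k]]
      show "q k * exp (h * (real k - m)) \<le> q k + h * (q k * (real k - m)) + h\<^sup>2 * (q k * g k)"
        by (simp add: algebra_simps)
    qed
    also have "\<dots> \<le> 1 + K * h\<^sup>2" by (simp add: K_def algebra_simps)
    also have "\<dots> \<le> exp (K * h\<^sup>2)" by (rule exp_ge_add_one_self)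
    finally have 4: "eval_fps Q (exp h) \<le> exp (K * h\<^sup>2 + h * m)"
      by (simp add: exp_add exp_minus field_simps)
    have "eval_fps Q (exp h) \<ge> 0" unfolding eval_fps_def using summable_fps[OF rad] q_nonneg by (intro suminf_nonneg) (auto simp: Q_def)
    then have "eval_fps Q (exp h) ^ S \<le> exp (K * h\<^sup>2 + h * m) ^ S" using 4 by (intro power_mono) auto
    then have "(Q ^ S) $ N * exp (h * real N) \<le> exp (real S * (K * h\<^sup>2 + h * m))"
      using 1 by (simp add: mult.commute flip: exp_of_nat_mult)
    then have "(Q ^ S) $ N \<le> exp (real S * (K * h\<^sup>2 + h * m)) / exp (h * real N)"
      by (simp add: field_simps)
    also have "\<dots> = exp (real S * K * h\<^sup>2 - h * (real N - real S * m))"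
      by (simp add: algebra_simps flip: exp_diff)
    finally show ?thesis .
  qed
  then show ?thesis using K h0(1) by blast
qed

end

section \<open>The maximum over the number of steps\<close>

text \<open>\<open>f s n\<close> is the probability that a walk with steps in \<open>1 + d \<nat>\<close>, mean \<open>A\<close> and variance
  \<open>d\<^sup>2 v\<close> is at \<open>n\<close> after \<open>s\<close> steps.\<close>

locale peak_profile =
  fixes f :: "nat \<Rightarrow> nat \<Rightarrow> real" and A v C K h0 :: real and d :: nat
  assumes A: "A \<ge> 1" and v: "v > 0" and C: "C \<ge> 0" and K: "K > 0" and h0: "h0 > 0" and d: "d \<ge> 1"
    and supp: "\<And>s n. f s n \<noteq> 0 \<Longrightarrow> s \<le> n \<and> d dvd n - s"
    and local_limit: "\<And>s n. s \<ge> 2 \<Longrightarrow> s \<le> n \<Longrightarrow> d dvd n - s \<Longrightarrow>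
      \<bar>f s n - exp (- ((real n - real s * A) / real d)\<^sup>2 / (2 * v * real s)) / sqrt (2 * pi * v * real s)\<bar>
        \<le> C * (1 + \<bar>(real n - real s * A) / real d\<bar>) / (real s * sqrt (real s))"
    and chernoff: "\<And>s n h. s \<le> n \<Longrightarrow> d dvd n - s \<Longrightarrow> \<bar>h\<bar> \<le> h0 \<Longrightarrow>
      f s n \<le> exp (real s * K * h\<^sup>2 - h * ((real n - real s * A) / real d))"
begin

text \<open>As a function of \<open>s\<close> the profile is centred at n / A, since n - s A = - A
  (s - n / A). Multiplying by the Gaussian normalisation removes a factor s^(-1/2) from the
  error.\<close>

lemma scaled_local_limit:
  assumes s: "s \<ge> 2" "s \<le> n" "d dvd n - s"
  shows "\<bar>f s n * sqrt (2 * pi * v * real s) - exp (- (A * (real s - real n / A) / real d)\<^sup>2 / (2 * v * real s))\<bar>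
    \<le> sqrt (2 * pi * v) * C * A * (1 + \<bar>real s - real n / A\<bar>) / real s"
proof -
  define t where "t = real s - real n / A"
  have tau: "(real n - real s * A) / real d = - (A * t / real d)"
  proof -
    have "A * t = real s * A - real n" using A by (simp add: t_def right_diff_distrib)
    then show ?thesis by (simp add: minus_divide_left)
  qed
  have q: "sqrt (2 * pi * v * real s) > 0" using v s by simp
  have "\<bar>f s n - exp (- (A * t / real d)\<^sup>2 / (2 * v * real s)) / sqrt (2 * pi * v * real s)\<bar>
      \<le> C * (1 + \<bar>A * t / real d\<bar>) / (real s * sqrt (real s))"
    using local_limit[OF s] unfolding tau by simp
  also have "\<dots> \<le> C * (A * (1 + \<bar>t\<bar>)) / (real s * sqrt (real s))"
  proof (intro divide_right_mono mult_left_mono C)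
    have "\<bar>A * t / real d\<bar> \<le> A * \<bar>t\<bar>"
      using A d mult_left_mono[of 1 "real d" "A * \<bar>t\<bar>"] by (simp add: abs_mult field_simps)
    then show "1 + \<bar>A * t / real d\<bar> \<le> A * (1 + \<bar>t\<bar>)" using A by (simp add: distrib_left)
  qed auto
  finally have "\<bar>f s n - exp (- (A * t / real d)\<^sup>2 / (2 * v * real s)) / sqrt (2 * pi * v * real s)\<bar> * sqrt (2 * pi * v * real s)
      \<le> C * (A * (1 + \<bar>t\<bar>)) / (real s * sqrt (real s)) * sqrt (2 * pi * v * real s)"
    using q by (intro mult_right_mono) auto
  also have "\<bar>f s n - exp (- (A * t / real d)\<^sup>2 / (2 * v * real s)) / sqrt (2 * pi * v * real s)\<bar> * sqrt (2 * pi * v * real s)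
      = \<bar>(f s n - exp (- (A * t / real d)\<^sup>2 / (2 * v * real s)) / sqrt (2 * pi * v * real s)) * sqrt (2 * pi * v * real s)\<bar>"
    using q by (simp only: abs_mult abs_of_pos)
  also have "(f s n - exp (- (A * t / real d)\<^sup>2 / (2 * v * real s)) / sqrt (2 * pi * v * real s)) * sqrt (2 * pi * v * real s)
      = f s n * sqrt (2 * pi * v * real s) - exp (- (A * t / real d)\<^sup>2 / (2 * v * real s))"
    using v s by (simp only: left_diff_distrib) simp
  also have "C * (A * (1 + \<bar>t\<bar>)) / (real s * sqrt (real s)) * sqrt (2 * pi * v * real s)
      = sqrt (2 * pi * v) * C * A * (1 + \<bar>t\<bar>) / real s"
    using s by (simp add: real_sqrt_mult)
  finally show ?thesis unfolding t_def .
qed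

lemma sqrt_rescale:
  assumes "s \<ge> 1"
  shows "sqrt (2 * pi * v * (real n / A)) = sqrt (real n / A / real s) * sqrt (2 * pi * v * real s)"
  using assms by (simp flip: real_sqrt_mult)

text \<open>The normalised value differs from 1 for three reasons, each O(1 / n) at bounded
  distance: the local limit error, the Gaussian factor \<open>exp (- y)\<close>, and
  \<open>x\<close>, which accounts for n / A in place of \<open>s\<close> under the root.\<close>

lemma near_peak:
  assumes D: "D \<ge> 0"
  shows "\<exists>G\<ge>0. \<exists>n1. \<forall>n\<ge>n1. \<forall>s. \<bar>real s - real n / A\<bar> \<le> D \<longrightarrow> s \<le> n \<longrightarrow> d dvd n - s \<longrightarrow>
    \<bar>f s n * sqrt (2 * pi * v * (real n / A)) - 1\<bar> \<le> G / real n"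
proof -
  define E where "E = 2 * (sqrt (2 * pi * v) * C * A * (1 + D))"
  define G where "G = 2 * E + 2 * ((A * D)\<^sup>2 / v) + 2 * D"
  have E0: "E \<ge> 0" using v C A D by (simp add: E_def)
  have G0: "G \<ge> 0" using E0 v D by (simp add: G_def)
  have main: "\<bar>f s n * sqrt (2 * pi * v * (real n / A)) - 1\<bar> \<le> (G * A) / real n"
    if n: "n \<ge> nat \<lceil>A * (2 * D + 4)\<rceil>" and sD: "\<bar>real s - real n / A\<bar> \<le> D" and s: "s \<le> n" "d dvd n - s" for n s
  proof -
    define N where "N = real n / A"
    have "A * (2 * D + 4) \<le> real n" using n by linarith
    then have N: "N \<ge> 2 * D + 4" using A by (simp add: N_def field_simps)
    \<comment> \<open>N \<ge> 2 D + 4 keeps \<open>s\<close> above N / 2 and at least 2, where the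
      local limit theorem applies.\<close>
    have sN: "real s \<ge> N / 2" "real s \<ge> 2" "real s > 0" "\<bar>real s - N\<bar> \<le> D" using sD N D by (auto simp: N_def)
    define x where "x = sqrt (N / real s)"
    define y where "y = (A * (real s - N) / real d)\<^sup>2 / (2 * v * real s)"
    define z where "z = f s n * sqrt (2 * pi * v * real s)"
    have inv: "1 / real s \<le> 2 / N" using sN N D by (simp add: field_simps)
    have x0: "x \<ge> 0" using N D sN by (simp add: x_def)
    have x1: "\<bar>x - 1\<bar> \<le> 2 * D / N"
    proof -
      have "x * x = N / real s" using N D sN by (simp add: x_def)
      then have "(x - 1) * (x + 1) = N / real s - 1" by (simp add: algebra_simps)
      then have "\<bar>x - 1\<bar> * (x + 1) = \<bar>N / real s - 1\<bar>" using x0 by (metis abs_mult abs_of_nonneg add_nonneg_nonneg zero_le_one)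
      moreover have "\<bar>x - 1\<bar> * 1 \<le> \<bar>x - 1\<bar> * (x + 1)" using x0 by (intro mult_left_mono) auto
      moreover have "\<bar>N / real s - 1\<bar> = \<bar>real s - N\<bar> * (1 / real s)" using sN by (simp add: field_simps abs_if)
      moreover have "\<bar>real s - N\<bar> * (1 / real s) \<le> D * (2 / N)"
        using sN inv D by (intro mult_mono) auto
      ultimately show ?thesis by (simp add: mult_ac)
    qed
    have x2: "x \<le> 2"
    proof -
      have "2 * D / N \<le> 1" using N D by simp
      then show ?thesis using x1 by linarith
    qed
    have y: "0 \<le> y" "y \<le> (A * D)\<^sup>2 / v / N"
    proof -
      show "0 \<le> y" using v by (simp add: y_def)
      have "\<bar>A * (real s - N) / real d\<bar> \<le> A * D"
      proof -
        have "\<bar>A * (real s - N) / real d\<bar> = A * \<bar>real s - N\<bar> / real d" using A by (simp add: abs_mult)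
        also have "\<dots> \<le> A * \<bar>real s - N\<bar> / 1" using A d by (intro divide_left_mono) auto
        also have "\<dots> \<le> A * D" using sN A by simp
        finally show ?thesis .
      qed
      then have "(A * (real s - N) / real d)\<^sup>2 \<le> (A * D)\<^sup>2" by (metis abs_ge_zero power2_abs power_mono)
      then have "y \<le> (A * D)\<^sup>2 / (2 * v * real s)" unfolding y_def using v by (intro divide_right_mono) auto
      also have "\<dots> = (A * D)\<^sup>2 / (2 * v) * (1 / real s)" by simp
      also have "\<dots> \<le> (A * D)\<^sup>2 / (2 * v) * (2 / N)" using inv v by (intro mult_left_mono) auto
      finally show "y \<le> (A * D)\<^sup>2 / v / N" by simp
    qed
    have ey: "\<bar>exp (- y) - 1\<bar> \<le> y" using exp_ge_add_one_self[of "- y"] y(1) by simp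
    have "\<bar>z - exp (- y)\<bar> \<le> sqrt (2 * pi * v) * C * A * (1 + \<bar>real s - N\<bar>) / real s"
      using scaled_local_limit[of s n] s sN(2) by (simp add: z_def y_def N_def)
    also have "\<dots> = sqrt (2 * pi * v) * C * A * (1 + \<bar>real s - N\<bar>) * (1 / real s)" by simp
    also have "\<dots> \<le> sqrt (2 * pi * v) * C * A * (1 + D) * (2 / N)"
      using sN inv v C A D by (intro mult_mono mult_left_mono) auto
    finally have z: "\<bar>z - exp (- y)\<bar> \<le> E / N" by (simp add: E_def mult_ac)
    have "f s n * sqrt (2 * pi * v * N) = x * z"
      using sqrt_rescale[of s n] sN by (simp add: z_def x_def N_def)
    then have "\<bar>f s n * sqrt (2 * pi * v * N) - 1\<bar> = \<bar>x * (z - exp (- y)) + x * (exp (- y) - 1) + (x - 1)\<bar>"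
      by (simp add: algebra_simps)
    also have "\<dots> \<le> x * \<bar>z - exp (- y)\<bar> + x * \<bar>exp (- y) - 1\<bar> + \<bar>x - 1\<bar>"
      using x0 abs_triangle_ineq[of "x * (z - exp (- y)) + x * (exp (- y) - 1)" "x - 1"]
        abs_triangle_ineq[of "x * (z - exp (- y))" "x * (exp (- y) - 1)"] by (simp add: abs_mult)
    also have "\<dots> \<le> 2 * (E / N) + 2 * ((A * D)\<^sup>2 / v / N) + 2 * D / N"
      using x0 x2 z ey y E0 N D v x1 by (intro add_mono mult_mono) auto
    also have "\<dots> = G / N" by (simp add: G_def add_divide_distrib)
    finally show ?thesis by (simp add: N_def)
  qed
  moreover have "G * A \<ge> 0" using G0 A by simp
  ultimately show ?thesis by blast
qed

text \<open>At distance up to N / 2 the factor sqrt(N / s) is no longer 1 + O(1 / N), but it is at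
  most 1 + |t| / N, which goes into the linear error term.\<close>

lemma profile_upper:
  "\<exists>a>0. \<exists>C4\<ge>0. \<forall>n s. real n / A \<ge> 4 \<longrightarrow> s \<le> n \<longrightarrow> d dvd n - s \<longrightarrow> \<bar>real s - real n / A\<bar> \<le> real n / A / 2 \<longrightarrow>
    f s n * sqrt (2 * pi * v * (real n / A))
      \<le> exp (- (a * (real s - real n / A)\<^sup>2 / (real n / A))) + C4 * (1 + \<bar>real s - real n / A\<bar>) / (real n / A)"
proof -
  \<comment> \<open>In the Gaussian exponent \<open>s\<close> is replaced by its upper bound 2 N,
    which accounts for the 4.\<close>
  define a where "a = A\<^sup>2 / (4 * v * (real d)\<^sup>2)"
  define E where "E = 2 * (sqrt (2 * pi * v) * C * A)"
  have a0: "a > 0" using A v d by (simp add: a_def)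
  have E0: "E \<ge> 0" using v C A by (simp add: E_def)
  have "f s n * sqrt (2 * pi * v * N) \<le> exp (- (a * (real s - N)\<^sup>2 / N)) + (1 + 2 * E) * (1 + \<bar>real s - N\<bar>) / N"
    if N_def: "N = real n / A" and N: "N \<ge> 4" and s: "s \<le> n" "d dvd n - s" and tN: "\<bar>real s - N\<bar> \<le> N / 2" for n s N
  proof -
    define t where "t = real s - N"
    define r where "r = \<bar>t\<bar> / N"
    have sN: "real s \<ge> N / 2" "real s \<ge> 2" "real s > 0" "real s \<le> 2 * N"
      using tN N unfolding abs_le_iff by linarith+
    have r: "0 \<le> r" "r \<le> 1 / 2" using tN N by (auto simp: r_def t_def field_simps)
    define x where "x = sqrt (N / real s)"
    define y where "y = (A * t / real d)\<^sup>2 / (2 * v * real s)"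
    define z where "z = f s n * sqrt (2 * pi * v * real s)"
    have inv: "1 / real s \<le> 2 / N" using sN N by (simp add: field_simps)
    have x0: "x \<ge> 0" using N sN by (simp add: x_def)
    have x1: "x \<le> 1 + r"
      unfolding x_def
    proof (rule real_le_lsqrt)
      have "N * (1 - r) = N - \<bar>t\<bar>" using N by (simp add: r_def field_simps)
      then have "N * (1 - r) \<le> real s" by (simp add: t_def)
      then have "N * (1 - r) * (1 + r)\<^sup>2 \<le> real s * (1 + r)\<^sup>2" by (rule mult_right_mono) simp
      \<comment> \<open>Combined with s \<ge> N (1 - r) this bounds N / s by (1 + r)^2. The product
        is 1 + r (1 - r - r^2), and r \<le> 1/2 makes the bracket nonnegative.\<close>
      moreover have "1 \<le> (1 - r) * (1 + r)\<^sup>2"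
      proof -
        have "r * r \<le> 1 / 2 * (1 / 2)" using r by (intro mult_mono) auto
        then have "0 \<le> r * (1 - r - r * r)" using r by (intro mult_nonneg_nonneg) auto
        then show ?thesis by (simp add: power2_eq_square algebra_simps)
      qed
      then have "N * 1 \<le> N * ((1 - r) * (1 + r)\<^sup>2)" using N by (intro mult_left_mono) auto
      ultimately show "N / real s \<le> (1 + r)\<^sup>2" using sN by (simp add: field_simps)
    qed (use r in auto)
    have ey: "exp (- y) \<le> exp (- (a * t\<^sup>2 / N))"
    proof -
      have "a * t\<^sup>2 / N = (A * t / real d)\<^sup>2 / (2 * v * (2 * N))"
        by (simp add: a_def power_mult_distrib power_divide)
      also have "\<dots> \<le> y" unfolding y_def using sN v by (intro divide_left_mono) auto
      finally show ?thesis by simp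
    qed
    have "z - exp (- y) \<le> sqrt (2 * pi * v) * C * A * (1 + \<bar>t\<bar>) / real s"
      using scaled_local_limit[of s n] s sN(2) by (simp add: z_def y_def N_def t_def)
    also have "\<dots> = sqrt (2 * pi * v) * C * A * (1 + \<bar>t\<bar>) * (1 / real s)" by simp
    also have "\<dots> \<le> sqrt (2 * pi * v) * C * A * (1 + \<bar>t\<bar>) * (2 / N)"
      using inv v C A by (intro mult_left_mono) auto
    also have "\<dots> = E * (1 + \<bar>t\<bar>) / N" by (simp add: E_def mult_ac)
    finally have z: "z \<le> exp (- (a * t\<^sup>2 / N)) + E * (1 + \<bar>t\<bar>) / N" using ey by linarith
    have "f s n * sqrt (2 * pi * v * N) = x * z"
      using sqrt_rescale[of s n] sN by (simp add: z_def x_def N_def)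
    also have "\<dots> \<le> x * (exp (- (a * t\<^sup>2 / N)) + E * (1 + \<bar>t\<bar>) / N)" using z x0 by (rule mult_left_mono)
    also have "\<dots> \<le> (1 + r) * (exp (- (a * t\<^sup>2 / N)) + E * (1 + \<bar>t\<bar>) / N)"
      using x1 E0 N by (intro mult_right_mono) auto
    also have "\<dots> = exp (- (a * t\<^sup>2 / N)) + r * exp (- (a * t\<^sup>2 / N)) + (1 + r) * (E * (1 + \<bar>t\<bar>) / N)"
      by (simp add: algebra_simps)
    also have "\<dots> \<le> exp (- (a * t\<^sup>2 / N)) + (1 + \<bar>t\<bar>) / N * 1 + 2 * (E * (1 + \<bar>t\<bar>) / N)"
      using r a0 N E0 by (intro add_mono mult_mono) (auto simp: r_def divide_right_mono)
    also have "\<dots> = exp (- (a * t\<^sup>2 / N)) + (1 + 2 * E) * (1 + \<bar>t\<bar>) / N"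
      by (simp add: add_divide_distrib algebra_simps)
    finally show ?thesis by (simp add: t_def)
  qed
  moreover have "1 + 2 * E \<ge> 0" using E0 by simp
  ultimately show ?thesis using a0 by blast
qed

lemma ex_near_peak:
  assumes "real n / A \<ge> real d"
  shows "\<exists>s. s \<le> n \<and> d dvd n - s \<and> \<bar>real s - real n / A\<bar> \<le> real d"
proof -
  define N where "N = real n / A"
  have Nn: "N \<le> real n" using A mult_right_mono[of 1 A "real n"] by (simp add: N_def field_simps)
  \<comment> \<open>\<open>n - d * k\<close> is the largest admissible lattice point not exceeding
    \<open>N\<close>.\<close>
  define k where "k = nat \<lceil>(real n - N) / real d\<rceil>"
  have "(real n - N) / real d \<ge> 0" using Nn by simp
  then have k: "real k \<ge> (real n - N) / real d" "real k < (real n - N) / real d + 1"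
    unfolding k_def by linarith+
  then have k': "real (d * k) \<ge> real n - N" "real (d * k) < real n - N + real d"
    using d by (auto simp: field_simps)
  then have "real (d * k) \<le> real n" using assms by (simp add: N_def)
  then have dk: "d * k \<le> n" by linarith
  then have "real (n - d * k) = real n - real (d * k)" by (rule of_nat_diff)
  then show ?thesis using k' dk by (intro exI[of _ "n - d * k"]) (auto simp: N_def)
qed

lemma far_from_peak:
  assumes e: "e > 0"
  shows "\<exists>k>0. \<forall>n s. s \<le> n \<longrightarrow> d dvd n - s \<longrightarrow> \<bar>real s - real n / A\<bar> \<ge> e * (real n / A) \<longrightarrow> f s n \<le> exp (- (k * real n))"
proof -
  \<comment> \<open>This makes the quadratic term s K h^2 at most half of the linear term h |tau|;
    \<open>k\<close> is the half that remains.\<close>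
  define h where "h = min h0 (e / (2 * d * K))"
  have h: "h > 0" "h \<le> h0" "h \<le> e / (2 * d * K)" using h0 e d K by (auto simp: h_def)
  define k where "k = h * e / (2 * d)"
  have k: "k > 0" using h e d by (simp add: k_def)
  have "f s n \<le> exp (- (k * real n))"
    if s: "s \<le> n" "d dvd n - s" and t: "\<bar>real s - real n / A\<bar> \<ge> e * (real n / A)" for s n
  proof -
    define tau where "tau = (real n - real s * A) / real d"
    have "A * (e * (real n / A)) \<le> A * \<bar>real s - real n / A\<bar>" using t A by (intro mult_left_mono) auto
    also have "\<dots> = \<bar>A * (real s - real n / A)\<bar>" using A by (simp add: abs_mult)
    also have "A * (real s - real n / A) = real s * A - real n" using A by (simp add: field_simps)
    finally have "e * real n \<le> \<bar>real n - real s * A\<bar>" using A by simp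
    then have tau: "\<bar>tau\<bar> \<ge> e * real n / d" using d by (simp add: tau_def divide_right_mono)
    define h' where "h' = (if tau \<ge> 0 then h else - h)"
    have h': "\<bar>h'\<bar> \<le> h0" "h'\<^sup>2 = h * h" "h' * tau = h * \<bar>tau\<bar>" using h by (auto simp: h'_def power2_eq_square)
    have "f s n \<le> exp (real s * K * (h * h) - h * \<bar>tau\<bar>)"
      using chernoff[OF s h'(1)] unfolding tau_def[symmetric] h'(2,3) .
    also have "\<dots> \<le> exp (- (k * real n))"
    proof -
      have "real s * K * (h * h) \<le> real n * K * (h * (e / (2 * d * K)))"
        using s h K by (intro mult_mono) auto
      also have "\<dots> = k * real n" using K by (simp add: k_def)
      finally have "real s * K * (h * h) \<le> k * real n" .
      moreover have "h * \<bar>tau\<bar> \<ge> h * (e * real n / d)" using tau h by (intro mult_left_mono) auto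
      moreover have "h * (e * real n / d) = 2 * k * real n" using d by (simp add: k_def)
      ultimately show ?thesis by simp
    qed
    finally show ?thesis .
  qed
  then show ?thesis using k by blast
qed

text \<open>Comparison with a lattice point near \<open>N\<close> first shows that a maximiser has
  nonzero value, hence lies on the lattice. The Chernoff bound then confines it to |t| < e N, where
  \<open>profile_upper\<close> turns the same comparison into a quadratic inequality for
  |t|.\<close>

theorem argmax_near_peak:
  "\<exists>D\<ge>0. \<exists>n0. \<forall>n\<ge>n0. \<forall>s. (\<forall>s'\<ge>1. f s' n \<le> f s n) \<longrightarrow> \<bar>real s - real n / A\<bar> \<le> D \<and> s \<le> n \<and> d dvd n - s"
proof -
  obtain G n1 where G: "G \<ge> 0" and peak: "\<And>n s. n \<ge> n1 \<Longrightarrow> \<bar>real s - real n / A\<bar> \<le> real d \<Longrightarrow> s \<le> n \<Longrightarrow> d dvd n - s \<Longrightarrow>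
    \<bar>f s n * sqrt (2 * pi * v * (real n / A)) - 1\<bar> \<le> G / real n"
    using near_peak[of "real d"] by auto
  obtain a C4 where a: "a > 0" "C4 \<ge> 0" and upper: "\<And>n s. real n / A \<ge> 4 \<Longrightarrow> s \<le> n \<Longrightarrow> d dvd n - s \<Longrightarrow>
    \<bar>real s - real n / A\<bar> \<le> real n / A / 2 \<Longrightarrow> f s n * sqrt (2 * pi * v * (real n / A))
      \<le> exp (- (a * (real s - real n / A)\<^sup>2 / (real n / A))) + C4 * (1 + \<bar>real s - real n / A\<bar>) / (real n / A)"
    using profile_upper by blast
  define C5 where "C5 = G + C4 + 1"
  have C5: "C5 \<ge> 1" using G a by (simp add: C5_def)
  \<comment> \<open>With |t| < e N and N \<ge> 8 C5 the error C5 (1 + |t|) / N is at most 1/4, which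
    forces \<open>y \<le> 1\<close> below.\<close>
  define e where "e = 1 / (8 * C5)"
  have e: "e > 0" "e \<le> 1 / 2" using C5 by (auto simp: e_def field_simps)
  obtain k where k: "k > 0" and far: "\<And>n s. s \<le> n \<Longrightarrow> d dvd n - s \<Longrightarrow> \<bar>real s - real n / A\<bar> \<ge> e * (real n / A) \<Longrightarrow> f s n \<le> exp (- (k * real n))"
    using far_from_peak[OF e(1)] by blast
  have "(\<lambda>n. exp (- (k * real n)) * sqrt (2 * pi * v * (real n / A))) \<longlonglongrightarrow> 0"
    using k v A by real_asymp
  then have "eventually (\<lambda>n. exp (- (k * real n)) * sqrt (2 * pi * v * (real n / A)) < 1 / 2) sequentially"
    by (rule order_tendstoD) simp
  then obtain n2 where n2: "\<And>n. n \<ge> n2 \<Longrightarrow> exp (- (k * real n)) * sqrt (2 * pi * v * (real n / A)) < 1 / 2"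
    unfolding eventually_sequentially by blast
  define B where "B = 2 * C5 / a"
  define n0 where "n0 = 1 + n1 + n2 + nat \<lceil>A * (real d + 1)\<rceil> + nat \<lceil>A * 8 * C5\<rceil> + nat \<lceil>2 * G\<rceil>"
  have main: "\<bar>real s - real n / A\<bar> \<le> B + 1 \<and> s \<le> n \<and> d dvd n - s" if n: "n \<ge> n0" and max: "\<And>s'. s' \<ge> 1 \<Longrightarrow> f s' n \<le> f s n" for n s
  proof -
    define N where "N = real n / A"
    have nn: "n \<ge> 1" "n \<ge> n1" "n \<ge> n2" "n \<ge> nat \<lceil>A * (real d + 1)\<rceil>" "n \<ge> nat \<lceil>A * 8 * C5\<rceil>" "n \<ge> nat \<lceil>2 * G\<rceil>"
      using n unfolding n0_def by linarith+
    have "real n \<ge> A * (real d + 1)" "real n \<ge> A * 8 * C5" and n2G: "real n \<ge> 2 * G" using nn by linarith+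
    then have N: "N \<ge> real d + 1" "N \<ge> 8 * C5" "N \<ge> 4" "N > 0"
    proof -
      show 1: "N \<ge> real d + 1" "N \<ge> 8 * C5"
        using A \<open>real n \<ge> A * (real d + 1)\<close> \<open>real n \<ge> A * 8 * C5\<close> by (auto simp: N_def le_divide_eq mult_ac)
      show "N \<ge> 4" "N > 0" using 1 C5 by linarith+
    qed
    have Nn: "N \<le> real n" using A mult_right_mono[of 1 A "real n"] by (simp add: N_def field_simps)
    obtain s0 where s0: "s0 \<le> n" "d dvd n - s0" "\<bar>real s0 - N\<bar> \<le> real d"
      using ex_near_peak[of n] N by (auto simp: N_def)
    define Z where "Z = sqrt (2 * pi * v * N)"
    have Z: "Z > 0" using v N by (simp add: Z_def)
    have low0: "f s0 n * Z \<ge> 1 - G / real n" using peak[of n s0] nn s0 by (simp add: Z_def N_def)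
    have Gn: "G / real n \<le> 1 / 2" "G / real n \<le> G / N"
    proof -
      show "G / real n \<le> 1 / 2" using n2G nn(1) by (simp add: divide_le_eq)
      show "G / real n \<le> G / N" using Nn G N(4) nn(1) by (intro divide_left_mono mult_pos_pos) auto
    qed
    \<comment> \<open>Only \<open>s' \<ge> 1\<close> compete, so \<open>s0 = 0\<close> must be
      excluded; this is the reason for N \<ge> d + 1 instead of N \<ge> d.\<close>
    have le: "f s0 n \<le> f s n"
    proof (rule max)
      show "s0 \<ge> 1" using s0(3) N(1) by (cases s0) auto
    qed
    have low: "f s n * Z \<ge> 1 - G / real n"
      using low0 mult_right_mono[OF le, of Z] Z by linarith
    then have "f s n * Z \<ge> 1 / 2" using Gn by linarith
    then have "f s n \<noteq> 0" by auto
    then have s: "s \<le> n" "d dvd n - s" using supp by auto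
    have near: "\<bar>real s - N\<bar> < e * N"
    proof (rule ccontr)
      assume "\<not> \<bar>real s - N\<bar> < e * N"
      then have "f s n \<le> exp (- (k * real n))" using far[OF s] by (simp add: N_def)
      then have "f s n * Z \<le> exp (- (k * real n)) * Z" using Z by (intro mult_right_mono) auto
      then show False using n2[OF nn(3)] \<open>f s n * Z \<ge> 1 / 2\<close> by (simp add: Z_def N_def)
    qed
    define t where "t = real s - N"
    define y where "y = a * t\<^sup>2 / N"
    have y: "y \<ge> 0" using a N by (simp add: y_def)
    have "e * N \<le> 1 / 2 * N" using e N by (intro mult_right_mono) auto
    then have "\<bar>t\<bar> \<le> N / 2" using near by (simp add: t_def)
    then have "f s n * Z \<le> exp (- y) + C4 * (1 + \<bar>t\<bar>) / N"
      using upper[of n s] s N by (simp add: Z_def N_def t_def y_def)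
    then have "1 - exp (- y) \<le> G / N + C4 * (1 + \<bar>t\<bar>) / N" using low Gn by linarith
    also have "\<dots> \<le> G * (1 + \<bar>t\<bar>) / N + C4 * (1 + \<bar>t\<bar>) / N"
      using G N by (intro add_mono divide_right_mono) (auto simp: algebra_simps)
    also have "\<dots> \<le> C5 * (1 + \<bar>t\<bar>) / N"
      unfolding C5_def add_divide_distrib[symmetric] using N by (intro divide_right_mono) (auto simp: algebra_simps)
    finally have up: "1 - exp (- y) \<le> C5 * (1 + \<bar>t\<bar>) / N" .
    \<comment> \<open>Once \<open>y \<le> 1\<close> is known, the left side is at least y / 2, so
      the bound becomes quadratic in \<open>t\<close>.\<close>
    have ey: "y / (1 + y) \<le> 1 - exp (- y)"
    proof -
      have "exp (- y) \<le> 1 / (1 + y)"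
        using exp_ge_add_one_self[of y] y by (simp add: exp_minus inverse_eq_divide frac_le)
      moreover have "y / (1 + y) = 1 - 1 / (1 + y)" using y by (simp add: field_simps)
      ultimately show ?thesis by linarith
    qed
    have "y \<le> 1"
    proof (rule ccontr)
      assume "\<not> y \<le> 1"
      then have "1 / 2 < y / (1 + y)" by (simp add: field_simps)
      then have "1 / 2 < C5 * (1 + \<bar>t\<bar>) / N" using ey up by linarith
      also have "\<dots> \<le> C5 * (1 + e * N) / N" using near C5 N by (intro divide_right_mono mult_left_mono) (auto simp: t_def)
      also have "\<dots> = C5 / N + C5 * e" using N by (simp add: field_simps)
      also have "C5 * e = 1 / 8" using C5 by (simp add: e_def)
      also have "C5 / N \<le> 1 / 8" using N C5 by (simp add: field_simps)
      finally show False by simp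
    qed
    then have "y / 2 \<le> y / (1 + y)" using y by (intro divide_left_mono) auto
    then have "y / 2 \<le> C5 * (1 + \<bar>t\<bar>) / N" using ey up by linarith
    then have "a * t\<^sup>2 \<le> 2 * C5 * (1 + \<bar>t\<bar>)" using N by (simp add: y_def field_simps)
    then have q: "t\<^sup>2 \<le> B * (1 + \<bar>t\<bar>)" using a by (simp add: B_def field_simps)
    have "\<bar>t\<bar> \<le> B + 1"
    proof (rule ccontr)
      assume "\<not> \<bar>t\<bar> \<le> B + 1"
      moreover have "B > 0" using a C5 by (simp add: B_def)
      ultimately have "\<bar>t\<bar> > B" "B + 1 \<le> \<bar>t\<bar>" by linarith+
      moreover from mult_left_mono[OF this(2) abs_ge_zero[of t]]
      have "\<bar>t\<bar> * (B + 1) \<le> t * t" by simp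
      ultimately have "B * (1 + \<bar>t\<bar>) < t\<^sup>2" by (simp add: power2_eq_square algebra_simps)
      then show False using q by simp
    qed
    then show ?thesis using s by (simp add: t_def N_def)
  qed
  have "B + 1 \<ge> 0" using a C5 by (simp add: B_def)
  then show ?thesis using main by blast
qed

end

section \<open>The weighted compositions of one\<close>

lemma W_fps_0: "b \<ge> 2 \<Longrightarrow> W_fps b $ 0 = 0"
  using W_1_support[of b 0] by (auto simp: W_fps_def)

lemma W_gf_eq_eval_fps:
  assumes b: "b \<ge> 2" and x: "ereal \<bar>x\<bar> < fps_conv_radius (W_fps b)"
  shows "W_gf b x = eval_fps (W_fps b) x"
proof -
  have r: "ereal (norm x) < fps_conv_radius (W_fps b)" using x by simp
  have "((\<lambda>n. W_fps b $ n * x ^ n) has_sum eval_fps (W_fps b) x) UNIV"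
    using norm_summable_fps[OF r] sums_eval_fps[OF r] by (rule norm_summable_imp_has_sum)
  also have "?this \<longleftrightarrow> ((\<lambda>n. real (W b 1 n) / fact n * x ^ n) has_sum eval_fps (W_fps b) x) {1..}"
  proof (rule has_sum_cong_neutral)
    fix n :: nat assume "n \<in> UNIV - {1..}"
    then have "n = 0" by auto
    then show "W_fps b $ n * x ^ n = 0" using W_fps_0[OF b] by simp
  qed (auto simp: W_fps_def)
  finally show ?thesis unfolding W_gf_def by (rule infsumI)
qed

section \<open>Derivatives of the generating function\<close>

lemma eventually_in_conv_radius:
  fixes f :: "real fps"
  assumes "ereal \<bar>x\<bar> < fps_conv_radius f"
  shows "eventually (\<lambda>y. ereal \<bar>y\<bar> < fps_conv_radius f) (nhds x)"
  using eventually_nhds_in_open[OF open_eball, of x 0 "fps_conv_radius f"] assms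
  by (simp add: in_eball_iff dist_norm)

text \<open>\<open>W_gf\<close> is identified with the power series only inside the disc of
  convergence, so the derivatives are compared through equality near \<open>x\<close>.\<close>

lemma deriv_W_gf:
  assumes b: "b \<ge> 2" and x: "ereal \<bar>x\<bar> < fps_conv_radius (W_fps b)"
  shows "deriv (W_gf b) x = eval_fps (fps_deriv (W_fps b)) x"
proof -
  have "eventually (\<lambda>y. W_gf b y = eval_fps (W_fps b) y) (nhds x)"
    using eventually_in_conv_radius[OF x] by eventually_elim (rule W_gf_eq_eval_fps[OF b])
  then have "deriv (W_gf b) x = deriv (eval_fps (W_fps b)) x" by (rule deriv_cong_ev) simp
  also have "\<dots> = eval_fps (fps_deriv (W_fps b)) x"
    by (rule DERIV_imp_deriv) (use x in \<open>auto intro: has_field_derivative_eval_fps\<close>)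
  finally show ?thesis .
qed

lemma deriv_deriv_W_gf:
  assumes b: "b \<ge> 2" and x: "ereal \<bar>x\<bar> < fps_conv_radius (W_fps b)"
  shows "deriv (deriv (W_gf b)) x = eval_fps (fps_deriv (fps_deriv (W_fps b))) x"
proof -
  have "eventually (\<lambda>y. deriv (W_gf b) y = eval_fps (fps_deriv (W_fps b)) y) (nhds x)"
    using eventually_in_conv_radius[OF x] by eventually_elim (rule deriv_W_gf[OF b])
  then have "deriv (deriv (W_gf b)) x = deriv (eval_fps (fps_deriv (W_fps b))) x" by (rule deriv_cong_ev) simp
  also have "\<dots> = eval_fps (fps_deriv (fps_deriv (W_fps b))) x"
    using x fps_conv_radius_deriv[of "W_fps b"]
    by (intro DERIV_imp_deriv has_field_derivative_eval_fps) (auto intro: less_le_trans)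
  finally show ?thesis .
qed

section \<open>Existence and uniqueness of the root\<close>

lemma ex_theta:
  assumes b: "b \<ge> 2"
  shows "\<exists>\<theta>>0. ereal \<theta> < fps_conv_radius (W_fps b) \<and> eval_fps (W_fps b) \<theta> = 1"
proof -
  obtain x1 x0 where x: "0 < x1" "x1 < x0" "summable (\<lambda>n. W_fps b $ n * x0 ^ n)" "(\<Sum>n. W_fps b $ n * x1 ^ n) > 1"
    using W_fps_radius[OF b] by blast
  have rad: "ereal x0 \<le> fps_conv_radius (W_fps b)"
    unfolding fps_conv_radius_def using conv_radius_geI[OF x(3)] x by simp
  have in_rad: "ereal y < fps_conv_radius (W_fps b)" if "y \<le> x1" for y
  proof -
    have "ereal y < ereal x0" using that x by simp
    then show ?thesis using rad by (rule less_le_trans)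
  qed
  have "continuous_on {0..x1} (eval_fps (W_fps b))"
    by (rule continuous_on_eval_fps') (use in_rad in \<open>auto simp: continuous_on_id\<close>)
  moreover have "eval_fps (W_fps b) 0 \<le> 1" using W_fps_0[OF b] by (simp add: eval_fps_at_0)
  moreover have "eval_fps (W_fps b) x1 \<ge> 1" using x by (simp add: eval_fps_def)
  ultimately obtain t where t: "0 \<le> t" "t \<le> x1" "eval_fps (W_fps b) t = 1"
    using IVT'[of "eval_fps (W_fps b)" 0 1 x1] x by auto
  moreover have "t \<noteq> 0" using t W_fps_0[OF b] by (auto simp: eval_fps_at_0)
  ultimately show ?thesis using in_rad by (intro exI[of _ t]) auto
qed

text \<open>Convergence at \<open>x\<close> and \<open>y\<close> is not assumed: the value 1 differs
  from the default 0 of the infinite sum, so both series converge. They are then compared termwise,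
  strictly at \<open>n = 1\<close>.\<close>

lemma W_gf_eq_1_imp_le:
  assumes b: "b \<ge> 2" and "0 < x" and "W_gf b x = 1" "W_gf b y = 1"
  shows "y \<le> x"
proof (rule ccontr)
  assume xy: "\<not> y \<le> x"
  define f where "f = (\<lambda>x n. real (W b 1 n) / fact n * x ^ n)"
  have hs: "(f z has_sum 1) {1..}" if "W_gf b z = 1" for z
  proof -
    have "infsum (f z) {1..} = 1" using that by (simp add: W_gf_def f_def)
    then show ?thesis using infsum_not_exists[of "f z" "{1..}"] has_sum_infsum[of "f z" "{1..}"] by force
  qed
  have diff: "((\<lambda>n. f y n - f x n) has_sum (1 - 1)) {1..}"
    using has_sum_add[OF hs[OF assms(4)], of "\<lambda>n. - f x n" "-1"] hs[OF assms(3)]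
    by (simp add: has_sum_uminus)
  have nonneg: "f y n - f x n \<ge> 0" for n
  proof -
    have "x ^ n \<le> y ^ n" using xy assms(2) by (intro power_mono) auto
    then have "f x n \<le> f y n" unfolding f_def by (rule mult_left_mono) simp
    then show ?thesis by simp
  qed
  have "sum (\<lambda>n. f y n - f x n) {1} \<le> 1 - 1"
    by (rule finite_sum_le_has_sum[OF diff]) (use nonneg in auto)
  moreover have "f y 1 - f x 1 > 0"
    using W_1_1_pos[OF b] xy by (simp add: f_def)
  ultimately show False by simp
qed

section \<open>The walk attached to the root\<close>

locale weighted_compositions =
  fixes b :: nat and \<theta> :: real
  assumes b: "b \<ge> 2" and theta_pos: "\<theta> > 0"
    and theta_radius: "ereal \<theta> < fps_conv_radius (W_fps b)"
    and theta_eq: "eval_fps (W_fps b) \<theta> = 1"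
begin

definition d where "d = b - 1"
text \<open>A step of size \<open>1 + d * j\<close> is recorded as \<open>j\<close>; this rescaling
  gives the walk span one.\<close>

definition step where "step j = \<theta> ^ (1 + d * j) * W_fps b $ (1 + d * j)"
text \<open>\<open>A\<close> is the mean of the unscaled step.\<close>

definition A where "A = \<theta> * eval_fps (fps_deriv (W_fps b)) \<theta>"
definition prob where "prob s n = \<theta> ^ n * (W_fps b ^ s) $ n"

lemma d_ge_1: "d \<ge> 1" using b by (simp add: d_def)

lemma strict_mono_lattice: "strict_mono (\<lambda>j. 1 + d * j)"
  using d_ge_1 by (auto simp: strict_mono_def)

lemma W_fps_off_lattice: "n \<notin> range (\<lambda>j. 1 + d * j) \<Longrightarrow> W_fps b $ n = 0"
  using W_1_support[OF b, of n] by (auto simp: W_fps_def d_def)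

lemma sums_lattice:
  "(\<lambda>j. h (1 + d * j) * step j) sums c \<longleftrightarrow> (\<lambda>n. h n * (\<theta> ^ n * W_fps b $ n)) sums c"
  unfolding step_def
  by (rule sums_mono_reindex[OF strict_mono_lattice, of "\<lambda>n. h n * (\<theta> ^ n * W_fps b $ n)"])
    (simp add: W_fps_off_lattice)

lemma radius: "ereal (norm \<theta>) < fps_conv_radius (W_fps b)"
  using theta_radius theta_pos by simp

lemma step_sums: "step sums 1"
  using sums_eval_fps[OF radius] sums_lattice[of "\<lambda>_. 1" 1] by (simp add: theta_eq mult.commute)

sublocale lattice_walk step
proof
  show "step k \<ge> 0" for k using theta_pos by (simp add: step_def W_fps_nonneg)
  show "step sums 1" by (rule step_sums)
  show "step 0 > 0" using theta_pos W_fps_1_ge[OF b] by (simp add: step_def)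
  \<comment> \<open>\<open>step 1\<close> belongs to the coefficient at \<open>1 + d = b\<close>,
    which is positive because \<open>b\<close> is a sum of \<open>b\<close> ones.\<close>
  have "0 < W_fps b $ b" using W_fps_b_ge[OF b] by (rule less_le_trans[rotated]) simp
  then show "step 1 > 0" using theta_pos b by (simp add: step_def d_def)
  obtain x0 where x0: "\<theta> < x0" "ereal x0 < fps_conv_radius (W_fps b)"
    using ereal_dense2[OF theta_radius] by auto
  define R where "R = x0 / \<theta>"
  have R: "R > 1" using x0 theta_pos by (simp add: R_def)
  have "summable (\<lambda>n. W_fps b $ n * x0 ^ n)"
    by (rule summable_fps) (use x0 theta_pos in simp)
  then have "summable (\<lambda>j. W_fps b $ (1 + d * j) * x0 ^ (1 + d * j))"
    using summable_mono_reindex[OF strict_mono_lattice, of "\<lambda>n. W_fps b $ n * x0 ^ n"] W_fps_off_lattice by simp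
  then have "summable (\<lambda>j. step j * R ^ j)"
  proof (rule summable_comparison_test')
    fix j
    \<comment> \<open>The inequality \<open>j \<le> 1 + d * j\<close> lets a radius in the original
      variable serve for the rescaled index.\<close>
    have "1 * j \<le> d * j" using d_ge_1 by (rule mult_le_mono1)
    then have "j \<le> 1 + d * j" by linarith
    then have "step j * R ^ j \<le> step j * R ^ (1 + d * j)"
      using R theta_pos W_fps_nonneg by (intro mult_left_mono power_increasing) (auto simp: step_def)
    also have "\<dots> = W_fps b $ (1 + d * j) * (\<theta> * R) ^ (1 + d * j)"
      by (simp only: step_def power_mult_distrib mult_ac)
    also have "\<theta> * R = x0" using theta_pos by (simp add: R_def)
    finally show "norm (step j * R ^ j) \<le> W_fps b $ (1 + d * j) * x0 ^ (1 + d * j)"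
      using R theta_pos W_fps_nonneg by (simp add: step_def)
  qed
  then show "\<exists>R>1. summable (\<lambda>k. step k * R ^ k)" using R by blast
qed

lemma sums_first_moment: "(\<lambda>n. real n * (\<theta> ^ n * W_fps b $ n)) sums A"
proof -
  have "ereal (norm \<theta>) < fps_conv_radius (fps_deriv (W_fps b))"
    using radius fps_conv_radius_deriv by (rule less_le_trans)
  from sums_mult[OF sums_eval_fps[OF this], of \<theta>]
  have "(\<lambda>n. real (Suc n) * (\<theta> ^ Suc n * W_fps b $ Suc n)) sums A"
    unfolding A_def by (simp add: mult_ac)
  from sums_Suc_imp[OF _ this] show ?thesis by simp
qed

lemma sums_second_moment:
  "(\<lambda>n. real n * (real n - 1) * (\<theta> ^ n * W_fps b $ n)) sums (\<theta>\<^sup>2 * eval_fps (fps_deriv (fps_deriv (W_fps b))) \<theta>)"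
proof -
  have "ereal (norm \<theta>) < fps_conv_radius (fps_deriv (fps_deriv (W_fps b)))"
    using radius fps_conv_radius_deriv fps_conv_radius_deriv by (meson less_le_trans)
  from sums_mult[OF sums_eval_fps[OF this], of "\<theta>\<^sup>2"]
  have "(\<lambda>n. real (Suc (Suc n)) * (real (Suc (Suc n)) - 1) * (\<theta> ^ Suc (Suc n) * W_fps b $ Suc (Suc n)))
      sums (\<theta>\<^sup>2 * eval_fps (fps_deriv (fps_deriv (W_fps b))) \<theta>)"
    by (simp add: power2_eq_square algebra_simps)
  from sums_Suc_imp[OF _ this]
  have "(\<lambda>n. real (Suc n) * (real (Suc n) - 1) * (\<theta> ^ Suc n * W_fps b $ Suc n))
      sums (\<theta>\<^sup>2 * eval_fps (fps_deriv (fps_deriv (W_fps b))) \<theta>)" by simp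
  from sums_Suc_imp[OF _ this] show ?thesis by simp
qed

lemma A_eq: "A = 1 + real d * m"
proof -
  have "(\<lambda>j. real (1 + d * j) * step j) sums A" using sums_first_moment sums_lattice[of real A] by simp
  moreover have "(\<lambda>j. step j + real d * (step j * real j)) sums (1 + real d * m)"
    unfolding m_def by (intro sums_add sums_mult step_sums summable_sums summable_mean)
  then have "(\<lambda>j. real (1 + d * j) * step j) sums (1 + real d * m)"
    by (simp add: algebra_simps)
  ultimately show ?thesis by (rule sums_unique2)
qed

lemma A_ge_1: "A \<ge> 1"
proof -
  have "m \<ge> 0" unfolding m_def using q_nonneg by (intro suminf_nonneg summable_mean) auto
  then show ?thesis by (simp add: A_eq)
qed

text \<open>For the unscaled step X both sides are its variance, written on the right as E X(X - 1)
  + E X - (E X)^2.\<close>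

lemma variance_eq: "(real d)\<^sup>2 * v = \<theta>\<^sup>2 * eval_fps (fps_deriv (fps_deriv (W_fps b))) \<theta> + A - A\<^sup>2"
proof -
  define B where "B = \<theta>\<^sup>2 * eval_fps (fps_deriv (fps_deriv (W_fps b))) \<theta>"
  let ?X = "\<lambda>j. real (1 + d * j)"
  have s2: "(\<lambda>j. ?X j * (?X j - 1) * step j) sums B"
    using sums_second_moment sums_lattice[of "\<lambda>n. real n * (real n - 1)" B] by (simp only: B_def)
  have s1: "(\<lambda>j. ?X j * step j) sums A" using sums_first_moment sums_lattice[of real A] by simp
  have "(\<lambda>j. ?X j * (?X j - 1) * step j + (1 - 2 * A) * (?X j * step j) + A\<^sup>2 * step j)
      sums (B + (1 - 2 * A) * A + A\<^sup>2 * 1)"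
    by (intro sums_add sums_mult s1 s2 step_sums)
  moreover have "?X j * (?X j - 1) * step j + (1 - 2 * A) * (?X j * step j) + A\<^sup>2 * step j
      = (real d)\<^sup>2 * (step j * (real j - m) ^ 2)" for j
  proof -
    have "?X j * (?X j - 1) * step j + (1 - 2 * A) * (?X j * step j) + A\<^sup>2 * step j = (?X j - A)\<^sup>2 * step j"
      by (simp add: power2_eq_square algebra_simps)
    also have "?X j - A = real d * (real j - m)" by (simp add: A_eq algebra_simps)
    finally show ?thesis by (simp add: power_mult_distrib mult_ac)
  qed
  ultimately have "(\<lambda>j. (real d)\<^sup>2 * (step j * (real j - m) ^ 2)) sums (B + (1 - 2 * A) * A + A\<^sup>2 * 1)" by simp
  moreover have "(\<lambda>j. (real d)\<^sup>2 * (step j * (real j - m) ^ 2)) sums ((real d)\<^sup>2 * v)"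
    unfolding mom_def by (intro sums_mult summable_sums summable_mom)
  ultimately have "B + (1 - 2 * A) * A + A\<^sup>2 * 1 = (real d)\<^sup>2 * v" by (rule sums_unique2)
  then show ?thesis by (simp add: B_def power2_eq_square algebra_simps)
qed

text \<open>By the lattice support W(\<theta> x) = x Q(x^d), and the \<open>s\<close>-th power is
  x^s Q(x^d)^s.\<close>

lemma prob_eq:
  "prob s n = (if s \<le> n \<and> d dvd n - s then (Q ^ s) $ ((n - s) div d) else 0)"
proof -
  let ?P = "fps_compose (W_fps b) (fps_const \<theta> * fps_X)"
  have "?P = fps_X * (Q oo fps_X ^ d)"
  proof (rule fps_ext)
    fix n
    show "?P $ n = (fps_X * (Q oo fps_X ^ d)) $ n"
    proof (cases n)
      case 0
      then show ?thesis by (simp add: fps_compose_linear W_fps_0[OF b])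
    next
      case (Suc k)
      show ?thesis
      proof (cases "d dvd k")
        case True
        then show ?thesis
          by (simp add: Suc fps_compose_linear fps_nth_compose_X_power Q_def step_def)
      next
        case False
        then have "W_fps b $ Suc k = 0" by (intro W_fps_off_lattice) auto
        then show ?thesis using False by (simp add: Suc fps_compose_linear fps_nth_compose_X_power)
      qed
    qed
  qed
  then have "?P ^ s = fps_X ^ s * (Q ^ s oo fps_X ^ d)"
    using d_ge_1 by (simp add: power_mult_distrib fps_compose_power)
  moreover have "?P ^ s = fps_compose (W_fps b ^ s) (fps_const \<theta> * fps_X)"
    by (rule fps_compose_power) simp
  ultimately have "fps_compose (W_fps b ^ s) (fps_const \<theta> * fps_X) $ n = (fps_X ^ s * (Q ^ s oo fps_X ^ d)) $ n"
    by simp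
  then show ?thesis
    by (simp add: prob_def fps_compose_linear fps_X_power_mult_nth fps_nth_compose_X_power not_less)
qed

lemma W_eq_prob:
  assumes "s \<ge> 1"
  shows "real (W b s n) / fact n = (1 / \<theta>) ^ n * prob s n"
  using W_eq_W_fps_power[OF b assms, of n] theta_pos by (simp add: prob_def power_divide)

lemma prob_le_1: "prob s n \<le> 1"
proof -
  obtain K h0 where "h0 > 0" "\<And>S N h. \<bar>h\<bar> \<le> h0 \<Longrightarrow> (Q ^ S) $ N \<le> exp (real S * K * h\<^sup>2 - h * (real N - real S * m))"
    using chernoff by blast
  \<comment> \<open>The case \<open>h = 0\<close> of the Chernoff bound.\<close>
  from this(2)[of 0] this(1) show ?thesis by (simp add: prob_eq)
qed

lemma center_eq:
  assumes "s \<le> n" "d dvd n - s"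
  shows "real ((n - s) div d) - real s * m = (real n - real s * A) / real d"
proof -
  have "real ((n - s) div d) = real (n - s) / real d" using assms(2) by (rule real_of_nat_div)
  then show ?thesis using assms(1) d_ge_1 by (simp add: of_nat_diff A_eq field_simps)
qed

theorem argmax_and_peak:
  "\<exists>D\<ge>0. \<exists>G\<ge>0. \<exists>n0. \<forall>n\<ge>n0. \<forall>s. (\<forall>s'\<ge>1. prob s' n \<le> prob s n) \<longrightarrow>
    \<bar>real s - real n / A\<bar> \<le> D \<and> \<bar>prob s n * sqrt (2 * pi * v * (real n / A)) - 1\<bar> \<le> G / real n"
proof -
  obtain C where C: "C \<ge> 0" "\<And>S N. S \<ge> 2 \<Longrightarrow>
      \<bar>(Q ^ S) $ N - exp (- (real N - real S * m)\<^sup>2 / (2 * v * real S)) / sqrt (2 * pi * v * real S)\<bar>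
      \<le> C * (1 + \<bar>real N - real S * m\<bar>) / (real S * sqrt (real S))"
    using local_limit by blast
  obtain K h0 where K: "K > 0" "h0 > 0"
    "\<And>S N h. \<bar>h\<bar> \<le> h0 \<Longrightarrow> (Q ^ S) $ N \<le> exp (real S * K * h\<^sup>2 - h * (real N - real S * m))"
    using chernoff by blast
  interpret peak_profile prob A v C K h0 d
  proof
    show "A \<ge> 1" by (rule A_ge_1)
    show "v > 0" by (rule v_pos)
    show "d \<ge> 1" by (rule d_ge_1)
    show "prob s n \<noteq> 0 \<Longrightarrow> s \<le> n \<and> d dvd n - s" for s n by (simp add: prob_eq split: if_splits)
    show "\<bar>prob s n - exp (- ((real n - real s * A) / real d)\<^sup>2 / (2 * v * real s)) / sqrt (2 * pi * v * real s)\<bar>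
        \<le> C * (1 + \<bar>(real n - real s * A) / real d\<bar>) / (real s * sqrt (real s))"
      if "s \<ge> 2" "s \<le> n" "d dvd n - s" for s n
      using C(2)[OF that(1), of "(n - s) div d"] that unfolding center_eq[OF that(2,3)] by (simp add: prob_eq)
    show "prob s n \<le> exp (real s * K * h\<^sup>2 - h * ((real n - real s * A) / real d))"
      if "s \<le> n" "d dvd n - s" "\<bar>h\<bar> \<le> h0" for s n h
      using K(3)[OF that(3), of s "(n - s) div d"] that unfolding center_eq[OF that(1,2)] by (simp add: prob_eq)
  qed (use C K in auto)
  obtain D n0 where D: "D \<ge> 0" "\<And>n s. n \<ge> n0 \<Longrightarrow> (\<forall>s'\<ge>1. prob s' n \<le> prob s n) \<Longrightarrow>
      \<bar>real s - real n / A\<bar> \<le> D \<and> s \<le> n \<and> d dvd n - s"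
    using argmax_near_peak by blast
  obtain G n1 where G: "G \<ge> 0" "\<And>n s. n \<ge> n1 \<Longrightarrow> \<bar>real s - real n / A\<bar> \<le> D \<Longrightarrow> s \<le> n \<Longrightarrow> d dvd n - s \<Longrightarrow>
      \<bar>prob s n * sqrt (2 * pi * v * (real n / A)) - 1\<bar> \<le> G / real n"
    using near_peak[OF D(1)] by blast
  show ?thesis
    by (rule exI[of _ D], rule conjI[OF D(1)], rule exI[of _ G], rule conjI[OF G(1)], rule exI[of _ "max n0 n1"])
      (use D(2) G(2) in auto)
qed

end

section \<open>From the walk to \<open>M\<close>\<close>

lemma W_le_M:
  assumes "b \<ge> 2" "s \<ge> 1"
  shows "W b s n \<le> M b n"
proof -
  have "W b s n \<in> (\<lambda>l. U b l n) ` {l. l \<ge> 1 \<and> digit_sum b l = s}"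
    unfolding W_def using finite_U_values[OF assms(1)] ex_digit_sum[OF assms]
    by (intro Max_in) auto
  then show ?thesis unfolding M_def using finite_U_values[OF assms(1)] by (intro Max_ge) auto
qed

lemma ex_W_eq_M:
  assumes "b \<ge> 2"
  shows "\<exists>s\<ge>1. W b s n = M b n"
proof -
  have "M b n \<in> (\<lambda>l. U b l n) ` {1..}"
    unfolding M_def using finite_U_values[OF assms] by (intro Max_in) auto
  then obtain l where l: "l \<ge> 1" "M b n = U b l n" by auto
  have "digit_sum b l \<ge> 1" by (rule digit_sum_pos[OF assms l(1)])
  moreover from this have "W b (digit_sum b l) n = M b n"
    using U_le_W[OF assms l(1), of n] W_le_M[OF assms, of "digit_sum b l" n] l by simp
  ultimately show ?thesis by blast
qed

lemma M_pos:
  assumes "b \<ge> 2" "n \<ge> 1"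
  shows "M b n \<ge> 1"
proof -
  have "{replicate n 0} \<subseteq> power_reps b n n" by (auto simp: power_reps_def sum_list_replicate)
  then have "1 \<le> U b n n"
    unfolding U_def using card_mono[OF finite_power_reps[OF assms(1)]] by (metis is_singletonI is_singleton_altdef)
  also have "\<dots> \<le> M b n" unfolding M_def using finite_U_values[OF assms(1)] assms(2) by (intro Max_ge) auto
  finally show ?thesis .
qed

context weighted_compositions
begin

text \<open>This is the constant \<lambda> of the asymptotic formula once sigma^2 = d^2 v / A^3 is
  inserted.\<close>

definition lam where "lam = sqrt A / sqrt (2 * pi * v)"

lemma lam_pos: "lam > 0" using A_ge_1 v_pos by (simp add: lam_def)

lemma lam_mult_powr:
  assumes "n \<ge> 1"
  shows "lam * real n powr (- 1 / 2) = 1 / sqrt (2 * pi * v * (real n / A))"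
proof -
  have "real n powr (- 1 / 2) = 1 / sqrt (real n)"
    using assms by (simp add: powr_minus_divide powr_half_sqrt)
  then show ?thesis using A_ge_1 by (simp add: lam_def real_sqrt_divide real_sqrt_mult)
qed

lemma M_eq_prob:
  assumes "s \<ge> 1" "W b s n = M b n"
  shows "real (M b n) / fact n = (1 / \<theta>) ^ n * prob s n"
  using W_eq_prob[OF assms(1), of n] assms(2) by simp

lemma prob_maximal:
  assumes "s \<ge> 1" "W b s n = M b n" "s' \<ge> 1"
  shows "prob s' n \<le> prob s n"
proof -
  have "real (W b s' n) / fact n \<le> real (W b s n) / fact n"
    using W_le_M[OF b assms(3), of n] assms(2) by (simp add: divide_right_mono)
  then have "(1 / \<theta>) ^ n * prob s' n \<le> (1 / \<theta>) ^ n * prob s n"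
    unfolding W_eq_prob[OF assms(3)] W_eq_prob[OF assms(1)] .
  then show ?thesis using theta_pos by (subst (asm) mult_le_cancel_left_pos) auto
qed

lemma M_upper_bound: "real (M b n) / fact n \<le> (1 / \<theta>) ^ n"
proof -
  obtain s where s: "s \<ge> 1" "W b s n = M b n" using ex_W_eq_M[OF b] by blast
  show ?thesis
    unfolding M_eq_prob[OF s] using prob_le_1[of s n] theta_pos by (simp add: mult_left_le)
qed

lemma argmax_bounded:
  "\<exists>C. \<forall>n\<ge>1. \<forall>s\<ge>1. W b s n = M b n \<longrightarrow> \<bar>real s - 1 / A * real n\<bar> \<le> C"
proof -
  obtain D G n0 where D: "\<And>n s. n \<ge> n0 \<Longrightarrow> (\<forall>s'\<ge>1. prob s' n \<le> prob s n) \<Longrightarrow> \<bar>real s - real n / A\<bar> \<le> D"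
    using argmax_and_peak by blast
  have "\<bar>real s - 1 / A * real n\<bar> \<le> max D (2 * real n0)" if n: "n \<ge> 1" and s: "s \<ge> 1" "W b s n = M b n" for n s
  proof (cases "n \<ge> n0")
    case True
    then show ?thesis using D[of n s] prob_maximal[OF s] by simp
  next
    case False
    \<comment> \<open>For the finitely many small \<open>n\<close> a maximiser has positive value,
      so \<open>s \<le> n < n0\<close>.\<close>
    have "prob s n \<noteq> 0" using M_eq_prob[OF s] M_pos[OF b n] by auto
    then have "s \<le> n" by (simp add: prob_eq split: if_splits)
    then have "real s \<le> real n0" using False by simp
    moreover have "1 / A * real n \<le> 1 * real n0" using A_ge_1 False by (intro mult_mono) auto
    moreover have "1 / A * real n \<ge> 0" using A_ge_1 by simp
    ultimately show ?thesis by (auto simp: abs_if)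
  qed
  then show ?thesis by blast
qed

lemma relative_error:
  "\<exists>G\<ge>0. \<exists>n0. \<forall>n\<ge>n0. \<bar>real (M b n) / fact n / (lam * real n powr (- 1 / 2) * (1 / \<theta>) ^ n) - 1\<bar> \<le> G / real n"
proof -
  obtain D G n0 where G: "G \<ge> 0" "\<And>n s. n \<ge> n0 \<Longrightarrow> (\<forall>s'\<ge>1. prob s' n \<le> prob s n) \<Longrightarrow>
      \<bar>prob s n * sqrt (2 * pi * v * (real n / A)) - 1\<bar> \<le> G / real n"
    using argmax_and_peak by blast
  have "\<bar>real (M b n) / fact n / (lam * real n powr (- 1 / 2) * (1 / \<theta>) ^ n) - 1\<bar> \<le> G / real n"
    if n: "n \<ge> max 1 n0" for n
  proof -
    obtain s where s: "s \<ge> 1" "W b s n = M b n" using ex_W_eq_M[OF b] by blast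
    have "real (M b n) / fact n / (lam * real n powr (- 1 / 2) * (1 / \<theta>) ^ n)
        = prob s n * sqrt (2 * pi * v * (real n / A))"
      unfolding M_eq_prob[OF s] using lam_mult_powr[of n] n theta_pos by simp
    then show ?thesis using G(2)[of n s] prob_maximal[OF s] n by simp
  qed
  then show ?thesis using G(1) by blast
qed

text \<open>For c < 1 / \<theta> the quotient of \<open>M b n / fact n\<close> by the main term
  would be at most of order r^n sqrt n with r = c \<theta> < 1, although it tends to 1.\<close>

lemma growth_rate_optimal:
  assumes c: "\<And>n. n \<ge> 1 \<Longrightarrow> real (M b n) / fact n \<le> c ^ n"
  shows "1 / \<theta> \<le> c"
proof (rule ccontr)
  assume "\<not> 1 / \<theta> \<le> c"
  \<comment> \<open>The case \<open>n = 1\<close> excludes nonpositive \<open>c\<close>, so that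
    \<open>r\<close> is positive.\<close>
  have "1 \<le> c" using c[of 1] M_pos[OF b, of 1] by simp
  define r where "r = c * \<theta>"
  have r: "0 < r" "r < 1" using \<open>1 \<le> c\<close> \<open>\<not> 1 / \<theta> \<le> c\<close> theta_pos by (auto simp: r_def field_simps)
  obtain G n0 where G: "G \<ge> 0" "\<And>n. n \<ge> n0 \<Longrightarrow>
      \<bar>real (M b n) / fact n / (lam * real n powr (- 1 / 2) * (1 / \<theta>) ^ n) - 1\<bar> \<le> G / real n"
    using relative_error by blast
  have le: "1 - G / real n \<le> r ^ n / (lam * real n powr (- 1 / 2))" if n: "n \<ge> max 1 n0" for n
  proof -
    have "real n > 0" using n by simp
    then have p: "lam * real n powr (- 1 / 2) > 0" using lam_pos by simp
    have "1 - G / real n \<le> real (M b n) / fact n / (lam * real n powr (- 1 / 2) * (1 / \<theta>) ^ n)"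
      using G(2)[of n] n by (simp add: abs_le_iff)
    also have "\<dots> \<le> c ^ n / (lam * real n powr (- 1 / 2) * (1 / \<theta>) ^ n)"
      using c[of n] n p theta_pos by (intro divide_right_mono) auto
    also have "\<dots> = r ^ n / (lam * real n powr (- 1 / 2))"
      using theta_pos by (simp add: r_def power_mult_distrib power_divide)
    finally show ?thesis .
  qed
  have lim1: "(\<lambda>n. 1 - G / real n) \<longlonglongrightarrow> 1" by real_asymp
  have lim2: "(\<lambda>n. r ^ n / (lam * real n powr (- 1 / 2))) \<longlonglongrightarrow> 0" using r lam_pos by real_asymp
  have "1 \<le> (0::real)"
    by (rule LIMSEQ_le[OF lim1 lim2]) (use le in blast)
  then show False by simp
qed

end

theorem theorem5:
  fixes b :: nat
  assumes "b \<ge> 2"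
  shows "\<exists>\<theta> \<sigma> :: real.
    (\<theta> > 0 \<and> W_gf b \<theta> = 1 \<and> (\<forall>x>0. W_gf b x = 1 \<longrightarrow> x = \<theta>)) \<and>
    (let W1 = deriv (W_gf b) \<theta>; W2 = deriv (deriv (W_gf b)) \<theta>;
         \<nu> = 1 / \<theta>;
         lam = (real b - 1) / (\<theta> * W1 * \<sigma> * sqrt (2 * pi));
         \<mu> = 1 / (\<theta> * W1)
     in
       (\<sigma> > 0 \<and> \<sigma>\<^sup>2 = W2 / (\<theta> * W1 ^ 3) + 1 / (\<theta>\<^sup>2 * W1\<^sup>2) - 1 / (\<theta> * W1)) \<and>
       (\<forall>n\<ge>1. real (M b n) / fact n \<le> \<nu> ^ n) \<and>
       (\<forall>c::real. (\<forall>n\<ge>1. real (M b n) / fact n \<le> c ^ n) \<longrightarrow> \<nu> \<le> c) \<and>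
       (\<exists>\<epsilon>. \<epsilon> \<in> O(\<lambda>n. real n powr (- 1 / 2)) \<and>
          (\<forall>n\<ge>1. real (M b n) / fact n =
             lam * real n powr (- 1 / 2) * \<nu> ^ n * (1 + \<epsilon> n))) \<and>
       (\<exists>C::real. \<forall>n\<ge>1.
          (\<exists>s\<ge>1. W b s n = M b n) \<and>
          (\<forall>s\<ge>1. W b s n = M b n \<longrightarrow> \<bar>real s - \<mu> * real n\<bar> \<le> C)))"
proof -
  obtain \<theta> where \<theta>: "\<theta> > 0" "ereal \<theta> < fps_conv_radius (W_fps b)" "eval_fps (W_fps b) \<theta> = 1"
    using ex_theta[OF assms] by blast
  interpret weighted_compositions b \<theta> by unfold_locales (use assms \<theta> in auto)
  have rad: "ereal \<bar>\<theta>\<bar> < fps_conv_radius (W_fps b)" using \<theta> by simp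
  define W1 where "W1 = deriv (W_gf b) \<theta>"
  define W2 where "W2 = deriv (deriv (W_gf b)) \<theta>"
  have W1: "\<theta> * W1 = A" by (simp add: W1_def A_def deriv_W_gf[OF assms rad])
  have W1': "W1 = A / \<theta>" using W1 \<theta> by (simp add: field_simps)
  have var: "(real d)\<^sup>2 * v = \<theta>\<^sup>2 * W2 + A - A\<^sup>2"
    using variance_eq by (simp add: W2_def deriv_deriv_W_gf[OF assms rad])
  have A0: "A > 0" using A_ge_1 by simp
  have d_eq: "real d = real b - 1" using assms by (simp add: d_def of_nat_diff)
  \<comment> \<open>With mean \<open>A\<close> and variance d^2 v per step, d^2 v / A^3 is the
    asymptotic variance, per unit of \<open>n\<close>, of the number of steps.\<close>
  define \<sigma> where "\<sigma> = real d * sqrt v / (A * sqrt A)"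
  have \<sigma>: "\<sigma> > 0" using d_ge_1 v_pos A0 by (simp add: \<sigma>_def)
  have theta_gf: "W_gf b \<theta> = 1" using W_gf_eq_eval_fps[OF assms rad] \<theta> by simp
  have uniq: "x = \<theta>" if "x > 0" "W_gf b x = 1" for x
    using W_gf_eq_1_imp_le[OF assms that(1) that(2) theta_gf] W_gf_eq_1_imp_le[OF assms \<theta>(1) theta_gf that(2)]
    by simp
  have sigma2: "\<sigma>\<^sup>2 = W2 / (\<theta> * W1 ^ 3) + 1 / (\<theta>\<^sup>2 * W1\<^sup>2) - 1 / (\<theta> * W1)"
  proof -
    have "\<sigma>\<^sup>2 = (real d)\<^sup>2 * v / (A\<^sup>2 * A)"
      using v_pos A0 by (simp add: \<sigma>_def power_mult_distrib power_divide)
    also have "\<dots> = (real d)\<^sup>2 * v / A ^ 3" by (simp add: power2_eq_square power3_eq_cube)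
    also have "\<dots> = (\<theta>\<^sup>2 * W2 + A - A\<^sup>2) / A ^ 3" by (simp only: var)
    also have "\<dots> = W2 / (\<theta> * W1 ^ 3) + 1 / (\<theta>\<^sup>2 * W1\<^sup>2) - 1 / (\<theta> * W1)"
      unfolding W1' using A0 \<theta> by (simp add: power2_eq_square power3_eq_cube field_simps)
    finally show ?thesis .
  qed
  have lam_eq: "(real b - 1) / (\<theta> * W1 * \<sigma> * sqrt (2 * pi)) = lam"
  proof -
    have "A * \<sigma> = real d * sqrt v / sqrt A" using A0 by (simp add: \<sigma>_def)
    then have "real d / (A * \<sigma> * sqrt (2 * pi)) = real d / (real d * sqrt v / sqrt A * sqrt (2 * pi))"
      by (simp only:)
    also have "\<dots> = lam" using d_ge_1 A0 v_pos by (simp add: lam_def real_sqrt_mult)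
    finally show ?thesis unfolding W1 d_eq .
  qed
  \<comment> \<open>The error is defined by the required equation, so only its size is at issue; it
    turns out to be O(1 / n).\<close>
  define \<epsilon> where "\<epsilon> = (\<lambda>n. real (M b n) / fact n / (lam * real n powr (- 1 / 2) * (1 / \<theta>) ^ n) - 1)"
  have eps_O: "\<epsilon> \<in> O(\<lambda>n. real n powr (- 1 / 2))"
  proof -
    obtain G n0 where G: "G \<ge> 0" "\<And>n. n \<ge> n0 \<Longrightarrow> \<bar>\<epsilon> n\<bar> \<le> G / real n"
      using relative_error unfolding \<epsilon>_def by blast
    have "\<epsilon> \<in> O(\<lambda>n. 1 / real n)"
      by (rule bigoI[of _ G]) (use G in \<open>auto simp: eventually_sequentially\<close>)
    also have "(\<lambda>n. 1 / real n) \<in> O(\<lambda>n. real n powr (- 1 / 2))" by real_asymp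
    finally show ?thesis .
  qed
  have eps_eq: "real (M b n) / fact n = lam * real n powr (- 1 / 2) * (1 / \<theta>) ^ n * (1 + \<epsilon> n)" if "n \<ge> 1" for n
    using that lam_pos \<theta> by (simp add: \<epsilon>_def)
  obtain C where C: "\<And>n s. n \<ge> 1 \<Longrightarrow> s \<ge> 1 \<Longrightarrow> W b s n = M b n \<Longrightarrow> \<bar>real s - 1 / A * real n\<bar> \<le> C"
    using argmax_bounded by blast
  show ?thesis
  proof (rule exI[of _ \<theta>], rule exI[of _ \<sigma>], unfold Let_def W1_def[symmetric] W2_def[symmetric] lam_eq,
      intro conjI allI impI)
    show "\<exists>\<epsilon>. \<epsilon> \<in> O(\<lambda>n. real n powr (- 1 / 2)) \<and> (\<forall>n\<ge>1. real (M b n) / fact n =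
        lam * real n powr (- 1 / 2) * (1 / \<theta>) ^ n * (1 + \<epsilon> n))"
      using eps_O eps_eq by blast
    show "\<exists>C. \<forall>n\<ge>1. (\<exists>s\<ge>1. W b s n = M b n) \<and>
        (\<forall>s\<ge>1. W b s n = M b n \<longrightarrow> \<bar>real s - 1 / (\<theta> * W1) * real n\<bar> \<le> C)"
      using C ex_W_eq_M[OF assms] unfolding W1 by blast
  qed (use \<theta>(1) theta_gf uniq \<sigma> sigma2 M_upper_bound growth_rate_optimal in blast)+
qed

end
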